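(* Let $\alpha>0$ be fixed and consider a rate $\alpha$ PCF process on the rooted $d$-ary tree $\mathbf{T}_d$, with measure $\mu_{\mathbf{T}_d,\alpha}$. Let $A_k$ be the event that the root cluster has size $k$ ($k$ vertices) in the final distribution. Then, as $k\to\infty$: (i) if $\alpha<d-1$, then $\mu_{\mathbf{T}_d,\alpha}(A_k)\sim C_{d,\alpha}\,k^{-2}$ for some fixed constant $C_{d,\alpha}>0$; (ii) if $\alpha=d-1$, then $\mu_{\mathbf{T}_d,\alpha}(A_k)\sim C_d\,k^{-\left(2-\frac{1}{2d}\right)}$ for some fixed constant $C_d>0$; (iii) if $\alpha>d-1$, then $\mu_{\mathbf{T}_d,\alpha}(A_k)$ decays exponentially in $k$, i.e. there are constants $K,\lambda>0$ (depending on $d,\alpha$) with $\mu_{\mathbf{T}_d,\alpha}(A_k)\le K e^{-\lambda k}$ for all $k$.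
   Context: For a positive integer $d$, the rooted $d$-ary tree $\mathbf{T}_d$ is the infinite rooted tree in which every vertex has exactly $d$ children. Percolation with constant freezing (PCF) at rate $\alpha>0$ on a finite graph $\mathbf{H}=(\mathcal{V}_{\mathbf{H}},\mathcal{E}_{\mathbf{H}})$ is the continuous-time Markov chain $(\eta^t)_{t\ge 0}$ on $\{w,f\}^{\mathcal{V}_{\mathbf{H}}}\times\{0,1\}^{\mathcal{E}_{\mathbf{H}}}$ in which vertices are warm ($w$) or frozen ($f$) and edges are open ($1$) or closed ($0$). Initially all vertices are warm and all edges closed. The clusters of a configuration are the connected components of the graph formed by all vertices and the open edges (isolated vertices count as clusters; openness of paths ignores whether vertices are warm or frozen). Transitions: each closed edge whose two end vertices are both warm opens at rate $1$; each cluster $C$ freezes at rate $\alpha$ (all vertices of $C$ are set to $f$); there are no other transitions. The chain reaches a final configuration $\eta^\infty$ in finite time, so the process is indexed by $t\in[0,\infty]$. The (infinite volume) rate $\alpha$ PCF process on an infinite tree $\mathbf{T}$ is the process $(\eta^t)_{t\in[0,\infty]}$ of configurations on $\mathbf{T}$ which is the local limit of finite volume PCF: for every finite subgraph $\mathbf{\Lambda}$ and every increasing exhaustion $\mathbf{G}_1\subseteq\mathbf{G}_2\subseteq\cdots$ of $\mathbf{T}$ by finite connected subgraphs, the restriction to $\mathbf{\Lambda}$ of rate $\alpha$ PCF on $\mathbf{G}_n$ converges in law to the restriction of $(\eta^t)_{t\in[0,\infty]}$ to $\mathbf{\Lambda}$. (This local limit exists and does not depend on the exhaustion.) $\mu_{\mathbf{T},\alpha}$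 denotes its law; the final distribution is the law of $\eta^\infty$. *)

theory Defs
  imports "HOL-Probability.Probability" "HOL-Library.Landau_Symbols"
begin

datatype 'v graph = Graph (verts: "'v set") (edges: "'v set set")

definition is_graph :: "'v graph \<Rightarrow> bool" where
  "is_graph G \<longleftrightarrow> (\<forall>e\<in>edges G. \<exists>u\<in>verts G. \<exists>v\<in>verts G. u \<noteq> v \<and> e = {u, v})"

definition finite_graph :: "'v graph \<Rightarrow> bool" where
  "finite_graph G \<longleftrightarrow> is_graph G \<and> finite (verts G) \<and> finite (edges G)"

definition subgraph :: "'v graph \<Rightarrow> 'v graph \<Rightarrow> bool" where
  "subgraph H G \<longleftrightarrow> is_graph H \<and> verts H \<subseteq> verts G \<and> edges H \<subseteq> edges G"

definition component :: "'v set set \<Rightarrow> 'v \<Rightarrow> 'v set" where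
  "component E v = {u. (v, u) \<in> {(x, y). {x, y} \<in> E}\<^sup>*}"

definition connected_graph :: "'v graph \<Rightarrow> bool" where
  "connected_graph G \<longleftrightarrow> verts G \<noteq> {} \<and> (\<forall>v\<in>verts G. verts G \<subseteq> component (edges G) v)"

definition exhaustion :: "(nat \<Rightarrow> 'v graph) \<Rightarrow> 'v graph \<Rightarrow> bool" where
  "exhaustion G T \<longleftrightarrow>
     (\<forall>n. finite_graph (G n) \<and> connected_graph (G n) \<and> subgraph (G n) T \<and> subgraph (G n) (G (Suc n))) \<and>
     (\<Union>n. verts (G n)) = verts T \<and> (\<Union>n. edges (G n)) = edges T"

text \<open>A vertex is a word over \<open>{..<d}\<close>; the root is the empty word and the children of
  \<open>xs\<close> are the words \<open>i # xs\<close>.\<close>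

definition d_ary_tree :: "nat \<Rightarrow> nat list graph" where
  "d_ary_tree d = Graph (lists {..<d}) {{xs, i # xs} |xs i. xs \<in> lists {..<d} \<and> i < d}"

text \<open>An element of \<open>{w,f}\<^sup>V \<times> {0,1}\<^sup>E\<close> is given by its set of frozen vertices and its set of
  open edges.\<close>

datatype 'v config = Config (frozen: "'v set") (opened: "'v set set")

definition configs :: "'v graph \<Rightarrow> 'v config set" where
  "configs G = {\<eta>. frozen \<eta> \<subseteq> verts G \<and> opened \<eta> \<subseteq> edges G}"

definition initial_config :: "'v config" where
  "initial_config = Config {} {}"

definition cluster :: "'v config \<Rightarrow> 'v \<Rightarrow> 'v set" where
  "cluster \<eta> v = component (opened \<eta>) v"

definition restrict_config :: "'v graph \<Rightarrow> 'v config \<Rightarrow> 'v config" where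
  "restrict_config \<Lambda> \<eta> = Config (frozen \<eta> \<inter> verts \<Lambda>) (opened \<eta> \<inter> edges \<Lambda>)"

definition generator :: "'s set \<Rightarrow> ('s \<Rightarrow> 's \<Rightarrow> real) \<Rightarrow> 's \<Rightarrow> 's \<Rightarrow> real" where
  "generator S q x y = (if x = y then - (\<Sum>z\<in>S - {x}. q x z) else q x y)"

primrec generator_power :: "'s set \<Rightarrow> ('s \<Rightarrow> 's \<Rightarrow> real) \<Rightarrow> nat \<Rightarrow> 's \<Rightarrow> 's \<Rightarrow> real" where
  "generator_power S q 0 x y = (if x = y then 1 else 0)"
| "generator_power S q (Suc n) x y = (\<Sum>z\<in>S. generator S q x z * generator_power S q n z y)"

text \<open>The entries of the matrix exponential of \<open>t\<close> times the generator, for a finite state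
  space \<open>S\<close> and jump rates \<open>q\<close>.\<close>

definition transition :: "'s set \<Rightarrow> ('s \<Rightarrow> 's \<Rightarrow> real) \<Rightarrow> real \<Rightarrow> 's \<Rightarrow> 's \<Rightarrow> real" where
  "transition S q t x y = (\<Sum>n. t ^ n / fact n * generator_power S q n x y)"

text \<open>The term for a cluster that is already frozen only contributes to the diagonal, which
  the generator ignores.\<close>

definition pcf_rate :: "'v graph \<Rightarrow> real \<Rightarrow> 'v config \<Rightarrow> 'v config \<Rightarrow> real" where
  "pcf_rate G \<alpha> \<eta> \<eta>' =
     (\<Sum>e\<in>{e \<in> edges G. e \<notin> opened \<eta> \<and> e \<inter> frozen \<eta> = {}}.
        if \<eta>' = Config (frozen \<eta>) (insert e (opened \<eta>)) then 1 else 0) +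
     (\<Sum>C\<in>cluster \<eta> ` verts G.
        if \<eta>' = Config (frozen \<eta> \<union> C) (opened \<eta>) then \<alpha> else 0)"

text \<open>Paths are indexed by \<open>[0,\<infinity>]\<close>, represented by the type \<^typ>\<open>ennreal\<close>. The state of every
  single vertex and edge is right-continuous in time and eventually equal to its state at time
  \<open>\<infinity>\<close>. On a finite graph this says that the configuration itself is right-continuous and
  reaches the configuration at time \<open>\<infinity>\<close> in finite time.\<close>

definition regular_path :: "(ennreal \<Rightarrow> bool) \<Rightarrow> bool" where
  "regular_path f \<longleftrightarrow>
     (\<forall>t. \<forall>\<^sub>F s in at_right t. f s = f t) \<and> (\<forall>\<^sub>F s in at_left \<infinity>. f s = f \<infinity>)"

definition paths :: "'v graph \<Rightarrow> (ennreal \<Rightarrow> 'v config) set" where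
  "paths G = {\<eta>. (\<forall>t. \<eta> t \<in> configs G) \<and>
     (\<forall>v\<in>verts G. regular_path (\<lambda>t. v \<in> frozen (\<eta> t))) \<and>
     (\<forall>e\<in>edges G. regular_path (\<lambda>t. e \<in> opened (\<eta> t)))}"

definition path_algebra :: "'v graph \<Rightarrow> (ennreal \<Rightarrow> 'v config) measure" where
  "path_algebra G = sigma (paths G)
     ({{\<eta> \<in> paths G. v \<in> frozen (\<eta> t)} |v t. v \<in> verts G} \<union>
      {{\<eta> \<in> paths G. e \<in> opened (\<eta> t)} |e t. e \<in> edges G})"

definition finite_pcf_law :: "'v graph \<Rightarrow> real \<Rightarrow> (ennreal \<Rightarrow> 'v config) measure \<Rightarrow> bool" where
  "finite_pcf_law G \<alpha> \<nu> \<longleftrightarrow>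
     prob_space \<nu> \<and> sets \<nu> = sets (path_algebra G) \<and>
     (\<forall>(n::nat) (t :: nat \<Rightarrow> real) (x :: nat \<Rightarrow> 'v config).
        t 0 = 0 \<and> mono t \<and> x 0 = initial_config \<and> range x \<subseteq> configs G \<longrightarrow>
        measure \<nu> {\<eta> \<in> space \<nu>. \<forall>i\<le>n. \<eta> (ennreal (t i)) = x i} =
          (\<Prod>i<n. transition (configs G) (pcf_rate G \<alpha>) (t (Suc i) - t i) (x i) (x (Suc i))))"

text \<open>Convergence in law of the restrictions to a finite graph \<open>\<Lambda>\<close> is convergence of all
  finite-dimensional distributions, with \<open>\<infinity>\<close> allowed among the times. The restricted
  configurations take finitely many values, so this is convergence of point probabilities.
  The laws \<open>\<nu> n\<close> are uniquely determined.\<close>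

definition pcf_law :: "'v graph \<Rightarrow> real \<Rightarrow> (ennreal \<Rightarrow> 'v config) measure \<Rightarrow> bool" where
  "pcf_law T \<alpha> \<mu> \<longleftrightarrow>
     prob_space \<mu> \<and> sets \<mu> = sets (path_algebra T) \<and>
     (\<forall>G. exhaustion G T \<longrightarrow>
       (\<exists>\<nu>. (\<forall>n. finite_pcf_law (G n) \<alpha> (\<nu> n)) \<and>
         (\<forall>\<Lambda> J x. finite_graph \<Lambda> \<and> subgraph \<Lambda> T \<and> finite J \<longrightarrow>
           (\<lambda>n. measure (\<nu> n) {\<eta> \<in> space (\<nu> n). \<forall>t\<in>J. restrict_config \<Lambda> (\<eta> t) = x t})
             \<longlonglongrightarrow> measure \<mu> {\<eta> \<in> space \<mu>. \<forall>t\<in>J. restrict_config \<Lambda> (\<eta> t) = x t})))"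

text \<open>Finiteness is needed because the cardinality of an infinite set is \<open>0\<close>.\<close>

definition root_cluster_size ::
    "(ennreal \<Rightarrow> nat list config) measure \<Rightarrow> nat \<Rightarrow> (ennreal \<Rightarrow> nat list config) set" where
  "root_cluster_size \<mu> k =
     {\<eta> \<in> space \<mu>. finite (cluster (\<eta> \<infinity>) []) \<and> card (cluster (\<eta> \<infinity>) []) = k}"

end

theory Submission
  imports Defs "HOL-Library.Sublist" "HOL-Real_Asymp.Real_Asymp"
begin

text \<open>On a finite tree consider, for a subtree \<open>U\<close> containing the root, the events that all vertices of
  \<open>U\<close> are warm at time \<open>t\<close> and that the open edges of \<open>U\<close> are those in a given set. The generator acts
  on their indicators as a triangular linear system, because the number of clusters meeting \<open>U\<close> is
  determined by the number of closed edges of \<open>U\<close>. It follows that all of \<open>U\<close> is warm and all its edges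
  are open with probability \<open>exp (- \<alpha> t)\<close> times one factor \<open>a(t) = (1 - exp (- (1 + \<alpha>) t)) / (1 + \<alpha>)\<close>
  per edge, so by inclusion-exclusion a warm root cluster has the law of a Galton-Watson tree with
  offspring binomial in \<open>d\<close> and \<open>a(t)\<close>. It freezes at rate \<open>\<alpha>\<close>; substituting
  \<open>x = exp (- (1 + \<alpha>) t)\<close> turns the probability that the final root cluster has \<open>k\<close> vertices into
  the number of rooted subtrees of size \<open>k\<close> times an explicit integral over \<open>{0..1}\<close>. The integrand
  concentrates where \<open>a = 1 / d\<close>. This point is interior to the range of \<open>a\<close>, an end point of it, or
  outside of it according to whether \<open>\<alpha>\<close> is less than, equal to or greater than \<open>d - 1\<close>; at the end
  point the integrable singularity of the density changes the exponent.\<close>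

subsection \<open>Finite Markov chains\<close>

text \<open>The number of rooted subtrees with \<open>k\<close> vertices is the Fuss-Catalan number
  \<open>(d * k choose (k - 1)) / k\<close>. It is not estimated: up to the factor
  \<open>d * k + 1\<close>, the binomial coefficient is the reciprocal of the beta integral of
  \<open>u ^ (k - 1) * (1 - u) ^ (d * k + 1 - k)\<close>, and the same function of
  \<open>u = (1 - s) / (1 + \<alpha>)\<close> occurs in the integral for a single shape. So the
  probability is exactly \<open>\<alpha> / (k * (d * k + 1))\<close> times the mean of the weight
  \<open>s powr (- 1 / (1 + \<alpha>))\<close> under a normalised kernel. The prefactor carries
  \<open>k powr (- 2)\<close>. Below the critical rate the mean converges; at the critical rate
  \<open>s\<close> vanishes where the kernel peaks, and since the peak has width of order
  \<open>1 / sqrt k\<close>, the mean grows like \<open>k powr (1 / (2 * d))\<close>. The infinite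
  tree has no generator: its law is known only through limits of restrictions to finite graphs. That
  the root cluster is a given \<open>S\<close> depends only on the edges of \<open>S\<close> and
  those just below it, and the probability turns out to be the same on all finite trees that contain
  these, so no error terms arise in the limit.\<close>

lemma generator_eq_0:
  assumes "x \<in> R" "y \<in> S - R" "\<And>x y. x \<in> R \<Longrightarrow> y \<in> S - R \<Longrightarrow> q x y = 0"
  shows "generator S q x y = 0"
  using assms by (auto simp: generator_def)

text \<open>No product of nonzero rates leads out of \<open>R\<close>. With \<open>R\<close> the
  homogeneous configurations below, identities between test functions have to be checked only
  there.\<close>

lemma generator_power_eq_0:
  assumes "finite S" and R: "\<And>x y. x \<in> R \<Longrightarrow> y \<in> S - R \<Longrightarrow> q x y = 0"
    and "x \<in> R" "y \<in> S - R"
  shows "generator_power S q n x y = 0"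
  using assms(3)
proof (induction n arbitrary: x)
  case 0
  then show ?case using assms(4) by auto
next
  case (Suc n)
  have "generator S q x z * generator_power S q n z y = 0" if "z \<in> S" for z
    using Suc generator_eq_0[OF Suc.prems, of z S q] R that by (cases "z \<in> R") auto
  then show ?case by (simp add: sum.neutral)
qed

text \<open>The recursion puts the new factor on the left. On the right it can be passed on to the
  function that is averaged.\<close>

lemma generator_power_Suc_right:
  assumes "finite S" "x \<in> S" "y \<in> S"
  shows "generator_power S q (Suc n) x y = (\<Sum>z\<in>S. generator_power S q n x z * generator S q z y)"
  using assms(2)
proof (induction n arbitrary: x)
  case 0
  have "(\<Sum>z\<in>S. generator S q x z * (if z = y then 1 else 0)) = generator S q x y"
    "(\<Sum>z\<in>S. (if x = z then 1 else 0) * generator S q z y) = generator S q x y"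
    using assms 0 by (simp_all add: if_distrib if_distribR cong: if_cong)
  then show ?case by simp
next
  case (Suc n)
  have "generator_power S q (Suc (Suc n)) x y
      = (\<Sum>z\<in>S. generator S q x z * generator_power S q (Suc n) z y)"
    by simp
  also have "\<dots> = (\<Sum>z\<in>S. \<Sum>w\<in>S. generator S q x z * (generator_power S q n z w * generator S q w y))"
    by (intro sum.cong refl) (simp add: Suc.IH sum_distrib_left del: generator_power.simps)
  also have "\<dots> = (\<Sum>w\<in>S. \<Sum>z\<in>S. generator S q x z * (generator_power S q n z w * generator S q w y))"
    by (rule sum.swap)
  also have "\<dots> = (\<Sum>w\<in>S. generator_power S q (Suc n) x w * generator S q w y)"
    by (simp add: sum_distrib_right mult.assoc)
  finally show ?case .
qed

lemma generator_power_bound: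
  assumes "finite S" "x \<in> S"
  shows "\<bar>generator_power S q n x y\<bar> \<le> (\<Sum>x\<in>S. \<Sum>y\<in>S. \<bar>generator S q x y\<bar>) ^ n"
    (is "_ \<le> ?M ^ n")
  using assms(2)
proof (induction n arbitrary: x)
  case (Suc n)
  have M: "?M \<ge> 0" by (intro sum_nonneg) auto
  have "\<bar>generator_power S q (Suc n) x y\<bar>
      \<le> (\<Sum>z\<in>S. \<bar>generator S q x z\<bar> * \<bar>generator_power S q n z y\<bar>)"
    by (simp add: order.trans[OF sum_abs] abs_mult)
  also have "\<dots> \<le> (\<Sum>z\<in>S. \<bar>generator S q x z\<bar> * ?M ^ n)"
    by (intro sum_mono mult_left_mono Suc.IH) auto
  also have "\<dots> = (\<Sum>z\<in>S. \<bar>generator S q x z\<bar>) * ?M ^ n"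
    by (simp add: sum_distrib_right)
  also have "\<dots> \<le> ?M * ?M ^ n"
    using M Suc.prems assms(1)
    by (intro mult_right_mono member_le_sum[where f = "\<lambda>x. \<Sum>y\<in>S. \<bar>generator S q x y\<bar>"])
       (auto intro: sum_nonneg)
  finally show ?case by simp
qed simp

lemma summable_transition:
  assumes "finite S" "x \<in> S"
  shows "summable (\<lambda>n. t ^ n / fact n * generator_power S q n x y :: real)"
proof (rule summable_comparison_test')
  define M where "M = (\<Sum>x\<in>S. \<Sum>y\<in>S. \<bar>generator S q x y\<bar>)"
  show "summable (\<lambda>n. inverse (fact n) * (\<bar>t\<bar> * M) ^ n)"
    by (rule summable_exp)
  show "norm (t ^ n / fact n * generator_power S q n x y) \<le> inverse (fact n) * (\<bar>t\<bar> * M) ^ n" for n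
    using mult_left_mono[OF generator_power_bound[OF assms, of q n y], of "\<bar>t\<bar> ^ n / fact n"]
    by (simp add: abs_mult power_abs power_mult_distrib field_simps M_def)
qed

text \<open>Built from the matrix exponential alone, without a path measure, and for every real
  \<open>t\<close>, so that differential equations hold on the whole line.\<close>

definition expect :: "'s set \<Rightarrow> ('s \<Rightarrow> 's \<Rightarrow> real) \<Rightarrow> 's \<Rightarrow> ('s \<Rightarrow> real) \<Rightarrow> real \<Rightarrow> real" where
  "expect S q x f t = (\<Sum>y\<in>S. transition S q t x y * f y)"

definition generator_apply :: "'s set \<Rightarrow> ('s \<Rightarrow> 's \<Rightarrow> real) \<Rightarrow> ('s \<Rightarrow> real) \<Rightarrow> 's \<Rightarrow> real" where
  "generator_apply S q f x = (\<Sum>y\<in>S. generator S q x y * f y)"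

lemma expect_sums:
  assumes "finite S" "x \<in> S"
  shows "(\<lambda>n. t ^ n / fact n * (\<Sum>y\<in>S. generator_power S q n x y * f y)) sums expect S q x f t"
proof -
  have "(\<lambda>n. \<Sum>y\<in>S. t ^ n / fact n * generator_power S q n x y * f y) sums expect S q x f t"
    unfolding expect_def transition_def
    by (intro sums_sum sums_mult2 summable_sums summable_transition assms)
  then show ?thesis
    by (simp add: sum_distrib_left mult.assoc)
qed

lemma expect_0:
  assumes "finite S" "x \<in> S"
  shows "expect S q x f 0 = f x"
proof -
  have "(\<Sum>y\<in>S. (if x = y then 1 else 0) * f y) = f x"
    using assms by (simp add: if_distrib if_distribR cong: if_cong)
  then show ?thesis
    using expect_sums[OF assms, of 0 q f]
      sums_unique2[OF powser_sums_zero[of "\<lambda>n. (\<Sum>y\<in>S. generator_power S q n x y * f y) / fact n"]]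
    by (simp add: field_simps)
qed

text \<open>Kolmogorov's forward equation tested against \<open>f\<close>: termwise differentiation
  shifts the index of the power series, and the generator split off on the right is absorbed into
  \<open>f\<close>.\<close>

lemma expect_has_derivative:
  assumes S: "finite S" "x \<in> S"
  shows "((expect S q x f) has_real_derivative expect S q x (generator_apply S q f) t) (at t)"
proof -
  define c where "c = (\<lambda>f n. (\<Sum>y\<in>S. generator_power S q n x y * f y) / fact n)"
  have sums: "(\<lambda>n. c f n * t ^ n) sums expect S q x f t" for f t
    using expect_sums[OF S, of t q f] by (simp add: c_def field_simps)
  have "diffs (c f) n = c (generator_apply S q f) n" for n
  proof -
    have "(\<Sum>y\<in>S. generator_power S q (Suc n) x y * f y)
        = (\<Sum>y\<in>S. \<Sum>z\<in>S. generator_power S q n x z * (generator S q z y * f y))"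
      using S by (intro sum.cong refl)
        (simp add: generator_power_Suc_right sum_distrib_right mult.assoc del: generator_power.simps)
    also have "\<dots> = (\<Sum>z\<in>S. \<Sum>y\<in>S. generator_power S q n x z * (generator S q z y * f y))"
      by (rule sum.swap)
    also have "\<dots> = (\<Sum>z\<in>S. generator_power S q n x z * generator_apply S q f z)"
      by (simp add: generator_apply_def sum_distrib_left)
    finally show ?thesis
      by (simp add: diffs_def c_def del: generator_power.simps)
  qed
  then have "diffs (c f) = c (generator_apply S q f)" by blast
  moreover have "((\<lambda>t. \<Sum>n. c f n * t ^ n) has_real_derivative (\<Sum>n. diffs (c f) n * t ^ n)) (at t)"
    using sums by (intro termdiffs_strong_converges_everywhere) (auto simp: sums_iff)
  moreover have "expect S q x f = (\<lambda>t. \<Sum>n. c f n * t ^ n)"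
    using sums by (auto simp: sums_iff)
  moreover have "expect S q x (generator_apply S q f) t = (\<Sum>n. c (generator_apply S q f) n * t ^ n)"
    using sums by (auto simp: sums_iff)
  ultimately show ?thesis by simp
qed

lemma expect_cong:
  assumes "finite S" "x \<in> S" "x \<in> R"
    and "\<And>x y. x \<in> R \<Longrightarrow> y \<in> S - R \<Longrightarrow> q x y = 0"
    and "\<And>y. y \<in> S \<Longrightarrow> y \<in> R \<Longrightarrow> f y = g y"
  shows "expect S q x f t = expect S q x g t"
  unfolding expect_def
proof (rule sum.cong)
  fix y assume y: "y \<in> S"
  show "transition S q t x y * f y = transition S q t x y * g y"
  proof (cases "y \<in> R")
    case False
    then have "transition S q t x y = 0"
      using generator_power_eq_0[OF assms(1,4,3)] y by (simp add: transition_def)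
    then show ?thesis by simp
  qed (use assms(5) y in simp)
qed simp

lemma expect_sum:
  "expect S q x (\<lambda>y. \<Sum>i\<in>I. c i * f i y) t = (\<Sum>i\<in>I. c i * expect S q x (f i) t)"
  unfolding expect_def
  by (simp add: sum_distrib_left mult.left_commute sum.swap[of _ S I])

lemma expect_add:
  "expect S q x (\<lambda>y. f y + g y) t = expect S q x f t + expect S q x g t"
  by (simp add: expect_def algebra_simps sum.distrib)

lemma expect_scale:
  "expect S q x (\<lambda>y. c * f y) t = c * expect S q x f t"
  by (simp add: expect_def sum_distrib_left mult.left_commute)

text \<open>The rows of the generator sum to zero, so only increments of \<open>f\<close>
  enter.\<close>

lemma generator_apply_eq:
  assumes "finite S" "x \<in> S"
  shows "generator_apply S q f x = (\<Sum>z\<in>S. q x z * (f z - f x))"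
proof -
  have "generator_apply S q f x = generator S q x x * f x + (\<Sum>z\<in>S - {x}. generator S q x z * f z)"
    unfolding generator_apply_def using assms by (rule sum.remove)
  also have "(\<Sum>z\<in>S - {x}. generator S q x z * f z) = (\<Sum>z\<in>S - {x}. q x z * f z)"
    by (intro sum.cong) (auto simp: generator_def)
  also have "generator S q x x * f x + \<dots> = (\<Sum>z\<in>S - {x}. q x z * (f z - f x))"
    by (simp add: generator_def algebra_simps sum_subtractf sum_distrib_left)
  also have "\<dots> = (\<Sum>z\<in>S. q x z * (f z - f x))"
    using assms by (simp add: sum.remove[of S x])
  finally show ?thesis .
qed

text \<open>The integrating factor \<open>exp (c * t)\<close> makes the difference of two solutions
  constant.\<close>

lemma linear_ode_unique:
  fixes y z r :: "real \<Rightarrow> real"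
  assumes y: "\<And>t. (y has_real_derivative r t - c * y t) (at t)"
    and z: "\<And>t. (z has_real_derivative r t - c * z t) (at t)"
    and "y 0 = z 0"
  shows "y t = z t"
proof -
  have "((\<lambda>t. (y t - z t) * exp (c * t)) has_real_derivative 0) (at t)" for t
    by (auto intro!: derivative_eq_intros y z simp: algebra_simps)
  then have "(y t - z t) * exp (c * t) = (y 0 - z 0) * exp (c * 0)"
    by (intro DERIV_isconst_all) blast
  then show ?thesis using assms(3) by simp
qed

subsection \<open>Clusters on trees\<close>

text \<open>An edge is named by its lower end. The root names no edge, as \<open>tl [] = []\<close>
  yields a singleton; hence the recurring \<open>- {[]}\<close>.\<close>

definition parent_edge :: "'a list \<Rightarrow> 'a list set" where
  "parent_edge v = {tl v, v}"

text \<open>The vertex sets of finite subtrees that contain the root; because of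
  \<open>tl [] = []\<close> the root needs no exception.\<close>

definition parent_closed :: "'a list set \<Rightarrow> bool" where
  "parent_closed S \<longleftrightarrow> finite S \<and> [] \<in> S \<and> (\<forall>v\<in>S. tl v \<in> S)"

definition tree_on :: "'a list set \<Rightarrow> 'a list graph" where
  "tree_on V = Graph V (parent_edge ` (V - {[]}))"

lemma verts_tree_on [simp]: "verts (tree_on V) = V"
  and edges_tree_on [simp]: "edges (tree_on V) = parent_edge ` (V - {[]})"
  by (simp_all add: tree_on_def)

lemma d_ary_tree_eq: "d_ary_tree d = tree_on (lists {..<d})"
proof -
  have "{{xs, i # xs} |xs i. xs \<in> lists {..<d} \<and> i < d} = parent_edge ` (lists {..<d} - {[]})"
  proof (intro equalityI subsetI)
    fix e assume "e \<in> {{xs, i # xs} |xs i. xs \<in> lists {..<d} \<and> i < d}"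
    then obtain xs i where "e = parent_edge (i # xs)" "i # xs \<in> lists {..<d} - {[]}"
      by (auto simp: parent_edge_def)
    then show "e \<in> parent_edge ` (lists {..<d} - {[]})" by blast
  next
    fix e assume "e \<in> parent_edge ` (lists {..<d} - {[]})"
    then obtain v where "e = parent_edge v" "v \<in> lists {..<d}" "v \<noteq> []" by blast
    then show "e \<in> {{xs, i # xs} |xs i. xs \<in> lists {..<d} \<and> i < d}"
      by (cases v) (auto simp: parent_edge_def)
  qed
  then show ?thesis by (simp add: d_ary_tree_def tree_on_def)
qed

lemma parent_edge_eq_iff:
  assumes "v \<noteq> []" "w \<noteq> []"
  shows "parent_edge v = parent_edge w \<longleftrightarrow> v = w"
proof
  assume eq: "parent_edge v = parent_edge w"
  show "v = w"
  proof (rule ccontr)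
    assume "v \<noteq> w"
    \<comment> \<open>Otherwise each of the two vertices is the parent of the other, which the
      lengths exclude.\<close>
    then have "v = tl w" "w = tl v" using eq by (auto simp: parent_edge_def doubleton_eq_iff)
    then have "length v = length v - 2" by (metis length_tl diff_diff_left one_add_one)
    then show False using assms by (cases v) auto
  qed
qed simp

lemma inj_on_parent_edge: "inj_on parent_edge (V - {[]})"
  by (auto simp: inj_on_def parent_edge_eq_iff)

lemma is_graph_tree_on:
  assumes "\<And>v. v \<in> V \<Longrightarrow> tl v \<in> V"
  shows "is_graph (tree_on V)"
proof -
  have "tl v \<noteq> v" if "v \<noteq> []" for v :: "'a list" using that by (cases v) auto
  then show ?thesis using assms unfolding is_graph_def by (force simp: parent_edge_def)
qed

text \<open>The vertex at which the climb from \<open>v\<close> through open edges stops. It is a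
  canonical representative of the cluster and replaces reasoning about paths by recursion on
  words.\<close>

primrec cluster_top :: "'a list set set \<Rightarrow> 'a list \<Rightarrow> 'a list" where
  "cluster_top E [] = []"
| "cluster_top E (i # v) = (if parent_edge (i # v) \<in> E then cluster_top E v else i # v)"

lemma cluster_top_eq_self:
  "cluster_top E v = v \<longleftrightarrow> v = [] \<or> parent_edge v \<notin> E"
proof (cases v)
  case (Cons i w)
  \<comment> \<open>The climb never lengthens a word, so it cannot return to the longer
    \<open>i # w\<close>.\<close>
  have "length (cluster_top E u) \<le> length u" for u by (induction u) auto
  from this[of w] have "cluster_top E w \<noteq> i # w" by auto
  then show ?thesis using Cons by simp
qed simp

lemma cluster_top_idem: "cluster_top E (cluster_top E v) = cluster_top E v"
  by (induction v) auto

lemma cluster_top_closed: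
  assumes "\<And>v. v \<in> U \<Longrightarrow> tl v \<in> U" "v \<in> U"
  shows "cluster_top E v \<in> U"
  using assms(2)
proof (induction v)
  case (Cons i v)
  then show ?case using assms(1)[of "i # v"] by auto
qed simp

text \<open>The climb from the lower end of an open edge begins by passing to the upper end.\<close>

lemma cluster_top_edge:
  assumes "E \<subseteq> parent_edge ` (V - {[]})" "{x, y} \<in> E"
  shows "cluster_top E x = cluster_top E y"
proof -
  obtain v where v: "v \<noteq> []" "{x, y} = {tl v, v}" using assms by (auto simp: parent_edge_def)
  obtain i w where "v = i # w" using v(1) by (cases v) auto
  then have "{x, y} = {w, i # w}" and "parent_edge (i # w) \<in> E"
    using v assms(2) by (auto simp: parent_edge_def)
  then show ?thesis by (auto simp: doubleton_eq_iff)
qed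

lemma component_sym: "u \<in> component E v \<Longrightarrow> v \<in> component E u"
proof -
  have "sym {(x, y). {x, y} \<in> E}" by (auto simp: sym_def insert_commute)
  then show "u \<in> component E v \<Longrightarrow> v \<in> component E u"
    unfolding component_def by (auto dest: sym_rtrancl symD)
qed

lemma component_trans:
  "u \<in> component E v \<Longrightarrow> w \<in> component E u \<Longrightarrow> w \<in> component E v"
  unfolding component_def by auto

lemma component_self: "v \<in> component E v"
  unfolding component_def by auto

lemma cluster_top_in_component: "cluster_top E v \<in> component E v"
proof (induction v)
  case (Cons i v)
  have "v \<in> component E (i # v)" if "parent_edge (i # v) \<in> E"
    using that unfolding component_def parent_edge_def by (auto simp: insert_commute)
  then show ?case using Cons component_trans component_self by (auto split: if_splits)
qed (simp add: component_self)

text \<open>Clusters are the fibres of \<open>cluster_top\<close>: an open edge preserves the top,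
  and every vertex is joined to its top.\<close>

lemma component_eq:
  assumes "E \<subseteq> parent_edge ` (V - {[]})"
  shows "component E v = {u. cluster_top E u = cluster_top E v}"
proof (intro equalityI subsetI)
  fix u assume "u \<in> component E v"
  then have "(v, u) \<in> {(x, y). {x, y} \<in> E}\<^sup>*" by (simp add: component_def)
  then have "cluster_top E u = cluster_top E v"
    by (induction rule: rtrancl_induct) (use cluster_top_edge[OF assms] in auto)
  then show "u \<in> {u. cluster_top E u = cluster_top E v}" by simp
next
  fix u assume "u \<in> {u. cluster_top E u = cluster_top E v}"
  then have "u \<in> component E (cluster_top E v)"
    using component_sym[OF cluster_top_in_component[of E u]] by simp
  then show "u \<in> component E v"
    by (rule component_trans[OF cluster_top_in_component])
qed

text \<open>In a tree a set that contains with every vertex its parent meets one cluster for each of its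
  vertices whose parent edge is closed.\<close>

lemma card_cluster_image:
  assumes "opened \<eta> \<subseteq> parent_edge ` (V - {[]})" "parent_closed U"
  shows "card (cluster \<eta> ` U) = card {v \<in> U. v = [] \<or> parent_edge v \<notin> opened \<eta>}"
proof -
  let ?top = "cluster_top (opened \<eta>)"
  \<comment> \<open>Climbing stays inside a parent closed set, so the tops of \<open>U\<close> are
    the fixed points of \<open>cluster_top\<close> in \<open>U\<close>, one for each
    cluster.\<close>
  have img: "?top ` U = {v \<in> U. v = [] \<or> parent_edge v \<notin> opened \<eta>}"
  proof (intro equalityI subsetI)
    fix w assume "w \<in> ?top ` U"
    then obtain v where v: "v \<in> U" "w = ?top v" by auto
    then have "w \<in> U" using cluster_top_closed assms(2) by (metis parent_closed_def)
    moreover have "?top w = w" using v by (simp add: cluster_top_idem)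
    ultimately show "w \<in> {v \<in> U. v = [] \<or> parent_edge v \<notin> opened \<eta>}"
      by (simp add: cluster_top_eq_self)
  next
    fix w assume "w \<in> {v \<in> U. v = [] \<or> parent_edge v \<notin> opened \<eta>}"
    then have "w \<in> U" "?top w = w" by (auto simp: cluster_top_eq_self)
    then show "w \<in> ?top ` U" by (metis imageI)
  qed
  have "cluster \<eta> ` U = (\<lambda>x. {u. ?top u = x}) ` ?top ` U"
    by (auto simp: cluster_def component_eq[OF assms(1)] image_image)
  moreover have "inj_on (\<lambda>x. {u. ?top u = x}) (?top ` U)"
  proof (rule inj_onI)
    fix x y assume "x \<in> ?top ` U" "{u. ?top u = x} = {u. ?top u = y}"
    then have x: "?top x = x" using cluster_top_idem by blast
    then have "x \<in> {u. ?top u = x}" by simp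
    then have "?top x = y" unfolding \<open>{u. ?top u = x} = _\<close> by simp
    then show "x = y" using x by simp
  qed
  ultimately show ?thesis using img by (simp add: card_image)
qed

section \<open>The generator on finite trees\<close>

lemma finite_configs:
  assumes "finite_graph G" shows "finite (configs G)"
proof -
  have "configs G \<subseteq> (\<lambda>(F, E). Config F E) ` (Pow (verts G) \<times> Pow (edges G))"
  proof
    fix \<eta> assume "\<eta> \<in> configs G"
    then show "\<eta> \<in> (\<lambda>(F, E). Config F E) ` (Pow (verts G) \<times> Pow (edges G))"
      by (intro image_eqI[of _ _ "(frozen \<eta>, opened \<eta>)"]) (auto simp: configs_def)
  qed
  moreover have "finite (Pow (verts G) \<times> Pow (edges G))"
    using assms by (auto simp: finite_graph_def)
  ultimately show ?thesis by (meson finite_imageI finite_subset)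
qed

lemma component_subset:
  assumes "v \<in> V" "\<And>e. e \<in> E \<Longrightarrow> e \<subseteq> V"
  shows "component E v \<subseteq> V"
proof
  fix u assume "u \<in> component E v"
  then have "(v, u) \<in> {(x, y). {x, y} \<in> E}\<^sup>*" by (simp add: component_def)
  then show "u \<in> V" by (induction rule: rtrancl_induct) (use assms in auto)
qed

text \<open>\<open>pcf_rate\<close> is a sum of indicators of target states, so exchanging
  summations leaves one increment for each transition. A cluster that is frozen already has
  increment zero.\<close>

lemma generator_apply_pcf:
  assumes G: "finite_graph G" and \<eta>: "\<eta> \<in> configs G"
  shows "generator_apply (configs G) (pcf_rate G \<alpha>) f \<eta> =
    (\<Sum>e\<in>{e \<in> edges G. e \<notin> opened \<eta> \<and> e \<inter> frozen \<eta> = {}}.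
        f (Config (frozen \<eta>) (insert e (opened \<eta>))) - f \<eta>) +
    (\<Sum>C\<in>cluster \<eta> ` verts G. \<alpha> * (f (Config (frozen \<eta> \<union> C) (opened \<eta>)) - f \<eta>))"
proof -
  let ?S = "configs G" and ?E = "{e \<in> edges G. e \<notin> opened \<eta> \<and> e \<inter> frozen \<eta> = {}}"
  have fin: "finite ?S" by (rule finite_configs[OF G])
  have pick: "(\<Sum>z\<in>?S. \<Sum>i\<in>I. (if z = h i then c else 0) * (f z - f \<eta>)) = (\<Sum>i\<in>I. c * (f (h i) - f \<eta>))"
    if "\<And>i. i \<in> I \<Longrightarrow> h i \<in> ?S" for I :: "'a set set" and h c
  proof -
    have "(\<Sum>z\<in>?S. \<Sum>i\<in>I. (if z = h i then c else 0) * (f z - f \<eta>))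
        = (\<Sum>i\<in>I. \<Sum>z\<in>?S. if z = h i then c * (f z - f \<eta>) else 0)"
      by (subst sum.swap) (intro sum.cong refl, simp)
    then show ?thesis using fin that by simp
  qed
  have sub: "e \<subseteq> verts G" if "e \<in> opened \<eta>" for e
    using that \<eta> G by (force simp: configs_def finite_graph_def is_graph_def)
  have E: "Config (frozen \<eta>) (insert e (opened \<eta>)) \<in> ?S" if "e \<in> ?E" for e
    using \<eta> that by (auto simp: configs_def)
  have C: "Config (frozen \<eta> \<union> C) (opened \<eta>) \<in> ?S" if "C \<in> cluster \<eta> ` verts G" for C
    using \<eta> that component_subset[of _ "verts G" "opened \<eta>"] sub
    by (auto simp: configs_def cluster_def)
  show ?thesis
    unfolding generator_apply_eq[OF fin \<eta>] pcf_rate_def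
    using pick[where I = ?E and h = "\<lambda>e. Config (frozen \<eta>) (insert e (opened \<eta>))" and c = 1, OF E]
      pick[where I = "cluster \<eta> ` verts G" and h = "\<lambda>C. Config (frozen \<eta> \<union> C) (opened \<eta>)" and c = \<alpha>, OF C]
    by (simp add: distrib_right sum.distrib sum_distrib_right)
qed

lemma finite_graph_tree_on: "parent_closed V \<Longrightarrow> finite_graph (tree_on V)"
  by (simp add: finite_graph_def is_graph_tree_on parent_closed_def)

definition open_below :: "'a list set \<Rightarrow> 'a list config \<Rightarrow> 'a list set" where
  "open_below U \<eta> = {v \<in> U - {[]}. parent_edge v \<in> opened \<eta>}"

definition warm_pattern :: "'a list set \<Rightarrow> 'a list set \<Rightarrow> 'a list config \<Rightarrow> real" where
  "warm_pattern U A \<eta> = of_bool (frozen \<eta> \<inter> U = {} \<and> open_below U \<eta> = A)"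

text \<open>The pattern is entered only by opening the last missing edge of \<open>A\<close>. It is
  left by opening a closed edge of \<open>U\<close> or by freezing a cluster that meets
  \<open>U\<close>. On the pattern there are exactly \<open>card (U - A)\<close> such clusters, so
  the rate of leaving is constant there and the equation involves only patterns with fewer open
  edges besides.\<close>

lemma generator_apply_warm_pattern:
  assumes V: "parent_closed V" and U: "parent_closed U" "U \<subseteq> V" and A: "A \<subseteq> U - {[]}"
    and \<eta>: "\<eta> \<in> configs (tree_on V)"
  shows "generator_apply (configs (tree_on V)) (pcf_rate (tree_on V) \<alpha>) (warm_pattern U A) \<eta> =
    (\<Sum>v\<in>A. warm_pattern U (A - {v}) \<eta>)
    - (real (card (U - {[]} - A)) + \<alpha> * real (card (U - A))) * warm_pattern U A \<eta>"
proof -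
  let ?F = "frozen \<eta>" and ?O = "opened \<eta>" and ?P = "open_below U \<eta>"
  let ?f = "warm_pattern U A"
  have finU: "finite U" using U by (simp add: parent_closed_def)
  have finV: "finite V" using V by (simp add: parent_closed_def)
  have O: "?O \<subseteq> parent_edge ` (V - {[]})" using \<eta> by (simp add: configs_def)
  have tlU: "tl v \<in> U" if "v \<in> U" for v using U that by (simp add: parent_closed_def)
  have "(\<Sum>e\<in>{e \<in> edges (tree_on V). e \<notin> ?O \<and> e \<inter> ?F = {}}. ?f (Config ?F (insert e ?O)) - ?f \<eta>)
      = (\<Sum>e\<in>parent_edge ` {v \<in> V - {[]}. parent_edge v \<notin> ?O \<and> parent_edge v \<inter> ?F = {}}.
          ?f (Config ?F (insert e ?O)) - ?f \<eta>)"
    by (intro sum.cong) auto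
  also have "\<dots> = (\<Sum>v\<in>{v \<in> V - {[]}. parent_edge v \<notin> ?O \<and> parent_edge v \<inter> ?F = {}}.
          ?f (Config ?F (insert (parent_edge v) ?O)) - ?f \<eta>)"
    by (subst sum.reindex) (auto intro: inj_on_subset[OF inj_on_parent_edge[of V]])
  \<comment> \<open>An edge whose lower end is outside \<open>U\<close> does not affect the
    pattern.\<close>
  also have "\<dots> = (\<Sum>v\<in>{v \<in> U - {[]}. parent_edge v \<notin> ?O \<and> parent_edge v \<inter> ?F = {}}.
          ?f (Config ?F (insert (parent_edge v) ?O)) - ?f \<eta>)"
  proof (rule sum.mono_neutral_right)
    show "\<forall>v\<in>{v \<in> V - {[]}. parent_edge v \<notin> ?O \<and> parent_edge v \<inter> ?F = {}} -
        {v \<in> U - {[]}. parent_edge v \<notin> ?O \<and> parent_edge v \<inter> ?F = {}}.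
        ?f (Config ?F (insert (parent_edge v) ?O)) - ?f \<eta> = 0"
    proof
      fix v assume v: "v \<in> {v \<in> V - {[]}. parent_edge v \<notin> ?O \<and> parent_edge v \<inter> ?F = {}} -
        {v \<in> U - {[]}. parent_edge v \<notin> ?O \<and> parent_edge v \<inter> ?F = {}}"
      then have "open_below U (Config ?F (insert (parent_edge v) ?O)) = ?P"
        using parent_edge_eq_iff by (fastforce simp: open_below_def)
      then show "?f (Config ?F (insert (parent_edge v) ?O)) - ?f \<eta> = 0"
        by (simp add: warm_pattern_def)
    qed
  qed (use finV U in auto)
  also have "\<dots> = (\<Sum>v\<in>A. warm_pattern U (A - {v}) \<eta>) - real (card (U - {[]} - A)) * ?f \<eta>"
  proof (cases "?F \<inter> U = {}")
    case False
    then show ?thesis by (simp add: warm_pattern_def)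
  next
    case True
    have PU: "?P \<subseteq> U - {[]}" by (auto simp: open_below_def)
    \<comment> \<open>Both ends of the edge named by a vertex of \<open>U\<close> are in
      \<open>U\<close>, so while \<open>U\<close> is warm all its closed edges may open.\<close>
    have "{v \<in> U - {[]}. parent_edge v \<notin> ?O \<and> parent_edge v \<inter> ?F = {}} = U - {[]} - ?P"
      using True tlU by (auto simp: open_below_def parent_edge_def)
    moreover have "?f (Config ?F (insert (parent_edge v) ?O)) = of_bool (insert v ?P = A)"
      if "v \<in> U - {[]} - ?P" for v
    proof -
      have "open_below U (Config ?F (insert (parent_edge v) ?O)) = insert v ?P"
        using that by (auto simp: open_below_def parent_edge_eq_iff)
      then show ?thesis using True by (simp add: warm_pattern_def)
    qed
    ultimately have "(\<Sum>v\<in>{v \<in> U - {[]}. parent_edge v \<notin> ?O \<and> parent_edge v \<inter> ?F = {}}.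
          ?f (Config ?F (insert (parent_edge v) ?O)) - ?f \<eta>)
        = (\<Sum>v\<in>U - {[]} - ?P. of_bool (insert v ?P = A)) - real (card (U - {[]} - ?P)) * ?f \<eta>"
      by (simp add: sum_subtractf)
    \<comment> \<open>For \<open>v\<close> outside \<open>?P\<close>, \<open>insert v ?P = A\<close>
      says the same as \<open>?P = A - {v}\<close> with \<open>v\<close> in \<open>A\<close>; all
      other terms on either side vanish.\<close>
    also have "(\<Sum>v\<in>U - {[]} - ?P. of_bool (insert v ?P = A)) = (\<Sum>v\<in>A. of_bool (?P = A - {v}) :: real)"
    proof (rule sum.mono_neutral_cong)
      show "finite A" using A finU by (meson finite_Diff finite_subset)
    qed (use finU A PU in auto)
    also have "\<dots> = (\<Sum>v\<in>A. warm_pattern U (A - {v}) \<eta>)"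
      using True by (simp add: warm_pattern_def)
    also have "real (card (U - {[]} - ?P)) * ?f \<eta> = real (card (U - {[]} - A)) * ?f \<eta>"
      by (simp add: warm_pattern_def)
    finally show ?thesis .
  qed
  finally have open_part: "(\<Sum>e\<in>{e \<in> edges (tree_on V). e \<notin> ?O \<and> e \<inter> ?F = {}}.
      ?f (Config ?F (insert e ?O)) - ?f \<eta>)
      = (\<Sum>v\<in>A. warm_pattern U (A - {v}) \<eta>) - real (card (U - {[]} - A)) * ?f \<eta>" .
  \<comment> \<open>Freezing a cluster that meets \<open>U\<close> destroys the pattern; any other
    freezing leaves it alone.\<close>
  have "(\<Sum>C\<in>cluster \<eta> ` V. ?f (Config (?F \<union> C) ?O) - ?f \<eta>)
      = (\<Sum>C\<in>cluster \<eta> ` V. if C \<inter> U \<noteq> {} then - ?f \<eta> else 0)"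
    by (intro sum.cong refl) (auto simp: warm_pattern_def open_below_def)
  also have "\<dots> = (\<Sum>C\<in>{C \<in> cluster \<eta> ` V. C \<inter> U \<noteq> {}}. - ?f \<eta>)"
    using finV by (intro sum.inter_filter[symmetric]) auto
  also have "{C \<in> cluster \<eta> ` V. C \<inter> U \<noteq> {}} = cluster \<eta> ` U"
  proof (intro equalityI subsetI)
    fix C assume "C \<in> {C \<in> cluster \<eta> ` V. C \<inter> U \<noteq> {}}"
    then obtain w u where "C = cluster \<eta> w" "u \<in> U" "u \<in> cluster \<eta> w" by blast
    then have "C = cluster \<eta> u" by (simp add: cluster_def component_eq[OF O])
    then show "C \<in> cluster \<eta> ` U" using \<open>u \<in> U\<close> by blast
  next
    fix C assume "C \<in> cluster \<eta> ` U"
    then show "C \<in> {C \<in> cluster \<eta> ` V. C \<inter> U \<noteq> {}}"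
      using U component_self by (fastforce simp: cluster_def)
  qed
  also have "(\<Sum>C\<in>cluster \<eta> ` U. - ?f \<eta>) = - real (card (U - A)) * ?f \<eta>"
  proof (cases "?P = A")
    case True
    have "card (cluster \<eta> ` U) = card {v \<in> U. v = [] \<or> parent_edge v \<notin> ?O}"
      by (rule card_cluster_image[OF O U(1)])
    also have "{v \<in> U. v = [] \<or> parent_edge v \<notin> ?O} = U - A"
      using True by (auto simp: open_below_def)
    finally show ?thesis by simp
  qed (simp add: warm_pattern_def)
  finally have freeze_part: "(\<Sum>C\<in>cluster \<eta> ` V. ?f (Config (?F \<union> C) ?O) - ?f \<eta>)
      = - real (card (U - A)) * ?f \<eta>" .
  show ?thesis
    unfolding generator_apply_pcf[OF finite_graph_tree_on[OF V] \<eta>] open_part verts_tree_on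
      sum_distrib_left[symmetric] freeze_part
    by (simp add: algebra_simps)
qed

subsection \<open>Warm clusters at a fixed time\<close>

text \<open>The integral of \<open>exp (- (1 + \<alpha>) * s)\<close> over \<open>{0..t}\<close>: an
  edge that opens at time \<open>s\<close> stayed closed until then (\<open>exp (- s)\<close>), and
  one additional cluster had to stay warm (\<open>exp (- \<alpha> * s)\<close>).\<close>

definition edge_open_prob :: "real \<Rightarrow> real \<Rightarrow> real" where
  "edge_open_prob \<alpha> t = (1 - exp (- (1 + \<alpha>) * t)) / (1 + \<alpha>)"

abbreviation pcf_expect :: "'a list set \<Rightarrow> real \<Rightarrow> ('a list config \<Rightarrow> real) \<Rightarrow> real \<Rightarrow> real" where
  "pcf_expect V \<alpha> \<equiv> expect (configs (tree_on V)) (pcf_rate (tree_on V) \<alpha>) initial_config"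

lemma initial_in_configs: "initial_config \<in> configs G"
  by (simp add: initial_config_def configs_def)

lemma finite_configs_tree: "parent_closed V \<Longrightarrow> finite (configs (tree_on V))"
  by (intro finite_configs finite_graph_tree_on)

lemma edge_open_prob_derivative:
  assumes "\<alpha> > 0"
  shows "(edge_open_prob \<alpha> has_real_derivative exp (- (1 + \<alpha>) * t)) (at t)"
proof -
  have "((\<lambda>t. (1 - exp (- b * t)) / b) has_real_derivative exp (- b * t)) (at t)" if "b \<noteq> 0" for b
    using that by (auto intro!: derivative_eq_intros)
  from this[of "1 + \<alpha>"] show ?thesis using assms by (simp add: edge_open_prob_def[abs_def])
qed

text \<open>The product solves the triangular system. With \<open>m\<close> closed edges,
  differentiating the two exponential factors gives the rate of leaving, as
  \<open>\<alpha> + (1 + \<alpha>) * m = m + \<alpha> * Suc m\<close>. Differentiating the power of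
  \<open>edge_open_prob\<close> trades an open edge for a closed one, which is the gain from the
  patterns \<open>A - {v}\<close>.\<close>

lemma expect_warm_pattern:
  assumes "\<alpha> > 0" and V: "parent_closed V" and U: "parent_closed U" "U \<subseteq> V" and "A \<subseteq> U - {[]}"
  shows "pcf_expect V \<alpha> (warm_pattern U A) t =
    exp (- \<alpha> * t) * edge_open_prob \<alpha> t ^ card A * exp (- (1 + \<alpha>) * t) ^ card (U - {[]} - A)"
  using assms(5)
proof (induction "card A" arbitrary: A t rule: less_induct)
  case less
  let ?p = "edge_open_prob \<alpha>" and ?q = "\<lambda>t. exp (- (1 + \<alpha>) * t)"
  define m where "m = card (U - {[]} - A)"
  define c where "c = real m + \<alpha> * real (Suc m)"
  have finU: "finite U" and root: "[] \<in> U" using U by (auto simp: parent_closed_def)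
  have finA: "finite A" using finU less.prems by (meson finite_Diff finite_subset)
  \<comment> \<open>The root belongs to no \<open>A\<close>, hence there is one more cluster than
    there are closed edges.\<close>
  have card_UA: "card (U - A) = Suc m"
  proof -
    have "U - A = insert [] (U - {[]} - A)" using root less.prems by auto
    then show ?thesis using finU by (simp add: m_def)
  qed
  define r where "r = (\<lambda>t. real (card A) * (exp (- \<alpha> * t) * ?p t ^ (card A - 1) * ?q t ^ Suc m))"
  show ?case unfolding m_def[symmetric]
  proof (rule linear_ode_unique[where r = r and c = c
        and y = "\<lambda>t. pcf_expect V \<alpha> (warm_pattern U A) t"
        and z = "\<lambda>t. exp (- \<alpha> * t) * ?p t ^ card A * ?q t ^ m"])
    fix t
    have "((\<lambda>t. pcf_expect V \<alpha> (warm_pattern U A) t) has_real_derivative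
        pcf_expect V \<alpha> (generator_apply (configs (tree_on V)) (pcf_rate (tree_on V) \<alpha>) (warm_pattern U A)) t) (at t)"
      by (intro expect_has_derivative finite_configs_tree V initial_in_configs)
    also have "pcf_expect V \<alpha> (generator_apply (configs (tree_on V)) (pcf_rate (tree_on V) \<alpha>) (warm_pattern U A)) t
        = pcf_expect V \<alpha> (\<lambda>\<eta>. (\<Sum>v\<in>A. 1 * warm_pattern U (A - {v}) \<eta>) + (- c) * warm_pattern U A \<eta>) t"
    proof (rule expect_cong[where R = UNIV])
      fix \<eta> assume "\<eta> \<in> configs (tree_on V)"
      from generator_apply_warm_pattern[OF V U less.prems this, of \<alpha>]
      show "generator_apply (configs (tree_on V)) (pcf_rate (tree_on V) \<alpha>) (warm_pattern U A) \<eta>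
          = (\<Sum>v\<in>A. 1 * warm_pattern U (A - {v}) \<eta>) + (- c) * warm_pattern U A \<eta>"
        unfolding card_UA m_def[symmetric] c_def[symmetric] by simp
    qed (auto intro: finite_configs_tree V initial_in_configs)
    also have "\<dots> = (\<Sum>v\<in>A. 1 * pcf_expect V \<alpha> (warm_pattern U (A - {v})) t) + (- c) * pcf_expect V \<alpha> (warm_pattern U A) t"
      by (simp only: expect_add expect_sum expect_scale)
    also have "(\<Sum>v\<in>A. 1 * pcf_expect V \<alpha> (warm_pattern U (A - {v})) t) = r t"
    proof -
      have "pcf_expect V \<alpha> (warm_pattern U (A - {v})) t
          = exp (- \<alpha> * t) * ?p t ^ (card A - 1) * ?q t ^ Suc m" if v: "v \<in> A" for v
      proof -
        have "card (A - {v}) < card A" using finA v by (rule card_Diff1_less)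
        moreover have "U - {[]} - (A - {v}) = insert v (U - {[]} - A)" using v less.prems by auto
        then have "card (U - {[]} - (A - {v})) = Suc m" using v finU by (simp add: m_def)
        ultimately show ?thesis using less.hyps[of "A - {v}" t] less.prems v finA by auto
      qed
      then show ?thesis by (simp add: r_def)
    qed
    finally show "((\<lambda>t. pcf_expect V \<alpha> (warm_pattern U A) t) has_real_derivative
        r t - c * pcf_expect V \<alpha> (warm_pattern U A) t) (at t)" by simp
    have e: "((\<lambda>t. exp (- \<alpha> * t)) has_real_derivative - \<alpha> * exp (- \<alpha> * t)) (at t)"
      and q: "(?q has_real_derivative - (1 + \<alpha>) * ?q t) (at t)"
      by (auto intro!: derivative_eq_intros)
    have qm: "((\<lambda>t. ?q t ^ m) has_real_derivative - (1 + \<alpha>) * real m * ?q t ^ m) (at t)"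
      using DERIV_power[OF q, of m] by (cases m) (simp_all add: mult_ac)
    have pn: "((\<lambda>t. ?p t ^ card A) has_real_derivative real (card A) * ?q t * ?p t ^ (card A - 1)) (at t)"
      using DERIV_power[OF edge_open_prob_derivative[OF assms(1)], of "card A" t] by (simp add: mult_ac)
    show "((\<lambda>t. exp (- \<alpha> * t) * ?p t ^ card A * ?q t ^ m) has_real_derivative
        r t - c * (exp (- \<alpha> * t) * ?p t ^ card A * ?q t ^ m)) (at t)"
      by (rule DERIV_cong[OF DERIV_mult[OF DERIV_mult[OF e pn] qm]])
         (simp add: r_def c_def algebra_simps)
  next
    have "warm_pattern U A initial_config = of_bool (A = {})"
      by (auto simp: warm_pattern_def open_below_def initial_config_def)
    then show "pcf_expect V \<alpha> (warm_pattern U A) 0 = exp (- \<alpha> * 0) * ?p 0 ^ card A * ?q 0 ^ m"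
      using finA by (cases "A = {}")
        (simp_all add: expect_0 finite_configs_tree V initial_in_configs edge_open_prob_def power_0_left)
  qed
qed

section \<open>Clusters are warm or frozen as a whole\<close>

text \<open>One implication suffices because \<open>{x, y} = {y, x}\<close>. The property holds
  initially and survives every transition; it lets the state of the root decide that of its whole
  cluster.\<close>

definition homogeneous :: "'v config \<Rightarrow> bool" where
  "homogeneous \<eta> \<longleftrightarrow> (\<forall>x y. {x, y} \<in> opened \<eta> \<longrightarrow> x \<in> frozen \<eta> \<longrightarrow> y \<in> frozen \<eta>)"

lemma homogeneous_cluster:
  assumes "homogeneous \<eta>" "u \<in> cluster \<eta> v"
  shows "u \<in> frozen \<eta> \<longleftrightarrow> v \<in> frozen \<eta>"
proof -
  have "(v, u) \<in> {(x, y). {x, y} \<in> opened \<eta>}\<^sup>*"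
    using assms(2) by (simp add: cluster_def component_def)
  then show ?thesis
    by (induction rule: rtrancl_induct)
       (use assms(1) in \<open>auto simp: homogeneous_def insert_commute\<close>)
qed

lemma homogeneous_initial: "homogeneous initial_config"
  by (simp add: homogeneous_def initial_config_def)

lemma homogeneous_open:
  assumes "homogeneous \<eta>" "e \<inter> frozen \<eta> = {}"
  shows "homogeneous (Config (frozen \<eta>) (insert e (opened \<eta>)))"
  using assms unfolding homogeneous_def by auto

lemma homogeneous_freeze:
  assumes "homogeneous \<eta>"
  shows "homogeneous (Config (frozen \<eta> \<union> cluster \<eta> v) (opened \<eta>))"
proof -
  have "y \<in> cluster \<eta> v" if "x \<in> cluster \<eta> v" "{x, y} \<in> opened \<eta>" for x y
    using that unfolding cluster_def component_def by (auto intro: rtrancl_into_rtrancl)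
  then show ?thesis using assms unfolding homogeneous_def by auto
qed

lemma pcf_rate_homogeneous:
  assumes "homogeneous \<eta>" "\<not> homogeneous \<eta>'"
  shows "pcf_rate G \<alpha> \<eta> \<eta>' = 0"
proof -
  have "(if \<eta>' = Config (frozen \<eta>) (insert e (opened \<eta>)) then 1 else 0) = (0::real)"
    if "e \<inter> frozen \<eta> = {}" for e
    using homogeneous_open[OF assms(1) that] assms(2) by auto
  moreover have "(if \<eta>' = Config (frozen \<eta> \<union> C) (opened \<eta>) then \<alpha> else 0) = 0"
    if "C \<in> cluster \<eta> ` verts G" for C
    using homogeneous_freeze[OF assms(1)] assms(2) that by auto
  ultimately show ?thesis
    unfolding pcf_rate_def by (simp add: sum.neutral)
qed

lemma expect_pcf_cong:
  assumes "parent_closed V"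
    and "\<And>\<eta>. \<eta> \<in> configs (tree_on V) \<Longrightarrow> homogeneous \<eta> \<Longrightarrow> f \<eta> = g \<eta>"
  shows "pcf_expect V \<alpha> f t = pcf_expect V \<alpha> g t"
  by (rule expect_cong[where R = "Collect homogeneous"])
     (use assms in \<open>auto intro: finite_configs_tree initial_in_configs homogeneous_initial pcf_rate_homogeneous\<close>)

section \<open>The root cluster at a finite time\<close>

definition outer_boundary :: "'a set \<Rightarrow> 'a list set \<Rightarrow> 'a list set" where
  "outer_boundary X S = {v \<in> lists X. v \<notin> S \<and> tl v \<in> S}"

text \<open>A vertex is in the root cluster iff its climb ends at the root, so a boundary edge can
  keep everything below it out. The event becomes a condition on the edges of \<open>S\<close> and
  its boundary only.\<close>

lemma component_root_eq_iff:
  assumes O: "E \<subseteq> parent_edge ` (lists X - {[]})" and S: "parent_closed S"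
  shows "component E [] = S \<longleftrightarrow>
    (\<forall>v\<in>S - {[]}. parent_edge v \<in> E) \<and> (\<forall>v\<in>outer_boundary X S. parent_edge v \<notin> E)"
    (is "_ \<longleftrightarrow> ?inner \<and> ?outer")
proof -
  have comp: "component E [] = {v. cluster_top E v = []}"
    using component_eq[OF O, of "[]"] by simp
  have root: "[] \<in> S" and tlS: "\<And>v. v \<in> S \<Longrightarrow> tl v \<in> S" using S by (auto simp: parent_closed_def)
  have inX: "v \<in> lists X" if "parent_edge v \<in> E" "v \<noteq> []" for v
    using that O parent_edge_eq_iff[of v] by auto
  show ?thesis
  proof
    assume eq: "component E [] = S"
    have "parent_edge v \<in> E" if "v \<in> S - {[]}" for v
      using that unfolding eq[symmetric] comp by (cases v) (auto split: if_splits)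
    moreover have "parent_edge v \<notin> E" if "v \<in> outer_boundary X S" for v
    proof
      assume "parent_edge v \<in> E"
      have "v \<notin> S" "tl v \<in> S" using that by (auto simp: outer_boundary_def)
      then have "v \<noteq> []" "cluster_top E (tl v) = []" "cluster_top E v \<noteq> []"
        using root unfolding eq[symmetric] comp by auto
      then show False using \<open>parent_edge v \<in> E\<close> by (cases v) auto
    qed
    ultimately show "?inner \<and> ?outer" by blast
  next
    assume *: "?inner \<and> ?outer"
    have "cluster_top E v = [] \<longleftrightarrow> v \<in> S" for v
    proof (induction v)
      case (Cons i v)
      show ?case
      proof (cases "parent_edge (i # v) \<in> E")
        case True
        have "i # v \<in> S" if "v \<in> S"
        proof (rule ccontr)
          assume "i # v \<notin> S"
          then have "i # v \<in> outer_boundary X S"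
            using that inX[OF True] by (simp add: outer_boundary_def)
          then show False using * True by blast
        qed
        then show ?thesis using True Cons tlS[of "i # v"] by auto
      next
        case False
        then show ?thesis using * by auto
      qed
    qed (simp add: root)
    then show "component E [] = S" by (auto simp: comp)
  qed
qed

definition warm_cluster :: "'a list set \<Rightarrow> 'a list config \<Rightarrow> real" where
  "warm_cluster S \<eta> = of_bool ([] \<notin> frozen \<eta> \<and> cluster \<eta> [] = S)"

definition frozen_cluster :: "'a list set \<Rightarrow> 'a list config \<Rightarrow> real" where
  "frozen_cluster S \<eta> = of_bool ([] \<in> frozen \<eta> \<and> cluster \<eta> [] = S)"

lemma parent_closed_boundary:
  assumes "parent_closed S" "B \<subseteq> outer_boundary X S" "finite B"
  shows "parent_closed (S \<union> B)"
  using assms by (auto simp: parent_closed_def outer_boundary_def)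

text \<open>A boundary vertex behind a closed edge may be warm or frozen, so the event is not itself
  a warm pattern. Expanding the product of
  \<open>1 - of_bool (parent_edge v \<in> opened \<eta>)\<close> over the boundary leaves only
  patterns in which all edges are open.\<close>

lemma warm_cluster_inclusion_exclusion:
  assumes V: "V \<subseteq> lists X" and S: "parent_closed S" and fin: "finite (outer_boundary X S)"
    and \<eta>: "\<eta> \<in> configs (tree_on V)" "homogeneous \<eta>"
  shows "warm_cluster S \<eta> =
    (\<Sum>B\<in>Pow (outer_boundary X S). (- 1) ^ card B * warm_pattern (S \<union> B) (S \<union> B - {[]}) \<eta>)"
proof -
  let ?D = "outer_boundary X S" and ?O = "opened \<eta>"
  let ?core = "frozen \<eta> \<inter> S = {} \<and> (\<forall>v\<in>S - {[]}. parent_edge v \<in> ?O)"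
  have O: "?O \<subseteq> parent_edge ` (lists X - {[]})" using \<eta>(1) V by (force simp: configs_def)
  have root: "[] \<in> S" using S by (simp add: parent_closed_def)
  have pattern: "warm_pattern (S \<union> B) (S \<union> B - {[]}) \<eta>
      = of_bool ?core * (\<Prod>v\<in>B. of_bool (parent_edge v \<in> ?O))" if B: "B \<subseteq> ?D" for B
  proof -
    have finB: "finite B" using B fin by (rule finite_subset)
    \<comment> \<open>By homogeneity a boundary vertex behind an open edge is warm like its parent
      in \<open>S\<close>.\<close>
    have "frozen \<eta> \<inter> B = {}" if "frozen \<eta> \<inter> S = {}" "\<forall>v\<in>B. parent_edge v \<in> ?O"
    proof -
      have "v \<notin> frozen \<eta>" if "v \<in> B" for v
      proof -
        have "{tl v, v} \<in> ?O" "tl v \<notin> frozen \<eta>"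
          using that B \<open>frozen \<eta> \<inter> S = {}\<close> \<open>\<forall>v\<in>B. parent_edge v \<in> ?O\<close>
          by (auto simp: outer_boundary_def parent_edge_def)
        then show ?thesis using \<eta>(2) unfolding homogeneous_def by (metis insert_commute)
      qed
      then show ?thesis by auto
    qed
    moreover have "[] \<notin> B" using B root by (auto simp: outer_boundary_def)
    ultimately have "(frozen \<eta> \<inter> (S \<union> B) = {} \<and> open_below (S \<union> B) \<eta> = S \<union> B - {[]})
        \<longleftrightarrow> ?core \<and> (\<forall>v\<in>B. parent_edge v \<in> ?O)"
      by (auto simp: open_below_def)
    moreover have "(\<Prod>v\<in>B. of_bool (parent_edge v \<in> ?O)) = (of_bool (\<forall>v\<in>B. parent_edge v \<in> ?O) :: real)"
      using finB by (induction B rule: finite_induct) auto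
    ultimately show ?thesis unfolding warm_pattern_def by auto
  qed
  have "(\<Sum>B\<in>Pow ?D. (- 1) ^ card B * warm_pattern (S \<union> B) (S \<union> B - {[]}) \<eta>)
      = of_bool ?core * (\<Sum>B\<in>Pow ?D. (- 1) ^ card B * (\<Prod>v\<in>B. of_bool (parent_edge v \<in> ?O)) * (\<Prod>v\<in>?D - B. 1))"
    by (simp add: pattern sum_distrib_left mult.left_commute)
  also have "(\<Sum>B\<in>Pow ?D. (- 1) ^ card B * (\<Prod>v\<in>B. of_bool (parent_edge v \<in> ?O)) * (\<Prod>v\<in>?D - B. 1))
      = (\<Prod>v\<in>?D. 1 - of_bool (parent_edge v \<in> ?O) :: real)"
    by (rule prod_diff_conv_sum[OF fin, symmetric])
  also have "\<dots> = of_bool (\<forall>v\<in>?D. parent_edge v \<notin> ?O)"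
    using fin by (auto simp: of_bool_def)
  also have "of_bool ?core * \<dots> = warm_cluster S \<eta>"
  proof -
    have "[] \<notin> frozen \<eta> \<and> cluster \<eta> [] = S \<longleftrightarrow> ?core \<and> (\<forall>v\<in>?D. parent_edge v \<notin> ?O)"
      using component_root_eq_iff[OF O S] homogeneous_cluster[OF \<eta>(2), of _ "[]"] root
      unfolding cluster_def by blast
    then show ?thesis by (simp add: warm_cluster_def)
  qed
  finally show ?thesis by simp
qed

lemma expect_warm_cluster:
  assumes "\<alpha> > 0" and V: "parent_closed V" "V \<subseteq> lists X"
    and S: "parent_closed S" "S \<union> outer_boundary X S \<subseteq> V"
  shows "pcf_expect V \<alpha> (warm_cluster S) t = exp (- \<alpha> * t) *
    (edge_open_prob \<alpha> t ^ (card S - 1) * (1 - edge_open_prob \<alpha> t) ^ card (outer_boundary X S))"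
proof -
  let ?D = "outer_boundary X S" and ?p = "edge_open_prob \<alpha> t"
  have fin: "finite ?D" using V(1) S(2) by (meson parent_closed_def finite_subset le_sup_iff)
  have finS: "finite S" and root: "[] \<in> S" using S by (auto simp: parent_closed_def)
  have pattern: "pcf_expect V \<alpha> (warm_pattern (S \<union> B) (S \<union> B - {[]})) t
      = exp (- \<alpha> * t) * ?p ^ (card S - 1) * ?p ^ card B" if B: "B \<subseteq> ?D" for B
  proof -
    have finB: "finite B" using B fin by (rule finite_subset)
    have "card (S \<union> B) = card S + card B"
      using finS finB B by (intro card_Un_disjoint) (auto simp: outer_boundary_def)
    moreover have "card S > 0" using finS root by (auto simp: card_gt_0_iff)
    ultimately have "card (S \<union> B - {[]}) = (card S - 1) + card B"
      using finS finB root by (simp add: card_Diff_singleton)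
    then show ?thesis
      using expect_warm_pattern[OF assms(1) V(1) parent_closed_boundary[OF S(1) B finB], of "S \<union> B - {[]}" t] B S(2)
      by (auto simp: power_add)
  qed
  have "pcf_expect V \<alpha> (warm_cluster S) t
      = pcf_expect V \<alpha> (\<lambda>\<eta>. \<Sum>B\<in>Pow ?D. (- 1) ^ card B * warm_pattern (S \<union> B) (S \<union> B - {[]}) \<eta>) t"
    by (intro expect_pcf_cong V warm_cluster_inclusion_exclusion[OF V(2) S(1) fin])
  also have "\<dots> = exp (- \<alpha> * t) * ?p ^ (card S - 1) * (\<Sum>B\<in>Pow ?D. (- 1) ^ card B * (\<Prod>v\<in>B. ?p) * (\<Prod>v\<in>?D - B. 1))"
    by (simp add: expect_sum pattern sum_distrib_left mult.left_commute)
  \<comment> \<open>The same expansion, read backwards.\<close>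
  also have "(\<Sum>B\<in>Pow ?D. (- 1) ^ card B * (\<Prod>v\<in>B. ?p) * (\<Prod>v\<in>?D - B. 1)) = (\<Prod>v\<in>?D. 1 - ?p)"
    by (rule prod_diff_conv_sum[OF fin, symmetric])
  finally show ?thesis by simp
qed

lemma component_insert:
  assumes "v \<notin> component E r" "w \<notin> component E r"
  shows "component (insert {v, w} E) r = component E r"
proof
  have "u \<in> component E r" if "(r, u) \<in> {(x, y). {x, y} \<in> insert {v, w} E}\<^sup>*" for u
    using that
  proof (induction rule: rtrancl_induct)
    case (step y z)
    then have "{y, z} \<in> E" using assms by (auto simp: doubleton_eq_iff)
    then show ?case using step.IH unfolding component_def by (auto intro: rtrancl_into_rtrancl)
  qed (rule component_self)
  then show "component (insert {v, w} E) r \<subseteq> component E r" by (auto simp: component_def)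
  show "component E r \<subseteq> component (insert {v, w} E) r"
    unfolding component_def using rtrancl_mono[of "{(x, y). {x, y} \<in> E}" "{(x, y). {x, y} \<in> insert {v, w} E}"] by auto
qed

text \<open>A frozen root cluster never changes, since by homogeneity no edge that may open touches
  it. The only relevant transition is the freezing of a warm root cluster, at rate
  \<open>\<alpha>\<close>.\<close>

lemma generator_apply_frozen_cluster:
  assumes V: "parent_closed V" and \<eta>: "\<eta> \<in> configs (tree_on V)" "homogeneous \<eta>"
  shows "generator_apply (configs (tree_on V)) (pcf_rate (tree_on V) \<alpha>) (frozen_cluster S) \<eta>
    = \<alpha> * warm_cluster S \<eta>"
proof -
  let ?F = "frozen \<eta>" and ?O = "opened \<eta>"
  have O: "?O \<subseteq> parent_edge ` (V - {[]})" using \<eta> by (simp add: configs_def)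
  have finV: "finite V" and root: "[] \<in> V" using V by (auto simp: parent_closed_def)
  have "frozen_cluster S (Config ?F (insert e ?O)) - frozen_cluster S \<eta> = 0"
    if e: "e \<in> edges (tree_on V)" "e \<inter> ?F = {}" for e
  proof (cases "[] \<in> ?F")
    case True
    obtain v where v: "e = {tl v, v}" using e(1) by (auto simp: parent_edge_def)
    then have "tl v \<notin> ?F" "v \<notin> ?F" using e(2) by auto
    then have "tl v \<notin> cluster \<eta> []" "v \<notin> cluster \<eta> []"
      using homogeneous_cluster[OF \<eta>(2)] True by auto
    then show ?thesis
      unfolding frozen_cluster_def cluster_def v by (simp add: component_insert)
  qed (simp add: frozen_cluster_def)
  then have open_part: "(\<Sum>e\<in>{e \<in> edges (tree_on V). e \<notin> ?O \<and> e \<inter> ?F = {}}.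
      frozen_cluster S (Config ?F (insert e ?O)) - frozen_cluster S \<eta>) = 0"
    by (intro sum.neutral) auto
  have "frozen_cluster S (Config (?F \<union> C) ?O) - frozen_cluster S \<eta>
      = (if C = cluster \<eta> [] then warm_cluster S \<eta> else 0)" if C: "C \<in> cluster \<eta> ` V" for C
  proof -
    have "[] \<in> C \<longleftrightarrow> C = cluster \<eta> []"
    proof
      assume "[] \<in> C"
      moreover obtain w where "C = component ?O w" using C by (auto simp: cluster_def)
      ultimately show "C = cluster \<eta> []" by (simp add: cluster_def component_eq[OF O])
    qed (simp add: cluster_def component_self)
    moreover have "frozen_cluster S (Config (?F \<union> C) ?O)
        = of_bool (([] \<in> ?F \<or> [] \<in> C) \<and> cluster \<eta> [] = S)"
      by (simp add: frozen_cluster_def cluster_def)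
    ultimately show ?thesis
      by (cases "[] \<in> ?F"; cases "C = cluster \<eta> []") (simp_all add: frozen_cluster_def warm_cluster_def)
  qed
  then have "(\<Sum>C\<in>cluster \<eta> ` V. \<alpha> * (frozen_cluster S (Config (?F \<union> C) ?O) - frozen_cluster S \<eta>))
      = (\<Sum>C\<in>cluster \<eta> ` V. if C = cluster \<eta> [] then \<alpha> * warm_cluster S \<eta> else 0)"
    by (intro sum.cong refl) auto
  also have "\<dots> = \<alpha> * warm_cluster S \<eta>" using finV root by simp
  finally have freeze_part: "(\<Sum>C\<in>cluster \<eta> ` V. \<alpha> * (frozen_cluster S (Config (?F \<union> C) ?O) - frozen_cluster S \<eta>))
      = \<alpha> * warm_cluster S \<eta>" .
  show ?thesis
    unfolding generator_apply_pcf[OF finite_graph_tree_on[OF V] \<eta>(1)] open_part verts_tree_on freeze_part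
    by simp
qed

lemma expect_frozen_cluster_derivative:
  assumes "\<alpha> > 0" and V: "parent_closed V" "V \<subseteq> lists X"
    and S: "parent_closed S" "S \<union> outer_boundary X S \<subseteq> V"
  shows "((\<lambda>t. pcf_expect V \<alpha> (frozen_cluster S) t) has_real_derivative \<alpha> * (exp (- \<alpha> * t) *
    (edge_open_prob \<alpha> t ^ (card S - 1) * (1 - edge_open_prob \<alpha> t) ^ card (outer_boundary X S)))) (at t)"
proof -
  have "((\<lambda>t. pcf_expect V \<alpha> (frozen_cluster S) t) has_real_derivative
      pcf_expect V \<alpha> (generator_apply (configs (tree_on V)) (pcf_rate (tree_on V) \<alpha>) (frozen_cluster S)) t) (at t)"
    by (intro expect_has_derivative finite_configs_tree V initial_in_configs)
  also have "pcf_expect V \<alpha> (generator_apply (configs (tree_on V)) (pcf_rate (tree_on V) \<alpha>) (frozen_cluster S)) t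
      = pcf_expect V \<alpha> (\<lambda>\<eta>. \<alpha> * warm_cluster S \<eta>) t"
    by (intro expect_pcf_cong V generator_apply_frozen_cluster)
  finally show ?thesis by (simp only: expect_scale expect_warm_cluster[OF assms])
qed

lemma expect_frozen_cluster_0:
  assumes V: "parent_closed V"
  shows "pcf_expect V \<alpha> (frozen_cluster S) 0 = 0"
proof -
  have "frozen_cluster S initial_config = 0"
    by (simp add: frozen_cluster_def initial_config_def)
  then show ?thesis using expect_0[OF finite_configs_tree[OF V] initial_in_configs] by metis
qed

subsection \<open>Counting rooted subtrees\<close>

text \<open>The trees of the forest start at positions from \<open>L\<close>, not all of which must
  be occupied; \<open>L\<close> is a list for the recursion on its head. The clause
  \<open>v \<noteq> []\<close> keeps the root from counting as its own parent, as
  \<open>tl [] = []\<close>.\<close>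

definition forests :: "'a set \<Rightarrow> 'a list list \<Rightarrow> nat \<Rightarrow> 'a list set set" where
  "forests X L k = {S. finite S \<and> card S = k \<and> S \<subseteq> lists X \<and>
     (\<forall>v\<in>S. v \<in> set L \<or> v \<noteq> [] \<and> tl v \<in> S)}"

text \<open>Children prepend a letter, so \<open>suffix u v\<close> says that \<open>u\<close> is
  \<open>v\<close> or an ancestor of it: the positions form an antichain.\<close>

definition independent_roots :: "'a list list \<Rightarrow> bool" where
  "independent_roots L \<longleftrightarrow> distinct L \<and> (\<forall>u\<in>set L. \<forall>v\<in>set L. suffix u v \<longrightarrow> u = v)"

lemma forests_ancestor:
  assumes "S \<in> forests X L k" "v \<in> S"
  shows "\<exists>u\<in>set L. suffix u v"
  using assms(2)
proof (induction v)
  case Nil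
  then show ?case using assms(1) by (auto simp: forests_def)
next
  case (Cons i v)
  then have "i # v \<in> set L \<or> v \<in> S" using assms(1) by (auto simp: forests_def)
  then show ?case using Cons.IH by (auto intro: suffix_ConsI)
qed

lemma independent_roots_children:
  assumes "independent_roots (v # L)" "distinct xs"
  shows "independent_roots (map (\<lambda>i. i # v) xs @ L)"
proof -
  have indep: "\<not> suffix v w" "\<not> suffix w v" if "w \<in> set L" for w
    using assms(1) that by (auto simp: independent_roots_def)
  have "i # v \<notin> set L" for i using indep(1)[of "i # v"] by (auto intro: suffix_ConsI)
  then have "distinct (map (\<lambda>i. i # v) xs @ L)"
    using assms \<open>\<And>i. i # v \<notin> set L\<close> by (auto simp: independent_roots_def distinct_map inj_on_def)
  moreover have "u = w" if uw: "u \<in> set (map (\<lambda>i. i # v) xs @ L)" "w \<in> set (map (\<lambda>i. i # v) xs @ L)"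
    "suffix u w" for u w
  proof -
    consider i j where "u = i # v" "w = j # v" | i where "u = i # v" "w \<in> set L"
      | j where "u \<in> set L" "w = j # v" | "u \<in> set L" "w \<in> set L"
      using uw(1,2) by auto
    then show ?thesis
    proof cases
      case 1
      then show ?thesis using that(3) by (auto simp: suffix_Cons dest: suffix_length_le)
    next
      case 2
      then show ?thesis using that(3) indep(1)[of w] by (metis suffix_ConsD)
    next
      case 3
      then show ?thesis using that(3) indep[of u] by (auto simp: suffix_Cons)
    next
      case 4
      then show ?thesis using that(3) assms(1) by (auto simp: independent_roots_def)
    qed
  qed
  ultimately show ?thesis unfolding independent_roots_def by blast
qed

lemma forests_Nil: "k > 0 \<Longrightarrow> forests X [] k = {}"
  using forests_ancestor[of _ X "[]" k] by (fastforce simp: forests_def card_gt_0_iff)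

lemma forests_0: "forests X L 0 = {{}}"
  by (auto simp: forests_def)

text \<open>Either position \<open>v\<close> is empty, or its vertex can be removed, whereupon its
  children become positions. The two further facts make the union disjoint and the insertion of
  \<open>v\<close> injective; they hold because the positions are incomparable.\<close>

lemma forests_Cons:
  assumes L: "independent_roots (v # L)" and v: "v \<in> lists (set xs)" and xs: "distinct xs"
  shows "forests (set xs) (v # L) (Suc k) =
    forests (set xs) L (Suc k) \<union> insert v ` forests (set xs) (map (\<lambda>i. i # v) xs @ L) k"
    (is "?lhs = ?A \<union> insert v ` ?B")
    and "S \<in> forests (set xs) L (Suc k) \<Longrightarrow> v \<notin> S"
    and "T \<in> forests (set xs) (map (\<lambda>i. i # v) xs @ L) k \<Longrightarrow> v \<notin> T"
proof -
  have indep: "\<not> suffix w v" if "w \<in> set L" for w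
    using L that by (auto simp: independent_roots_def)
  show vA: "v \<notin> S" if "S \<in> ?A" for S
    using forests_ancestor[OF that, of v] indep by blast
  show vB: "v \<notin> T" if T: "T \<in> ?B" for T
  proof
    assume "v \<in> T"
    then obtain u where "u \<in> set (map (\<lambda>i. i # v) xs @ L)" "suffix u v"
      using forests_ancestor[OF T \<open>v \<in> T\<close>] by blast
    then show False using indep by (auto dest: suffix_length_le)
  qed
  show "?lhs = ?A \<union> insert v ` ?B"
  proof (intro equalityI subsetI)
    fix S assume S: "S \<in> ?lhs"
    show "S \<in> ?A \<union> insert v ` ?B"
    proof (cases "v \<in> S")
      case False
      then have "S \<in> ?A" using S by (auto simp: forests_def)
      then show ?thesis by simp
    next
      case True
      have "S - {v} \<in> ?B"
      proof -
        have "w \<in> set (map (\<lambda>i. i # v) xs @ L) \<or> w \<noteq> [] \<and> tl w \<in> S - {v}" if w: "w \<in> S - {v}" for w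
        proof (cases "tl w = v \<and> w \<noteq> []")
          case True
          then obtain i where "w = i # v" by (cases w) auto
          then show ?thesis using w S by (auto simp: forests_def)
        next
          case False
          then show ?thesis using w S by (auto simp: forests_def)
        qed
        then show ?thesis using S True by (auto simp: forests_def)
      qed
      then show ?thesis using True by (metis UnI2 imageI insert_Diff)
    qed
  next
    fix S assume "S \<in> ?A \<union> insert v ` ?B"
    then show "S \<in> ?lhs"
    proof
      assume "S \<in> ?A"
      then show ?thesis by (auto simp: forests_def)
    next
      assume "S \<in> insert v ` ?B"
      then obtain T where T: "T \<in> ?B" "S = insert v T" by blast
      have "w \<in> set (v # L) \<or> w \<noteq> [] \<and> tl w \<in> insert v T" if "w \<in> insert v T" for w
        using that T(1) by (auto simp: forests_def)
      then show ?thesis using T vB[OF T(1)] v by (auto simp: forests_def)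
    qed
  qed
qed

text \<open>The recursion \<open>F(r, k) = F(r - 1, k) + F(r + d - 1, k - 1)\<close> for the number of forests with
  \<open>k\<close> vertices on \<open>r\<close> root positions is solved by \<open>r / k\<close> times a binomial coefficient.\<close>

lemma card_forests:
  assumes "distinct xs" "xs \<noteq> []" "independent_roots L" "set L \<subseteq> lists (set xs)"
  shows "finite (forests (set xs) L k)"
    and "k > 0 \<Longrightarrow> k * card (forests (set xs) L k)
      = length L * ((length xs * k + length L - 1) choose (k - 1))"
proof -
  let ?d = "length xs"
  have d: "?d > 0" using assms(2) by simp
  have "finite (forests (set xs) L k) \<and> (k > 0 \<longrightarrow> k * card (forests (set xs) L k)
      = length L * ((?d * k + length L - 1) choose (k - 1)))"
    using assms(3,4)
  \<comment> \<open>One term of the recursion shortens \<open>L\<close> at the same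
    \<open>k\<close>, the other lowers \<open>k\<close> and may lengthen \<open>L\<close>; hence an
    outer induction on \<open>k\<close> for all \<open>L\<close> and an inner one on
    \<open>L\<close>.\<close>
  proof (induction k arbitrary: L)
    case 0
    then show ?case by (simp add: forests_0)
  next
    case (Suc k)
    from Suc.prems show ?case
    proof (induction L)
      case Nil
      then show ?case by (simp add: forests_Nil)
    next
      case (Cons v L)
      let ?A = "forests (set xs) L (Suc k)" and ?L = "map (\<lambda>i. i # v) xs @ L"
      let ?B = "forests (set xs) ?L k" and ?r = "length L"
      have v: "v \<in> lists (set xs)" using Cons.prems by simp
      have "independent_roots L" using Cons.prems by (simp add: independent_roots_def)
      then have A: "finite ?A" "Suc k * card ?A = ?r * ((?d * Suc k + ?r - 1) choose k)"
        using Cons by auto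
      have "set ?L \<subseteq> lists (set xs)" using Cons.prems v by auto
      then have B: "finite ?B" "k > 0 \<Longrightarrow> k * card ?B = (?d + ?r) * ((?d * k + (?d + ?r) - 1) choose (k - 1))"
        using Suc.IH[OF independent_roots_children[OF Cons.prems(1) assms(1)]] by auto
      note split = forests_Cons[OF Cons.prems(1) v assms(1), where k = k]
      have "inj_on (insert v) ?B"
        using split(3) by (intro inj_onI) (metis insert_ident)
      then have card: "card (forests (set xs) (v # L) (Suc k)) = card ?A + card ?B"
        unfolding split(1) using A(1) B(1) split(2)
        by (subst card_Un_disjoint) (auto simp: card_image)
      have "Suc k * card (forests (set xs) (v # L) (Suc k)) = Suc ?r * ((?d * Suc k + ?r) choose k)"
      proof (cases k)
        \<comment> \<open>The induction hypothesis gives no count of \<open>?B\<close> for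
          \<open>k = 0\<close>; the empty forest is counted directly.\<close>
        case 0
        then show ?thesis using A(2) card[unfolded 0] by (simp add: forests_0)
      next
        case (Suc j)
        \<comment> \<open>Both binomial coefficients have the upper index \<open>N\<close>, so
          Pascal's rule adds them and absorption relates them.\<close>
        define N where "N = ?d * Suc k + ?r - 1"
        have N: "?d * Suc k + ?r = Suc N" "?d * k + (?d + ?r) - 1 = N"
          using d by (auto simp: N_def)
        have "N = ?d * k + ?d + ?r - 1" by (simp add: N_def)
        moreover have "?d * k \<ge> k" using mult_le_mono1[OF Suc_leI[OF d], of k] by simp
        ultimately have jN: "j \<le> N" using Suc by linarith
        define x y where "x = N choose Suc j" and "y = N choose j"
        have absorb: "Suc j * x = (N - j) * y"
          unfolding x_def y_def binomial_absorb_comp binomial_absorption ..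
        \<comment> \<open>The counts of \<open>?A\<close> and \<open>?B\<close> are known times
          \<open>Suc k\<close> and times \<open>k\<close>; with both factors present the two
          formulas apply, and \<open>k\<close> is cancelled afterwards.\<close>
        have "real k * (real (Suc k) * (real (card ?A) + real (card ?B)))
            = real k * (real (Suc ?r) * real (Suc N choose k))"
        proof -
          have a: "real (Suc k) * real (card ?A) = real ?r * real x"
            unfolding x_def N_def Suc[symmetric] of_nat_mult[symmetric] using A(2) by (simp only:)
          have b: "real k * real (card ?B) = real (?d + ?r) * real y"
            using B(2) Suc N(2) unfolding y_def of_nat_mult[symmetric] by simp
          have c: "real k * real x = (real ?d * real (Suc k) + real ?r - 1 - real j) * real y"
          proof -
            have "real (Suc j) * real x = real (N - j) * real y"
              unfolding of_nat_mult[symmetric] absorb ..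
            moreover have "real (Suc N) = real ?d * real (Suc k) + real ?r"
              unfolding N(1)[symmetric] by (simp add: algebra_simps)
            ultimately show ?thesis using jN Suc by (simp add: of_nat_diff)
          qed
          have "real k * (real (Suc k) * (real (card ?A) + real (card ?B)))
              = real k * (real (Suc k) * real (card ?A)) + real (Suc k) * (real k * real (card ?B))"
            by (simp only: algebra_simps)
          also have "\<dots> = real ?r * (real k * real x) + real (Suc k) * (real (?d + ?r) * real y)"
            unfolding a b by simp
          also have "\<dots> = real (Suc ?r) * (real k * real x + real k * real y)"
            unfolding c using Suc by (simp add: algebra_simps)
          also have "real k * real x + real k * real y = real k * real (Suc N choose k)"
            using Suc by (simp add: x_def y_def algebra_simps)
          finally show ?thesis by simp
        qed
        then have "real (Suc k) * (real (card ?A) + real (card ?B)) = real (Suc ?r) * real (Suc N choose k)"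
          using Suc by simp
        then have "Suc k * (card ?A + card ?B) = Suc ?r * (Suc N choose k)"
          unfolding of_nat_add[symmetric] of_nat_mult[symmetric] of_nat_eq_iff .
        then show ?thesis unfolding card N(1) .
      qed
      moreover have "finite (forests (set xs) (v # L) (Suc k))"
        unfolding split(1) using A(1) B(1) by simp
      ultimately show ?case by simp
    qed
  qed
  then show "finite (forests (set xs) L k)"
    and "k > 0 \<Longrightarrow> k * card (forests (set xs) L k) = length L * ((?d * k + length L - 1) choose (k - 1))"
    by auto
qed

lemma forests_root_eq:
  assumes "k > 0"
  shows "forests X [[]] k = {S. parent_closed S \<and> S \<subseteq> lists X \<and> card S = k}"
proof (intro equalityI subsetI)
  fix S assume S: "S \<in> forests X [[]] k"
  then have "S \<noteq> {}" using assms by (auto simp: forests_def)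
  have "v \<in> S \<Longrightarrow> [] \<in> S" for v
    by (induction v) (use S in \<open>auto simp: forests_def\<close>)
  then have "[] \<in> S" using \<open>S \<noteq> {}\<close> by blast
  then show "S \<in> {S. parent_closed S \<and> S \<subseteq> lists X \<and> card S = k}"
    using S by (auto simp: forests_def parent_closed_def)
next
  fix S assume "S \<in> {S. parent_closed S \<and> S \<subseteq> lists X \<and> card S = k}"
  then show "S \<in> forests X [[]] k" by (auto simp: forests_def parent_closed_def)
qed

text \<open>The Fuss-Catalan numbers, from the single root position \<open>[]\<close>.\<close>

lemma card_root_subtrees:
  assumes "d > 0" "k > 0"
  shows "finite {S. parent_closed S \<and> S \<subseteq> lists {..<d} \<and> card S = k}"
    and "k * card {S. parent_closed S \<and> S \<subseteq> lists {..<d} \<and> card S = k} = (d * k choose (k - 1))"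
  using card_forests[of "[0..<d]" "[[]]" k] assms
  by (simp_all add: forests_root_eq independent_roots_def atLeast0LessThan)

text \<open>The \<open>d * card S\<close> children of vertices of \<open>S\<close> are the boundary
  together with \<open>S\<close> without its root.\<close>

lemma card_outer_boundary:
  assumes S: "parent_closed S" "S \<subseteq> lists {..<d}"
  shows "finite (outer_boundary {..<d} S)"
    and "card (outer_boundary {..<d} S) + (card S - 1) = d * card S"
proof -
  let ?D = "outer_boundary {..<d} S" and ?K = "(\<lambda>(i, v). i # v) ` ({..<d} \<times> S)"
  have finS: "finite S" and root: "[] \<in> S" using S by (auto simp: parent_closed_def)
  have "?K = ?D \<union> (S - {[]})"
  proof (intro equalityI subsetI)
    fix w assume "w \<in> ?K"
    then obtain i v where "w = i # v" "i < d" "v \<in> S" by auto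
    then have "w \<in> lists {..<d}" "w \<noteq> []" "tl w \<in> S" using subsetD[OF S(2)] by simp_all
    then show "w \<in> ?D \<union> (S - {[]})" by (auto simp: outer_boundary_def)
  next
    fix w assume w: "w \<in> ?D \<union> (S - {[]})"
    then have "w \<noteq> []" "tl w \<in> S" "w \<in> lists {..<d}"
      using root S by (auto simp: outer_boundary_def parent_closed_def)
    then show "w \<in> ?K" by (cases w) auto
  qed
  moreover have "inj_on (\<lambda>(i, v). i # v) ({..<d} \<times> S)" by (auto simp: inj_on_def)
  then have "card ?K = d * card S"  by (simp add: card_image card_cartesian_product)
  moreover have "finite ?K" using finS by simp
  moreover have "?D \<inter> (S - {[]}) = {}" by (auto simp: outer_boundary_def)
  ultimately show "finite ?D" "card ?D + (card S - 1) = d * card S"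
    using finS root card_Un_disjoint[of ?D "S - {[]}"] by (simp_all add: card_Diff_singleton)
qed

subsection \<open>The final state on finite trees\<close>

text \<open>The density \<open>\<alpha> * exp (- \<alpha> * t) * a ^ j * (1 - a) ^ m\<close> of the
  freezing time, in the variable \<open>x = exp (- (1 + \<alpha>) * t)\<close>, with
  \<open>a = (1 - x) / (1 + \<alpha>)\<close>. Here \<open>j\<close> counts the edges of the cluster
  and \<open>m\<close> those leaving it; \<open>x = 0\<close> is infinite time.\<close>

definition final_density :: "real \<Rightarrow> nat \<Rightarrow> nat \<Rightarrow> real \<Rightarrow> real" where
  "final_density \<alpha> j m x = \<alpha> / (1 + \<alpha>) * x powr (- 1 / (1 + \<alpha>)) *
     ((1 - x) / (1 + \<alpha>)) ^ j * (1 - (1 - x) / (1 + \<alpha>)) ^ m"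

text \<open>The exponential law of rate \<open>\<alpha>\<close> in the variable \<open>x\<close>;
  the exponent exceeds \<open>- 1\<close>, so the singularity at \<open>0\<close> is
  integrable.\<close>

lemma powr_density_integral:
  fixes \<alpha> :: real
  assumes "\<alpha> > 0"
  shows "((\<lambda>x. \<alpha> / (1 + \<alpha>) * x powr (- 1 / (1 + \<alpha>))) has_integral 1) {0..1}"
proof -
  have "- 1 / (1 + \<alpha>) = \<alpha> / (1 + \<alpha>) - 1"
    using assms by (simp add: divide_simps)
  then have "((\<lambda>x. x powr (- 1 / (1 + \<alpha>))) has_integral (1 / (\<alpha> / (1 + \<alpha>)))) {0..1}"
    using has_integral_powr_from_0[of "\<alpha> / (1 + \<alpha>) - 1" 1] assms by (simp add: field_simps)
  from has_integral_mult_right[OF this, of "\<alpha> / (1 + \<alpha>)"] show ?thesis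
    using assms by simp
qed

lemma final_density_bounds:
  assumes "\<alpha> > 0" "x \<in> {0..1}"
  shows "0 \<le> final_density \<alpha> j m x"
    and "final_density \<alpha> j m x \<le> \<alpha> / (1 + \<alpha>) * x powr (- 1 / (1 + \<alpha>))"
proof -
  define u where "u = (1 - x) / (1 + \<alpha>)"
  have u: "0 \<le> u" "u \<le> 1" using assms by (auto simp: u_def field_simps)
  have "u ^ j * (1 - u) ^ m \<le> 1 * 1"
    using u by (intro mult_mono power_le_one) auto
  then have le: "\<alpha> / (1 + \<alpha>) * x powr (- 1 / (1 + \<alpha>)) * (u ^ j * (1 - u) ^ m)
      \<le> \<alpha> / (1 + \<alpha>) * x powr (- 1 / (1 + \<alpha>)) * 1"
    using assms by (intro mult_left_mono) auto
  show "0 \<le> final_density \<alpha> j m x"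
    unfolding final_density_def u_def[symmetric] using u assms by simp
  show "final_density \<alpha> j m x \<le> \<alpha> / (1 + \<alpha>) * x powr (- 1 / (1 + \<alpha>))"
    unfolding final_density_def u_def[symmetric] using le by (simp add: mult.assoc)
qed

lemma final_density_integrable:
  assumes "\<alpha> > 0"
  shows "final_density \<alpha> j m integrable_on {0..1}"
proof (rule measurable_bounded_by_integrable_imp_integrable)
  show "(\<lambda>x. \<alpha> / (1 + \<alpha>) * x powr (- 1 / (1 + \<alpha>))) integrable_on {0..1}"
    using powr_density_integral[OF assms] by blast
  have "final_density \<alpha> j m \<in> borel_measurable borel"
    unfolding final_density_def[abs_def] by measurable
  then show "final_density \<alpha> j m \<in> borel_measurable (lebesgue_on {0..1})"
    by (simp add: measurable_completion measurable_restrict_space1)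
  show "norm (final_density \<alpha> j m x) \<le> \<alpha> / (1 + \<alpha>) * x powr (- 1 / (1 + \<alpha>))" if "x \<in> {0..1}" for x
    using final_density_bounds[OF assms that, of j m] by simp
qed auto

lemma integral_final_density:
  assumes "\<alpha> > 0" "t \<ge> 0" and "g 0 = 0"
    and g: "\<And>t. (g has_real_derivative \<alpha> * (exp (- \<alpha> * t) *
      (edge_open_prob \<alpha> t ^ j * (1 - edge_open_prob \<alpha> t) ^ m))) (at t)"
  shows "g t = integral {exp (- (1 + \<alpha>) * t)..1} (final_density \<alpha> j m)"
proof -
  define b where "b = 1 + \<alpha>"
  define x0 where "x0 = exp (- b * t)"
  have b: "b > 1" using assms by (simp add: b_def)
  have x0: "0 < x0" "x0 \<le> 1" using assms b by (auto simp: x0_def)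
  \<comment> \<open>The substitution reverses orientation: \<open>x\<close> runs from
    \<open>1\<close> at time \<open>0\<close> down to \<open>x0\<close> at time
    \<open>t\<close>.\<close>
  have "((\<lambda>x. - final_density \<alpha> j m x) has_integral g (- ln 1 / b) - g (- ln x0 / b)) {x0..1}"
  proof (rule fundamental_theorem_of_calculus[OF x0(2)])
    fix x assume "x \<in> {x0..1}"
    then have x: "x > 0" using x0 by simp
    define s where "s = - ln x / b"
    have xs: "exp (- b * s) = x" using b x by (simp add: s_def)
    have D: "((\<lambda>x. g (- ln x / b)) has_real_derivative
        \<alpha> * (exp (- \<alpha> * s) * (edge_open_prob \<alpha> s ^ j * (1 - edge_open_prob \<alpha> s) ^ m)) * (- (1 / x) / b)) (at x)"
      unfolding s_def by (rule DERIV_chain2[OF g]) (use x b in \<open>auto intro!: derivative_eq_intros\<close>)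
    have p: "edge_open_prob \<alpha> s = (1 - x) / b"
      unfolding edge_open_prob_def b_def[symmetric] xs ..
    have "\<alpha> * (exp (- \<alpha> * s) * (((1 - x) / b) ^ j * (1 - (1 - x) / b) ^ m)) * (- (1 / x) / b)
        = - final_density \<alpha> j m x"
    proof -
      \<comment> \<open>\<open>exp (- \<alpha> * s)\<close> is \<open>x powr (\<alpha> / b)\<close>,
        and the \<open>1 / x\<close> from the change of variable lowers the exponent by one to
        \<open>- 1 / b\<close>.\<close>
      have "exp (- \<alpha> * s) / x = exp (- \<alpha> * s) * exp (- ln x)"
        using x by (simp add: exp_minus field_simps)
      also have "\<dots> = exp (- 1 / b * ln x)"
        using b by (simp add: mult_exp_exp s_def b_def field_simps)
      also have "\<dots> = x powr (- 1 / b)"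
        using x by (simp add: powr_def)
      finally have powr: "exp (- \<alpha> * s) / x = x powr (- 1 / b)" .
      show ?thesis
        unfolding final_density_def b_def[symmetric] powr[symmetric]
        by (simp only: times_divide_eq_left times_divide_eq_right mult_minus_right mult_minus_left
            minus_divide_left divide_divide_eq_left mult_1_right mult_ac)
    qed
    then have "((\<lambda>x. g (- ln x / b)) has_real_derivative - final_density \<alpha> j m x) (at x)"
      using D unfolding p by simp
    then show "((\<lambda>x. g (- ln x / b)) has_vector_derivative - final_density \<alpha> j m x) (at x within {x0..1})"
      unfolding has_real_derivative_iff_has_vector_derivative
      by (rule has_vector_derivative_at_within)
  qed
  from has_integral_neg[OF this] have "(final_density \<alpha> j m has_integral g t) {x0..1}"
    using b assms(3) by (simp add: x0_def)
  then show ?thesis by (simp add: integral_unique x0_def b_def)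
qed

lemma tendsto_integral_final_density:
  assumes "\<alpha> > 0"
  shows "(\<lambda>n. integral {exp (- (1 + \<alpha>) * real n)..1} (final_density \<alpha> j m))
    \<longlonglongrightarrow> integral {0..1} (final_density \<alpha> j m)"
proof -
  have "continuous_on {0..1} (\<lambda>x. integral {x..1} (final_density \<alpha> j m))"
    by (intro indefinite_integral_continuous_1' final_density_integrable assms)
  moreover have "(\<lambda>n. exp (- (1 + \<alpha>) * real n)) \<longlonglongrightarrow> 0"
    using assms by real_asymp
  ultimately show ?thesis
    by (rule continuous_on_tendsto_compose) (use assms in \<open>auto simp: mult_nonpos_nonneg\<close>)
qed

section \<open>Events on path space and finite-volume laws\<close>

context
  fixes T :: "'v graph" and \<mu> :: "(ennreal \<Rightarrow> 'v config) measure"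
  assumes \<mu>: "sets \<mu> = sets (path_algebra T)"
begin

lemma space_path_measure: "space \<mu> = paths T"
  using sets_eq_imp_space_eq[OF \<mu>] by (simp add: path_algebra_def space_measure_of_conv)

lemma frozen_event: "v \<in> verts T \<Longrightarrow> {\<eta> \<in> space \<mu>. v \<in> frozen (\<eta> t)} \<in> sets \<mu>"
  and opened_event: "e \<in> edges T \<Longrightarrow> {\<eta> \<in> space \<mu>. e \<in> opened (\<eta> t)} \<in> sets \<mu>"
proof -
  let ?gen = "{{\<eta> \<in> paths T. v \<in> frozen (\<eta> t)} |v t. v \<in> verts T} \<union>
      {{\<eta> \<in> paths T. e \<in> opened (\<eta> t)} |e t. e \<in> edges T}"
  have "sets \<mu> = sigma_sets (paths T) ?gen"
    unfolding \<mu> path_algebra_def by (rule sets_measure_of) auto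
  then have "A \<in> sets \<mu>" if "A \<in> ?gen" for A using that by auto
  then show "v \<in> verts T \<Longrightarrow> {\<eta> \<in> space \<mu>. v \<in> frozen (\<eta> t)} \<in> sets \<mu>"
    and "e \<in> edges T \<Longrightarrow> {\<eta> \<in> space \<mu>. e \<in> opened (\<eta> t)} \<in> sets \<mu>"
    unfolding space_path_measure by blast+
qed

lemma restrict_event:
  assumes "finite_graph \<Lambda>" "subgraph \<Lambda> T"
  shows "{\<eta> \<in> space \<mu>. restrict_config \<Lambda> (\<eta> t) = x} \<in> sets \<mu>"
proof -
  have fin: "finite (verts \<Lambda>)" "finite (edges \<Lambda>)"
    and sub: "verts \<Lambda> \<subseteq> verts T" "edges \<Lambda> \<subseteq> edges T"
    using assms by (auto simp: finite_graph_def subgraph_def)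
  have "{\<eta> \<in> space \<mu>. restrict_config \<Lambda> (\<eta> t) = x} =
    {\<eta> \<in> space \<mu>. (frozen x \<subseteq> verts \<Lambda> \<and> opened x \<subseteq> edges \<Lambda>) \<and>
      (\<forall>v\<in>verts \<Lambda>. (v \<in> frozen x \<longrightarrow> v \<in> frozen (\<eta> t)) \<and> (v \<notin> frozen x \<longrightarrow> v \<notin> frozen (\<eta> t))) \<and>
      (\<forall>e\<in>edges \<Lambda>. (e \<in> opened x \<longrightarrow> e \<in> opened (\<eta> t)) \<and> (e \<notin> opened x \<longrightarrow> e \<notin> opened (\<eta> t)))}"
    by (cases x) (auto simp: restrict_config_def)
  also have "\<dots> \<in> sets \<mu>"
    using fin sub
    by (intro sets.sets_Collect_conj sets.sets_Collect_finite_All' sets.sets_Collect_imp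
        sets.sets_Collect_neg sets.sets_Collect_const frozen_event opened_event sets.sets_Collect_finite_All) auto
  finally show ?thesis .
qed

end

lemma regular_path_limit:
  assumes "regular_path f"
  shows "\<forall>\<^sub>F n in sequentially. f (ennreal (real n)) = f \<infinity>"
proof -
  have "(\<lambda>n. ennreal (real n)) \<longlonglongrightarrow> \<infinity>"
    using of_nat_tendsto_top_ennreal by (simp add: ennreal_of_nat_eq_real_of_nat)
  then have "filterlim (\<lambda>n. ennreal (real n)) (at_left \<infinity>) sequentially"
    by (auto simp: filterlim_at)
  then show ?thesis
    using assms unfolding regular_path_def filterlim_iff by blast
qed

text \<open>Finitely many vertices and edges, each eventually in its final state, have a common time
  after which this holds for all.\<close>

lemma path_limit:
  assumes "finite_graph G" "\<eta> \<in> paths G"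
  shows "\<forall>\<^sub>F n in sequentially. \<eta> (ennreal (real n)) = \<eta> \<infinity>"
proof -
  have fin: "finite (verts G)" "finite (edges G)" using assms by (auto simp: finite_graph_def)
  have conf: "frozen (\<eta> t) \<subseteq> verts G" "opened (\<eta> t) \<subseteq> edges G" for t
    using assms(2) by (auto simp: paths_def configs_def)
  have "\<forall>\<^sub>F n in sequentially. \<forall>v\<in>verts G. (v \<in> frozen (\<eta> (ennreal (real n)))) = (v \<in> frozen (\<eta> \<infinity>))"
    using assms(2) fin by (intro eventually_ball_finite ballI regular_path_limit) (simp_all add: paths_def)
  moreover have "\<forall>\<^sub>F n in sequentially. \<forall>e\<in>edges G. (e \<in> opened (\<eta> (ennreal (real n)))) = (e \<in> opened (\<eta> \<infinity>))"
    using assms(2) fin by (intro eventually_ball_finite ballI regular_path_limit) (simp_all add: paths_def)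
  ultimately show ?thesis
  proof eventually_elim
    case (elim n)
    then show ?case using conf[of "ennreal (real n)"] conf[of \<infinity>] by (intro config.expand) blast
  qed
qed

lemma restrict_config_self: "\<eta> \<in> configs G \<Longrightarrow> restrict_config G \<eta> = \<eta>"
  by (cases \<eta>) (auto simp: restrict_config_def configs_def)

lemma finite_pcf_law_transition:
  assumes G: "finite_graph G" and law: "finite_pcf_law G \<alpha> \<nu>" and "t \<ge> 0" "y \<in> configs G"
  shows "{\<eta> \<in> space \<nu>. \<eta> (ennreal t) = y} \<in> sets \<nu>"
    and "measure \<nu> {\<eta> \<in> space \<nu>. \<eta> (ennreal t) = y}
      = transition (configs G) (pcf_rate G \<alpha>) t initial_config y"
proof -
  interpret prob_space \<nu> using law by (simp add: finite_pcf_law_def)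
  have sets: "sets \<nu> = sets (path_algebra G)" using law by (simp add: finite_pcf_law_def)
  have fdd: "measure \<nu> {\<eta> \<in> space \<nu>. \<forall>i\<le>n. \<eta> (ennreal (s i)) = x i} =
      (\<Prod>i<n. transition (configs G) (pcf_rate G \<alpha>) (s (Suc i) - s i) (x i) (x (Suc i)))"
    if "s 0 = 0" "mono s" "x 0 = initial_config" "range x \<subseteq> configs G" for n s x
    using law that unfolding finite_pcf_law_def by blast
  have sub: "subgraph G G" using G by (simp add: subgraph_def finite_graph_def)
  have "restrict_config G (\<eta> s) = \<eta> s" if "\<eta> \<in> space \<nu>" for \<eta> s
    using that by (intro restrict_config_self) (simp add: space_path_measure[OF sets] paths_def)
  then have "{\<eta> \<in> space \<nu>. \<eta> s = y} = {\<eta> \<in> space \<nu>. restrict_config G (\<eta> s) = y}" for s y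
    by auto
  then have event: "{\<eta> \<in> space \<nu>. \<eta> s = y} \<in> sets \<nu>" for s y
    using restrict_event[OF sets G sub] by simp
  then show "{\<eta> \<in> space \<nu>. \<eta> (ennreal t) = y} \<in> sets \<nu>" .
  \<comment> \<open>For \<open>n = 0\<close> the product is empty, so the chain starts in
    \<open>initial_config\<close> almost surely.\<close>
  have "measure \<nu> {\<eta> \<in> space \<nu>. \<eta> 0 = initial_config} = 1"
    using fdd[of "\<lambda>_. 0" "\<lambda>_. initial_config" 0] by (auto simp: mono_def initial_in_configs)
  then have ae: "AE \<eta> in \<nu>. \<eta> 0 = initial_config"
    using prob_Collect_eq_1[OF event] by simp
  \<comment> \<open>The law is stated for infinite sequences of times and states, so the two
    prescribed values are continued constantly.\<close>
  define s where "s = (\<lambda>i::nat. if i = 0 then 0 else t)"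
  define x where "x = (\<lambda>i::nat. if i = 0 then initial_config else y)"
  have "{\<eta> \<in> space \<nu>. \<forall>i\<le>1. \<eta> (ennreal (s i)) = x i}
      = {\<eta> \<in> space \<nu>. \<eta> 0 = initial_config} \<inter> {\<eta> \<in> space \<nu>. \<eta> (ennreal t) = y}"
    by (auto simp: s_def x_def le_Suc_eq)
  moreover have "measure \<nu> {\<eta> \<in> space \<nu>. \<forall>i\<le>1. \<eta> (ennreal (s i)) = x i}
      = transition (configs G) (pcf_rate G \<alpha>) t initial_config y"
  proof -
    have "s 0 = 0" "mono s" "x 0 = initial_config" "range x \<subseteq> configs G"
      using assms(3,4) by (auto simp: s_def x_def mono_def initial_in_configs)
    from fdd[OF this, of 1] show ?thesis by (simp add: s_def x_def)
  qed
  moreover have "measure \<nu> ({\<eta> \<in> space \<nu>. \<eta> 0 = initial_config} \<inter> {\<eta> \<in> space \<nu>. \<eta> (ennreal t) = y})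
      = measure \<nu> {\<eta> \<in> space \<nu>. \<eta> (ennreal t) = y}"
    using ae event by (intro finite_measure_eq_AE) auto
  ultimately show "measure \<nu> {\<eta> \<in> space \<nu>. \<eta> (ennreal t) = y}
      = transition (configs G) (pcf_rate G \<alpha>) t initial_config y" by simp
qed

lemma finite_pcf_law_expect:
  assumes G: "finite_graph G" and law: "finite_pcf_law G \<alpha> \<nu>" and "t \<ge> 0"
  shows "{\<eta> \<in> space \<nu>. P (\<eta> (ennreal t))} \<in> sets \<nu>"
    and "measure \<nu> {\<eta> \<in> space \<nu>. P (\<eta> (ennreal t))}
      = expect (configs G) (pcf_rate G \<alpha>) initial_config (\<lambda>y. of_bool (P y)) t"
proof -
  interpret prob_space \<nu> using law by (simp add: finite_pcf_law_def)
  have sets: "sets \<nu> = sets (path_algebra G)" using law by (simp add: finite_pcf_law_def)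
  have conf: "\<eta> s \<in> configs G" if "\<eta> \<in> space \<nu>" for \<eta> s
    using that by (simp add: space_path_measure[OF sets] paths_def)
  let ?Y = "{y \<in> configs G. P y}" and ?A = "\<lambda>y. {\<eta> \<in> space \<nu>. \<eta> (ennreal t) = y}"
  have fin: "finite (configs G)" by (rule finite_configs[OF G])
  have eq: "{\<eta> \<in> space \<nu>. P (\<eta> (ennreal t))} = (\<Union>y\<in>?Y. ?A y)"
    using conf by auto
  have ev: "?A y \<in> sets \<nu>" if "y \<in> ?Y" for y
    using finite_pcf_law_transition[OF assms] that by simp
  show "{\<eta> \<in> space \<nu>. P (\<eta> (ennreal t))} \<in> sets \<nu>"
    unfolding eq using fin ev by (intro sets.finite_UN) auto
  have "measure \<nu> (\<Union>y\<in>?Y. ?A y) = (\<Sum>y\<in>?Y. measure \<nu> (?A y))"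
    using fin ev by (intro finite_measure_finite_Union) (auto simp: disjoint_family_on_def)
  also have "\<dots> = (\<Sum>y\<in>?Y. transition (configs G) (pcf_rate G \<alpha>) t initial_config y)"
    using finite_pcf_law_transition(2)[OF assms] by (intro sum.cong) auto
  also have "\<dots> = (\<Sum>y\<in>configs G. if P y then transition (configs G) (pcf_rate G \<alpha>) t initial_config y else 0)"
    using fin by (rule sum.inter_filter)
  also have "\<dots> = expect (configs G) (pcf_rate G \<alpha>) initial_config (\<lambda>y. of_bool (P y)) t"
    unfolding expect_def by (intro sum.cong) auto
  finally show "measure \<nu> {\<eta> \<in> space \<nu>. P (\<eta> (ennreal t))}
      = expect (configs G) (pcf_rate G \<alpha>) initial_config (\<lambda>y. of_bool (P y)) t"
    unfolding eq .
qed

text \<open>Every path eventually sits in its final state, so the indicators converge pointwise and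
  dominated convergence applies; the event at time \<open>\<infinity>\<close> is measurable as such
  a limit.\<close>

lemma finite_pcf_law_limit:
  assumes G: "finite_graph G" and law: "finite_pcf_law G \<alpha> \<nu>"
  shows "(\<lambda>n. expect (configs G) (pcf_rate G \<alpha>) initial_config (\<lambda>y. of_bool (P y)) (real n))
    \<longlonglongrightarrow> measure \<nu> {\<eta> \<in> space \<nu>. P (\<eta> \<infinity>)}"
proof -
  interpret prob_space \<nu> using law by (simp add: finite_pcf_law_def)
  have sets: "sets \<nu> = sets (path_algebra G)" using law by (simp add: finite_pcf_law_def)
  let ?A = "\<lambda>n::nat. {\<eta> \<in> space \<nu>. P (\<eta> (ennreal (real n)))}" and ?B = "{\<eta> \<in> space \<nu>. P (\<eta> \<infinity>)}"
  have A: "?A n \<in> sets \<nu>" for n using finite_pcf_law_expect(1)[OF assms] by simp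
  have lim: "\<forall>\<^sub>F n in sequentially. indicat_real (?A n) \<eta> = indicat_real ?B \<eta>" if "\<eta> \<in> space \<nu>" for \<eta>
    using path_limit[OF G, of \<eta>] that
    by (auto simp: space_path_measure[OF sets] indicator_def elim!: eventually_mono)
  then have lim': "(\<lambda>n. indicat_real (?A n) \<eta>) \<longlonglongrightarrow> indicat_real ?B \<eta>" if "\<eta> \<in> space \<nu>" for \<eta>
    using that by (intro tendsto_eventually) auto
  have "indicat_real ?B \<in> borel_measurable \<nu>"
    by (rule borel_measurable_LIMSEQ_real[OF lim']) (use A in auto)
  then have "?B \<in> sets \<nu>"
    by (subst (asm) borel_measurable_indicator_iff) (simp add: Int_absorb2 subset_iff)
  have "(\<lambda>n. integral\<^sup>L \<nu> (indicat_real (?A n))) \<longlonglongrightarrow> integral\<^sup>L \<nu> (indicat_real ?B)"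
    by (rule integral_dominated_convergence[where w = "\<lambda>_. 1"])
       (use A \<open>?B \<in> sets \<nu>\<close> lim' in \<open>auto simp: indicator_def\<close>)
  then have "(\<lambda>n. measure \<nu> (?A n)) \<longlonglongrightarrow> measure \<nu> ?B"
    using A \<open>?B \<in> sets \<nu>\<close> by simp
  then show ?thesis using finite_pcf_law_expect(2)[OF assms] by simp
qed

lemma finite_pcf_cluster_prob:
  assumes "\<alpha> > 0" and V: "parent_closed V" "V \<subseteq> lists X"
    and S: "parent_closed S" "S \<union> outer_boundary X S \<subseteq> V"
    and law: "finite_pcf_law (tree_on V) \<alpha> \<nu>"
  shows "measure \<nu> {\<eta> \<in> space \<nu>. cluster (\<eta> \<infinity>) [] = S}
    = integral {0..1} (final_density \<alpha> (card S - 1) (card (outer_boundary X S)))"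
proof -
  let ?m = "card (outer_boundary X S)" and ?j = "card S - 1"
  let ?I = "\<lambda>t. integral {exp (- (1 + \<alpha>) * t)..1} (final_density \<alpha> ?j ?m)"
  let ?w = "\<lambda>t. exp (- \<alpha> * t) * (edge_open_prob \<alpha> t ^ ?j * (1 - edge_open_prob \<alpha> t) ^ ?m)"
  have "pcf_expect V \<alpha> (\<lambda>y. of_bool (cluster y [] = S)) t = ?I t + ?w t" if "t \<ge> 0" for t
  proof -
    have "(\<lambda>y. of_bool (cluster y [] = S)) = (\<lambda>y. frozen_cluster S y + warm_cluster S y)"
      by (auto simp: frozen_cluster_def warm_cluster_def)
    moreover have "pcf_expect V \<alpha> (frozen_cluster S) t = ?I t"
      by (rule integral_final_density[OF assms(1) that expect_frozen_cluster_0[OF V(1)]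
            expect_frozen_cluster_derivative[OF assms(1) V S]])
    ultimately show ?thesis by (simp only: expect_add expect_warm_cluster[OF assms(1) V S])
  qed
  then have "(\<lambda>n. ?I (real n) + ?w (real n)) \<longlonglongrightarrow> measure \<nu> {\<eta> \<in> space \<nu>. cluster (\<eta> \<infinity>) [] = S}"
    using finite_pcf_law_limit[OF finite_graph_tree_on[OF V(1)] law, of "\<lambda>y. cluster y [] = S"] by simp
  moreover have "(\<lambda>n. ?I (real n) + ?w (real n)) \<longlonglongrightarrow> integral {0..1} (final_density \<alpha> ?j ?m) + 0 * ((1 / (1 + \<alpha>)) ^ ?j * (1 - 1 / (1 + \<alpha>)) ^ ?m)"
  proof (intro tendsto_add tendsto_mult tendsto_integral_final_density assms(1) tendsto_power tendsto_diff tendsto_const)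
    show "(\<lambda>n. exp (- \<alpha> * real n)) \<longlonglongrightarrow> 0" using assms(1) by real_asymp
    have "(\<lambda>n. exp (- (1 + \<alpha>) * real n)) \<longlonglongrightarrow> 0" using assms(1) by real_asymp
    then have "(\<lambda>n. edge_open_prob \<alpha> (real n)) \<longlonglongrightarrow> (1 - 0) / (1 + \<alpha>)"
      unfolding edge_open_prob_def using assms(1) by (intro tendsto_intros) auto
    then show "(\<lambda>n. edge_open_prob \<alpha> (real n)) \<longlonglongrightarrow> 1 / (1 + \<alpha>)"
      and "(\<lambda>n. edge_open_prob \<alpha> (real n)) \<longlonglongrightarrow> 1 / (1 + \<alpha>)" by simp_all
  qed
  ultimately show ?thesis using LIMSEQ_unique by fastforce
qed

subsection \<open>The final state on the infinite tree\<close>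

definition tree_ball :: "nat \<Rightarrow> nat \<Rightarrow> nat list set" where
  "tree_ball d n = {v \<in> lists {..<d}. length v \<le> n}"

lemma tree_ball_subset: "tree_ball d n \<subseteq> lists {..<d}"
  by (auto simp: tree_ball_def)

lemma parent_closed_tree_ball: "parent_closed (tree_ball d n)"
proof -
  have "tree_ball d n = {v. set v \<subseteq> {..<d} \<and> length v \<le> n}"
    by (auto simp: tree_ball_def)
  then have "finite (tree_ball d n)" by (simp add: finite_lists_length_le)
  moreover have "tl v \<in> tree_ball d n" if "v \<in> tree_ball d n" for v
    using that by (cases v) (auto simp: tree_ball_def)
  ultimately show ?thesis by (auto simp: parent_closed_def tree_ball_def)
qed

lemma connected_tree_on:
  assumes "parent_closed V" shows "connected_graph (tree_on V)"
proof -
  let ?E = "parent_edge ` (V - {[]})"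
  have "cluster_top ?E v = []" if "v \<in> V" for v
    using that
  proof (induction v)
    case (Cons i v)
    then have "v \<in> V" using assms by (auto simp: parent_closed_def dest: bspec[of _ _ "i # v"])
    then show ?case using Cons by auto
  qed simp
  then show ?thesis
    using assms by (auto simp: connected_graph_def component_eq[of ?E V] parent_closed_def)
qed

lemma exhaustion_tree_ball: "exhaustion (\<lambda>n. tree_on (tree_ball d n)) (d_ary_tree d)"
proof -
  have graph: "is_graph (tree_on (tree_ball d n))" for n
    using parent_closed_tree_ball by (intro is_graph_tree_on) (auto simp: parent_closed_def)
  have union: "(\<Union>n. tree_ball d n) = lists {..<d}" by (auto simp: tree_ball_def)
  have mono: "tree_ball d n \<subseteq> tree_ball d (Suc n)" for n by (auto simp: tree_ball_def)
  moreover have "parent_edge ` (tree_ball d n - {[]}) \<subseteq> parent_edge ` (tree_ball d (Suc n) - {[]})"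
    "parent_edge ` (tree_ball d n - {[]}) \<subseteq> parent_edge ` (lists {..<d} - {[]})" for n
    using mono[of n] tree_ball_subset[of d n] by (auto intro!: image_mono)
  moreover have "(\<Union>n. parent_edge ` (tree_ball d n - {[]})) = parent_edge ` (lists {..<d} - {[]})"
    unfolding union[symmetric] by blast
  ultimately show ?thesis
    unfolding exhaustion_def d_ary_tree_eq subgraph_def
    using graph union tree_ball_subset[of d]
    by (auto intro!: finite_graph_tree_on connected_tree_on parent_closed_tree_ball)
qed

lemma cluster_root_restrict:
  assumes "opened \<eta> \<subseteq> parent_edge ` (lists X - {[]})" "parent_closed S" "S \<subseteq> lists X"
  defines "D \<equiv> S \<union> outer_boundary X S"
  shows "cluster \<eta> [] = S \<longleftrightarrow>
    (\<exists>F\<in>Pow D. restrict_config (tree_on D) \<eta> = Config F (parent_edge ` (S - {[]})))"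
proof -
  have root: "[] \<in> S" using assms(2) by (simp add: parent_closed_def)
  have D: "D - {[]} = (S - {[]}) \<union> outer_boundary X S" "(S - {[]}) \<inter> outer_boundary X S = {}"
    using root by (auto simp: D_def outer_boundary_def)
  have "(\<exists>F\<in>Pow D. restrict_config (tree_on D) \<eta> = Config F (parent_edge ` (S - {[]})))
      \<longleftrightarrow> opened \<eta> \<inter> parent_edge ` (D - {[]}) = parent_edge ` (S - {[]})"
    by (auto simp: restrict_config_def)
  also have "\<dots> \<longleftrightarrow> {v \<in> D - {[]}. parent_edge v \<in> opened \<eta>} = S - {[]}"
  proof -
    have "opened \<eta> \<inter> parent_edge ` (D - {[]}) = parent_edge ` {v \<in> D - {[]}. parent_edge v \<in> opened \<eta>}"
      by auto
    moreover have "S - {[]} \<subseteq> D - {[]}" by (auto simp: D_def)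
    ultimately show ?thesis
      using inj_on_image_eq_iff[OF inj_on_parent_edge[of D], of "{v \<in> D - {[]}. parent_edge v \<in> opened \<eta>}" "S - {[]}"]
      by auto
  qed
  also have "\<dots> \<longleftrightarrow> (\<forall>v\<in>S - {[]}. parent_edge v \<in> opened \<eta>) \<and> (\<forall>v\<in>outer_boundary X S. parent_edge v \<notin> opened \<eta>)"
    unfolding D(1) using D(2) by blast
  also have "\<dots> \<longleftrightarrow> cluster \<eta> [] = S"
    unfolding cluster_def by (rule component_root_eq_iff[OF assms(1,2), symmetric])
  finally show ?thesis by simp
qed

text \<open>A general vertex set \<open>W\<close> serves both the finite balls and the infinite
  tree.\<close>

lemma cluster_event:
  assumes "prob_space \<nu>" "sets \<nu> = sets (path_algebra (tree_on W))"
    and W: "W \<subseteq> lists X" "S \<union> outer_boundary X S \<subseteq> W"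
    and S: "parent_closed S" "finite (outer_boundary X S)"
  defines "D \<equiv> S \<union> outer_boundary X S"
  shows "{\<eta> \<in> space \<nu>. cluster (\<eta> t) [] = S} \<in> sets \<nu>"
    and "measure \<nu> {\<eta> \<in> space \<nu>. cluster (\<eta> t) [] = S} =
      (\<Sum>F\<in>Pow D. measure \<nu> {\<eta> \<in> space \<nu>. restrict_config (tree_on D) (\<eta> t) = Config F (parent_edge ` (S - {[]}))})"
proof -
  interpret prob_space \<nu> by fact
  let ?A = "\<lambda>F. {\<eta> \<in> space \<nu>. restrict_config (tree_on D) (\<eta> t) = Config F (parent_edge ` (S - {[]}))}"
  have D: "parent_closed D" unfolding D_def by (rule parent_closed_boundary[OF S(1) subset_refl S(2)])
  have finD: "finite (Pow D)" using D by (simp add: parent_closed_def)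
  have graph: "finite_graph (tree_on D)" by (rule finite_graph_tree_on[OF D])
  then have "subgraph (tree_on D) (tree_on W)"
    using W(2) unfolding subgraph_def finite_graph_def D_def by auto
  then have ev: "?A F \<in> sets \<nu>" for F by (rule restrict_event[OF assms(2) graph])
  have "cluster (\<eta> t) [] = S \<longleftrightarrow> (\<exists>F\<in>Pow D. \<eta> \<in> ?A F)" if "\<eta> \<in> space \<nu>" for \<eta>
  proof -
    have "opened (\<eta> t) \<subseteq> parent_edge ` (W - {[]})"
      using that by (simp add: space_path_measure[OF assms(2)] paths_def configs_def)
    then have "opened (\<eta> t) \<subseteq> parent_edge ` (lists X - {[]})" using W(1) by blast
    moreover have "S \<subseteq> lists X" using W by blast
    ultimately show ?thesis
      using cluster_root_restrict[OF _ S(1), of "\<eta> t" X] that unfolding D_def by simp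
  qed
  then have eq: "{\<eta> \<in> space \<nu>. cluster (\<eta> t) [] = S} = (\<Union>F\<in>Pow D. ?A F)"
    by blast
  show "{\<eta> \<in> space \<nu>. cluster (\<eta> t) [] = S} \<in> sets \<nu>"
    unfolding eq using finD ev by (intro sets.finite_UN) auto
  show "measure \<nu> {\<eta> \<in> space \<nu>. cluster (\<eta> t) [] = S} = (\<Sum>F\<in>Pow D. measure \<nu> (?A F))"
    unfolding eq using finD ev
    by (intro finite_measure_finite_Union) (auto simp: disjoint_family_on_def)
qed

text \<open>Every ball that contains \<open>S\<close> and its boundary gives the same probability,
  so the sequence whose limit defines the infinite volume law is eventually constant.\<close>

lemma pcf_law_cluster_prob:
  assumes "\<alpha> > 0" and law: "pcf_law (d_ary_tree d) \<alpha> \<mu>"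
    and S: "parent_closed S" "S \<subseteq> lists {..<d}"
  shows "{\<eta> \<in> space \<mu>. cluster (\<eta> \<infinity>) [] = S} \<in> sets \<mu>"
    and "measure \<mu> {\<eta> \<in> space \<mu>. cluster (\<eta> \<infinity>) [] = S}
      = integral {0..1} (final_density \<alpha> (card S - 1) (card (outer_boundary {..<d} S)))"
proof -
  let ?D = "S \<union> outer_boundary {..<d} S" and ?V = "tree_ball d"
  let ?I = "integral {0..1} (final_density \<alpha> (card S - 1) (card (outer_boundary {..<d} S)))"
  define x where "x = (\<lambda>F. Config F (parent_edge ` (S - {[]})))"
  have \<mu>: "prob_space \<mu>" "sets \<mu> = sets (path_algebra (tree_on (lists {..<d})))"
    using law by (auto simp: pcf_law_def d_ary_tree_eq)
  have fin: "finite (outer_boundary {..<d} S)" by (rule card_outer_boundary[OF S])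
  have Dsub: "?D \<subseteq> lists {..<d}" using S by (auto simp: outer_boundary_def)
  have finD: "finite ?D" using fin S by (simp add: parent_closed_def)
  show "{\<eta> \<in> space \<mu>. cluster (\<eta> \<infinity>) [] = S} \<in> sets \<mu>"
    by (rule cluster_event(1)[OF \<mu> subset_refl Dsub S(1) fin])
  obtain \<nu> where \<nu>: "\<And>n. finite_pcf_law (tree_on (?V n)) \<alpha> (\<nu> n)"
    and lim: "\<And>\<Lambda> J x. finite_graph \<Lambda> \<Longrightarrow> subgraph \<Lambda> (d_ary_tree d) \<Longrightarrow> finite J \<Longrightarrow>
      (\<lambda>n. measure (\<nu> n) {\<eta> \<in> space (\<nu> n). \<forall>t\<in>J. restrict_config \<Lambda> (\<eta> t) = x t})
        \<longlonglongrightarrow> measure \<mu> {\<eta> \<in> space \<mu>. \<forall>t\<in>J. restrict_config \<Lambda> (\<eta> t) = x t}"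
    using law exhaustion_tree_ball[of d] unfolding pcf_law_def by blast
  have graph: "finite_graph (tree_on ?D)"
    by (rule finite_graph_tree_on[OF parent_closed_boundary[OF S(1) subset_refl fin]])
  moreover have "subgraph (tree_on ?D) (d_ary_tree d)"
    using graph Dsub unfolding subgraph_def finite_graph_def d_ary_tree_eq by auto
  ultimately have "(\<lambda>n. measure (\<nu> n) {\<eta> \<in> space (\<nu> n). restrict_config (tree_on ?D) (\<eta> \<infinity>) = x F})
      \<longlonglongrightarrow> measure \<mu> {\<eta> \<in> space \<mu>. restrict_config (tree_on ?D) (\<eta> \<infinity>) = x F}" for F
    using lim[of "tree_on ?D" "{\<infinity>}" "\<lambda>_. x F"] by simp
  then have "(\<lambda>n. \<Sum>F\<in>Pow ?D. measure (\<nu> n) {\<eta> \<in> space (\<nu> n). restrict_config (tree_on ?D) (\<eta> \<infinity>) = x F})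
      \<longlonglongrightarrow> (\<Sum>F\<in>Pow ?D. measure \<mu> {\<eta> \<in> space \<mu>. restrict_config (tree_on ?D) (\<eta> \<infinity>) = x F})"
    by (intro tendsto_sum)
  then have "(\<lambda>n. \<Sum>F\<in>Pow ?D. measure (\<nu> n) {\<eta> \<in> space (\<nu> n). restrict_config (tree_on ?D) (\<eta> \<infinity>) = x F})
      \<longlonglongrightarrow> measure \<mu> {\<eta> \<in> space \<mu>. cluster (\<eta> \<infinity>) [] = S}"
    unfolding x_def cluster_event(2)[OF \<mu> subset_refl Dsub S(1) fin] .
  moreover have "\<forall>\<^sub>F n in sequentially. (\<Sum>F\<in>Pow ?D. measure (\<nu> n)
      {\<eta> \<in> space (\<nu> n). restrict_config (tree_on ?D) (\<eta> \<infinity>) = x F}) = ?I"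
  proof (rule eventually_sequentiallyI)
    fix n assume n: "n \<ge> Max (length ` ?D)"
    have DV: "?D \<subseteq> ?V n"
    proof
      fix v assume v: "v \<in> ?D"
      have "length v \<le> Max (length ` ?D)" using finD v by (intro Max_ge) auto
      then show "v \<in> ?V n" using v n Dsub unfolding tree_ball_def by auto
    qed
    have "prob_space (\<nu> n)" "sets (\<nu> n) = sets (path_algebra (tree_on (?V n)))"
      using \<nu>[of n] by (auto simp: finite_pcf_law_def)
    from cluster_event(2)[OF this tree_ball_subset DV S(1) fin, of \<infinity>]
    show "(\<Sum>F\<in>Pow ?D. measure (\<nu> n) {\<eta> \<in> space (\<nu> n). restrict_config (tree_on ?D) (\<eta> \<infinity>) = x F}) = ?I"
      unfolding x_def
      using finite_pcf_cluster_prob[OF assms(1) parent_closed_tree_ball tree_ball_subset S(1) DV \<nu>[of n]]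
      by simp
  qed
  ultimately show "measure \<mu> {\<eta> \<in> space \<mu>. cluster (\<eta> \<infinity>) [] = S} = ?I"
    by (rule LIMSEQ_unique[OF _ tendsto_eventually])
qed

text \<open>For \<open>k = 0\<close> the division by zero yields \<open>0\<close>, which is the
  correct value because a cluster is never empty.\<close>

definition cluster_size_prob :: "nat \<Rightarrow> real \<Rightarrow> nat \<Rightarrow> real" where
  "cluster_size_prob d \<alpha> k = real (d * k choose (k - 1)) / real k *
     integral {0..1} (final_density \<alpha> (k - 1) (d * k + 1 - k))"

lemma parent_closed_cluster:
  assumes "opened \<eta> \<subseteq> parent_edge ` (lists X - {[]})" "finite (cluster \<eta> [])"
  shows "parent_closed (cluster \<eta> [])" "cluster \<eta> [] \<subseteq> lists X"
proof -
  have eq: "cluster \<eta> [] = {v. cluster_top (opened \<eta>) v = []}"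
    unfolding cluster_def component_eq[OF assms(1)] by simp
  have "tl v \<in> cluster \<eta> []" if "v \<in> cluster \<eta> []" for v
    using that unfolding eq by (cases v) (auto split: if_splits)
  then show "parent_closed (cluster \<eta> [])"
    using assms(2) by (auto simp: parent_closed_def eq)
  have "v \<in> lists X" if "v \<in> cluster \<eta> []" for v
  proof (cases v)
    case (Cons i w)
    then have "parent_edge v \<in> opened \<eta>" using that unfolding eq by (auto split: if_splits)
    then obtain u where "u \<in> lists X" "u \<noteq> []" "parent_edge v = parent_edge u" using assms(1) by blast
    then show ?thesis using parent_edge_eq_iff[of v u] Cons by simp
  qed simp
  then show "cluster \<eta> [] \<subseteq> lists X" by blast
qed

text \<open>The boundary of a cluster of size \<open>k\<close> has size \<open>d * k + 1 - k\<close>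
  whatever its shape, so all shapes are equally likely.\<close>

lemma measure_root_cluster_size:
  assumes "d \<ge> 1" "\<alpha> > 0" and law: "pcf_law (d_ary_tree d) \<alpha> \<mu>"
  shows "measure \<mu> (root_cluster_size \<mu> k) = cluster_size_prob d \<alpha> k"
proof -
  interpret prob_space \<mu> using law by (simp add: pcf_law_def)
  have sets: "sets \<mu> = sets (path_algebra (tree_on (lists {..<d})))"
    using law by (simp add: pcf_law_def d_ary_tree_eq)
  have opened: "opened (\<eta> t) \<subseteq> parent_edge ` (lists {..<d} - {[]})" if "\<eta> \<in> space \<mu>" for \<eta> t
    using that by (simp add: space_path_measure[OF sets] paths_def configs_def)
  show ?thesis
  proof (cases "k = 0")
    case True
    have "cluster \<eta> [] \<noteq> {}" for \<eta> :: "nat list config"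
      using component_self[of "[]" "opened \<eta>"] by (auto simp: cluster_def)
    then have "root_cluster_size \<mu> 0 = {}"
      by (auto simp: root_cluster_size_def card_gt_0_iff)
    then show ?thesis using True by (simp add: cluster_size_prob_def)
  next
    case False
    let ?fam = "{S. parent_closed S \<and> S \<subseteq> lists {..<d} \<and> card S = k}"
    let ?I = "integral {0..1} (final_density \<alpha> (k - 1) (d * k + 1 - k))"
    let ?A = "\<lambda>S. {\<eta> \<in> space \<mu>. cluster (\<eta> \<infinity>) [] = S}"
    have fam: "finite ?fam" "k * card ?fam = (d * k choose (k - 1))"
      using card_root_subtrees[of d k] assms(1) False by auto
    have "root_cluster_size \<mu> k = (\<Union>S\<in>?fam. ?A S)"
    proof (intro equalityI subsetI)
      fix \<eta> assume "\<eta> \<in> root_cluster_size \<mu> k"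
      then show "\<eta> \<in> (\<Union>S\<in>?fam. ?A S)"
        using parent_closed_cluster[OF opened[of \<eta> \<infinity>]] by (auto simp: root_cluster_size_def)
    next
      fix \<eta> assume "\<eta> \<in> (\<Union>S\<in>?fam. ?A S)"
      then show "\<eta> \<in> root_cluster_size \<mu> k" by (auto simp: root_cluster_size_def parent_closed_def)
    qed
    also have "measure \<mu> \<dots> = (\<Sum>S\<in>?fam. measure \<mu> (?A S))"
      using fam(1) pcf_law_cluster_prob(1)[OF assms(2) law]
      by (intro finite_measure_finite_Union) (auto simp: disjoint_family_on_def)
    also have "\<dots> = (\<Sum>S\<in>?fam. ?I)"
    proof (intro sum.cong refl)
      fix S assume S: "S \<in> ?fam"
      then have "card (outer_boundary {..<d} S) = d * k + 1 - k"
        using card_outer_boundary(2)[of S d] False by auto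
      then show "measure \<mu> (?A S) = ?I"
        using pcf_law_cluster_prob(2)[OF assms(2) law, of S] S by simp
    qed
    also have "\<dots> = cluster_size_prob d \<alpha> k"
    proof -
      have "real (card ?fam) = real (d * k choose (k - 1)) / real k"
        unfolding fam(2)[symmetric] using False by simp
      then show ?thesis by (simp add: cluster_size_prob_def)
    qed
    finally show ?thesis .
  qed
qed

subsection \<open>Laplace's method\<close>

text \<open>The function \<open>u ^ (k - 1) * (1 - u) ^ (d * k + 1 - k)\<close> at
  \<open>u = (1 - x) / d\<close>, divided by its value at \<open>u = 1 / d\<close>. The indicator
  expresses \<open>0 < u < 1\<close>.\<close>

definition laplace_kernel :: "nat \<Rightarrow> nat \<Rightarrow> real \<Rightarrow> real" where
  "laplace_kernel d k x = indicator {- (real d - 1)<..<1} x *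
     ((1 - x) ^ (k - 1) * (1 + x / (real d - 1)) ^ (d * k + 1 - k))"

lemma laplace_kernel_measurable [measurable]: "laplace_kernel d k \<in> borel_measurable borel"
  unfolding laplace_kernel_def[abs_def] by measurable

text \<open>Shows the kernel as a \<open>(k - 1)\<close>-th power times a factor independent of
  \<open>k\<close>.\<close>

lemma exponent_split: "d \<ge> 1 \<Longrightarrow> k \<ge> 1 \<Longrightarrow> d * k + 1 - k = (d - 1) * (k - 1) + (d :: nat)"
proof -
  assume "d \<ge> 1" "k \<ge> 1"
  then obtain d' k' where "d = Suc d'" "k = Suc k'" by (metis Suc_le_D One_nat_def)
  then show ?thesis by (simp add: algebra_simps)
qed

text \<open>The gap \<open>- z - z\<^sup>2 / 2 - ln (1 - z)\<close> vanishes at \<open>0\<close> and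
  has derivative \<open>z\<^sup>2 / (1 - z)\<close>.\<close>

lemma one_minus_le_exp_quadratic:
  fixes z :: real
  assumes "0 \<le> z" "z < 1"
  shows "1 - z \<le> exp (- z - z\<^sup>2 / 2)"
proof -
  define f where "f = (\<lambda>z::real. - z - z\<^sup>2 / 2 - ln (1 - z))"
  have "f 0 \<le> f z"
  proof (rule DERIV_nonneg_imp_nondecreasing[OF assms(1)])
    fix x assume x: "0 \<le> x" "x \<le> z"
    have "(f has_real_derivative x\<^sup>2 / (1 - x)) (at x)"
      unfolding f_def using x assms
      by (auto intro!: derivative_eq_intros simp: field_simps power2_eq_square)
    then show "\<exists>y. (f has_real_derivative y) (at x) \<and> 0 \<le> y"
      using x assms by (intro exI[of _ "x\<^sup>2 / (1 - x)"] conjI) auto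
  qed
  then have "ln (1 - z) \<le> - z - z\<^sup>2 / 2" by (simp add: f_def)
  then show ?thesis using assms by (metis diff_gt_0_iff_gt exp_le_cancel_iff exp_ln)
qed

text \<open>On each side of \<open>0\<close> the factor below one receives the quadratic bound and
  the other only \<open>1 + z \<le> exp z\<close>; the linear terms cancel. The stated rate is the
  weaker of the two, that for \<open>x < 0\<close>.\<close>

lemma kernel_base_le:
  fixes x :: real
  assumes d: "d \<ge> 2" and x: "- (real d - 1) < x" "x < 1"
  defines "c \<equiv> real d - 1"
  shows "(1 - x) * (1 + x / c) ^ (d - 1) \<le> exp (- x\<^sup>2 / (2 * c))"
proof -
  have c: "c \<ge> 1" "c = real (d - 1)" using d by (auto simp: c_def)
  have pos: "1 + x / c > 0" using x c by (simp add: c_def field_simps)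
  show ?thesis
  proof (cases "x \<ge> 0")
    case True
    have "(1 + x / c) ^ (d - 1) \<le> exp (x / c) ^ (d - 1)"
      using pos by (intro power_mono exp_ge_add_one_self) auto
    also have "\<dots> = exp x" using c by (simp add: exp_of_nat_mult[symmetric])
    finally have "(1 - x) * (1 + x / c) ^ (d - 1) \<le> exp (- x - x\<^sup>2 / 2) * exp x"
      using True x pos by (intro mult_mono one_minus_le_exp_quadratic zero_le_power) auto
    also have "\<dots> = exp (- (x\<^sup>2 / 2))" by (simp add: mult_exp_exp)
    also have "\<dots> \<le> exp (- x\<^sup>2 / (2 * c))"
      using divide_left_mono[of 2 "2 * c" "x\<^sup>2"] c(1) by simp
    finally show ?thesis .
  next
    case False
    define z where "z = - x / c"
    have z: "0 \<le> z" "z < 1" "x = - c * z"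
      using False x c by (auto simp: z_def c_def field_simps)
    have "(1 + x / c) ^ (d - 1) = (1 - z) ^ (d - 1)" by (simp add: z_def)
    also have "\<dots> \<le> exp (- z - z\<^sup>2 / 2) ^ (d - 1)"
      using z by (intro power_mono one_minus_le_exp_quadratic) auto
    also have "\<dots> = exp (c * (- z - z\<^sup>2 / 2))" using c by (simp add: exp_of_nat_mult[symmetric])
    finally have "(1 - x) * (1 + x / c) ^ (d - 1) \<le> exp (c * z) * exp (c * (- z - z\<^sup>2 / 2))"
      using False x exp_ge_add_one_self[of "c * z"] pos z by (intro mult_mono) auto
    also have "\<dots> = exp (- x\<^sup>2 / (2 * c))"
      using c by (simp add: mult_exp_exp z(3) power2_eq_square field_simps)
    finally show ?thesis .
  qed
qed

lemma laplace_kernel_nonneg: "d \<ge> 2 \<Longrightarrow> 0 \<le> laplace_kernel d k x"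
  by (auto simp: laplace_kernel_def indicator_def field_simps intro!: mult_nonneg_nonneg zero_le_power)

text \<open>A bound uniform in \<open>k\<close>, for dominated convergence. From
  \<open>k = 2\<close> on, \<open>(k - 1) / k \<ge> 1 / 2\<close>, which turns the \<open>2\<close>
  of the exponent into \<open>4\<close>; the remaining factor is at most \<open>2 ^ d\<close>
  because \<open>x < 1 \<le> c\<close>.\<close>

lemma laplace_kernel_le:
  assumes d: "d \<ge> 2" and k: "k \<ge> 2"
  shows "laplace_kernel d k (y / sqrt (real k)) \<le> 2 ^ d * exp (- y\<^sup>2 / (4 * (real d - 1)))"
proof (cases "y / sqrt (real k) \<in> {- (real d - 1)<..<1}")
  case False
  then show ?thesis by (simp add: laplace_kernel_def)
next
  case True
  define c x where "c = real d - 1" and "x = y / sqrt (real k)"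
  have c: "c \<ge> 1" using d by (simp add: c_def)
  have x: "- c < x" "x < 1" using True by (auto simp: c_def x_def)
  have pos: "1 + x / c > 0" "1 + x / c \<le> 2" using x c by (auto simp: field_simps)
  have "laplace_kernel d k x = ((1 - x) * (1 + x / c) ^ (d - 1)) ^ (k - 1) * (1 + x / c) ^ d"
    using True d k exponent_split[of d k]
    by (simp add: laplace_kernel_def x_def c_def power_mult_distrib power_mult power_add)
  also have "\<dots> \<le> exp (- x\<^sup>2 / (2 * c)) ^ (k - 1) * 2 ^ d"
    using x pos c kernel_base_le[OF d, of x]
    by (intro mult_mono power_mono) (auto simp: c_def)
  also have "exp (- x\<^sup>2 / (2 * c)) ^ (k - 1) \<le> exp (- y\<^sup>2 / (4 * c))"
  proof -
    have "x\<^sup>2 = y\<^sup>2 / real k" using k by (simp add: x_def power_divide)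
    moreover have "y\<^sup>2 / real k * real (k - 1) \<ge> y\<^sup>2 / 2"
    proof -
      have "real (k - 1) / real k \<ge> 1 / 2" using k by (simp add: field_simps of_nat_diff)
      from mult_left_mono[OF this, of "y\<^sup>2"] show ?thesis by simp
    qed
    ultimately have "y\<^sup>2 / 2 / (2 * c) \<le> x\<^sup>2 * real (k - 1) / (2 * c)"
      using c by (intro divide_right_mono) auto
    then show ?thesis by (simp add: exp_of_nat_mult[symmetric] mult.commute)
  qed
  finally show ?thesis by (simp add: x_def c_def mult.commute)
qed

text \<open>The first-order terms of the two logarithms cancel; the second-order ones add up to
  \<open>- (1 + 1 / c) / 2\<close>, where \<open>1 + 1 / c = d / (d - 1)\<close>.\<close>

lemma laplace_kernel_tendsto:
  assumes d: "d \<ge> 2"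
  shows "(\<lambda>k. laplace_kernel d k (y / sqrt (real k))) \<longlonglongrightarrow> exp (- real d / (2 * (real d - 1)) * y\<^sup>2)"
proof -
  define c where "c = real d - 1"
  have c: "c > 0" using d by (simp add: c_def)
  define L where "L = (\<lambda>k. exp ((real k - 1) * ln (1 - y / sqrt (real k))
      + (c * (real k - 1) + real d) * ln (1 + y / (c * sqrt (real k)))))"
  have "((\<lambda>k::real. exp ((k - 1) * ln (1 - y / sqrt k)
      + (c * (k - 1) + real d) * ln (1 + y / (c * sqrt k))))
      \<longlongrightarrow> exp (- (y * y / 2) - c * (y * inverse c * (y * inverse c)) / 2)) at_top"
  proof -
    \<comment> \<open>The asymptotic expansion depends on the sign of \<open>y\<close>.\<close>
    consider "y > 0" | "y < 0" | "y = 0" by linarith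
    then show ?thesis
    proof cases
      case 1
      then show ?thesis using c by real_asymp
    next
      case 2
      then show ?thesis using c by real_asymp
    qed simp
  qed
  moreover have "- (y * y / 2) - c * (y * inverse c * (y * inverse c)) / 2 = - (1 + 1 / c) / 2 * y\<^sup>2"
    using c by (simp add: field_simps power2_eq_square)
  ultimately have "((\<lambda>k::real. exp ((k - 1) * ln (1 - y / sqrt k)
      + (c * (k - 1) + real d) * ln (1 + y / (c * sqrt k)))) \<longlongrightarrow> exp (- (1 + 1 / c) / 2 * y\<^sup>2)) at_top"
    by simp
  then have L: "L \<longlonglongrightarrow> exp (- (1 + 1 / c) / 2 * y\<^sup>2)"
    unfolding L_def by (rule filterlim_compose[OF _ filterlim_real_sequentially])
  have exponent: "- (1 + 1 / c) / 2 = - real d / (2 * (real d - 1))"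
    using c unfolding c_def by (simp add: field_simps)
  have "\<forall>\<^sub>F k in sequentially. L k = laplace_kernel d k (y / sqrt (real k))"
  proof -
    have lim: "(\<lambda>k. y / sqrt (real k)) \<longlonglongrightarrow> 0" by real_asymp
    have "\<forall>\<^sub>F k in sequentially. y / sqrt (real k) < 1" "\<forall>\<^sub>F k in sequentially. y / sqrt (real k) > - c"
      using order_tendstoD[OF lim, of 1] order_tendstoD[OF lim, of "- c"] c by auto
    then show ?thesis using eventually_ge_at_top[of 1]
    proof eventually_elim
      case (elim k)
      define x where "x = y / sqrt (real k)"
      have pos: "1 - x > 0" "1 + x / c > 0" using elim c by (auto simp: x_def field_simps)
      have "c * (real k - 1) + real d = real ((d - 1) * (k - 1) + d)"
        using d elim by (simp add: c_def of_nat_diff)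
      then have a: "c * (real k - 1) + real d = real (d * k + 1 - k)"
        using exponent_split[of d k] d elim by simp
      have b: "real k - 1 = real (k - 1)" using elim by simp
      have e: "y / (c * sqrt (real k)) = x / c" by (simp add: x_def)
      have "L k = exp (real (k - 1) * ln (1 - x)) * exp (real (d * k + 1 - k) * ln (1 + x / c))"
        unfolding L_def a unfolding b e x_def[symmetric] exp_add ..
      also have "\<dots> = (1 - x) ^ (k - 1) * (1 + x / c) ^ (d * k + 1 - k)"
        using pos by (simp only: exp_of_nat_mult exp_ln)
      also have "\<dots> = laplace_kernel d k x"
        using elim by (simp add: laplace_kernel_def c_def x_def)
      finally show ?case by (simp add: x_def)
    qed
  qed
  from Lim_transform_eventually[OF L this] show ?thesis unfolding exponent .
qed

lemma integrable_gaussian: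
  assumes "(a::real) > 0"
  shows "integrable lborel (\<lambda>y. exp (- y\<^sup>2 / a))"
proof -
  have "integrable lborel (\<lambda>y. sqrt (2 * pi * (sqrt (a / 2))\<^sup>2) * normal_density 0 (sqrt (a / 2)) y)"
    using assms by (intro integrable_mult_right integrable_normal_density) auto
  then show ?thesis using assms by (simp add: normal_density_def)
qed

text \<open>Dominated convergence, with the index shifted by \<open>2\<close> to where the Gaussian
  envelope is valid.\<close>

lemma laplace_limit:
  assumes d: "d \<ge> 2"
    and F: "\<And>k. F k \<in> borel_measurable borel" "F' \<in> borel_measurable borel"
    and bound: "\<And>k y. \<bar>F k y\<bar> \<le> H y"
    and H: "integrable lborel (\<lambda>y. H y * exp (- y\<^sup>2 / (4 * (real d - 1))))"
    and lim: "\<And>y. (\<lambda>k. F k y) \<longlonglongrightarrow> F' y"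
  shows "(\<lambda>k. \<integral>y. F k y * laplace_kernel d k (y / sqrt (real k)) \<partial>lborel)
    \<longlonglongrightarrow> (\<integral>y. F' y * exp (- real d / (2 * (real d - 1)) * y\<^sup>2) \<partial>lborel)"
proof -
  have "(\<lambda>k. \<integral>y. F (k + 2) y * laplace_kernel d (k + 2) (y / sqrt (real (k + 2))) \<partial>lborel)
      \<longlonglongrightarrow> (\<integral>y. F' y * exp (- real d / (2 * (real d - 1)) * y\<^sup>2) \<partial>lborel)"
  proof (rule integral_dominated_convergence)
    show "integrable lborel (\<lambda>y. 2 ^ d * (H y * exp (- y\<^sup>2 / (4 * (real d - 1)))))"
      using H by simp
    show "AE y in lborel. (\<lambda>k. F (k + 2) y * laplace_kernel d (k + 2) (y / sqrt (real (k + 2))))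
        \<longlonglongrightarrow> F' y * exp (- real d / (2 * (real d - 1)) * y\<^sup>2)"
      using LIMSEQ_ignore_initial_segment[OF tendsto_mult[OF lim laplace_kernel_tendsto[OF d]], where k = 2] by simp
    show "AE y in lborel. norm (F (k + 2) y * laplace_kernel d (k + 2) (y / sqrt (real (k + 2))))
        \<le> 2 ^ d * (H y * exp (- y\<^sup>2 / (4 * (real d - 1))))" for k
    proof (rule AE_I2)
      fix y
      have "norm (F (k + 2) y * laplace_kernel d (k + 2) (y / sqrt (real (k + 2))))
          = \<bar>F (k + 2) y\<bar> * laplace_kernel d (k + 2) (y / sqrt (real (k + 2)))"
        using laplace_kernel_nonneg[OF d] by (simp add: abs_mult)
      also have "\<dots> \<le> H y * (2 ^ d * exp (- y\<^sup>2 / (4 * (real d - 1))))"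
        using bound[of "k + 2" y] laplace_kernel_le[OF d, of "k + 2" y] laplace_kernel_nonneg[OF d]
        by (intro mult_mono) (auto intro: order.trans[OF abs_ge_zero])
      also have "\<dots> = 2 ^ d * (H y * exp (- y\<^sup>2 / (4 * (real d - 1))))" by (simp only: mult.left_commute)
      finally show "norm (F (k + 2) y * laplace_kernel d (k + 2) (y / sqrt (real (k + 2))))
          \<le> 2 ^ d * (H y * exp (- y\<^sup>2 / (4 * (real d - 1))))" .
    qed
  qed (use F in \<open>auto intro!: borel_measurable_times\<close>)
  then show ?thesis by (rule LIMSEQ_offset)
qed

text \<open>Passes from the gauge integral to the Lebesgue integral, where affine substitution and
  dominated convergence are carried out; nonnegativity supplies absolute integrability.\<close>

lemma nonneg_has_bochner_integral:
  fixes f :: "real \<Rightarrow> real"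
  assumes "f \<in> borel_measurable borel" "\<And>x. x \<in> S \<Longrightarrow> 0 \<le> f x" "S \<in> sets borel"
    and int: "(f has_integral I) S"
  shows "has_bochner_integral lborel (\<lambda>x. indicator S x * f x) I"
proof -
  have "f absolutely_integrable_on S"
    using int assms(2) by (intro nonnegative_absolutely_integrable_1) auto
  then have "integrable lebesgue (\<lambda>x. indicator S x *\<^sub>R f x)"
    by (simp add: set_integrable_def)
  then have S: "set_integrable lborel S f"
    unfolding set_integrable_def using assms by (subst (asm) integrable_completion) auto
  have "(\<integral>x. indicator S x * f x \<partial>lborel) = I"
    using set_borel_integral_eq_integral(2)[OF S] int
    by (simp add: set_lebesgue_integral_def integral_unique)
  then show ?thesis
    using S by (simp add: has_bochner_integral_iff set_integrable_def)
qed

text \<open>The beta function at \<open>k\<close> and \<open>d * k + 2 - k\<close>, as a quotient of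
  factorials. It makes the binomial coefficient of the subtree count an integral against the
  kernel.\<close>

lemma beta_integral:
  assumes "d \<ge> 1" "k \<ge> 1"
  shows "((\<lambda>u. u ^ (k - 1) * (1 - u) ^ (d * k + 1 - k)) has_integral
    1 / (real (d * k choose (k - 1)) * real (d * k + 1))) {0<..<1}"
proof -
  let ?m = "d * k + 1 - k"
  have "k \<le> d * k" using assms mult_le_mono1[of 1 d k] by simp
  then have k_le: "k - 1 \<le> d * k" "?m = d * k - (k - 1)" using assms by linarith+
  have "((\<lambda>u. u powr (real k - 1) * (1 - u) powr (real (Suc ?m) - 1)) has_integral Beta (real k) (real (Suc ?m))) {0..1}"
    using assms by (intro has_integral_Beta_real) auto
  then have "((\<lambda>u. u powr (real k - 1) * (1 - u) powr (real (Suc ?m) - 1)) has_integral Beta (real k) (real (Suc ?m))) {0<..<1}"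
    by (simp add: has_integral_Icc_iff_Ioo)
  moreover have "u powr (real k - 1) * (1 - u) powr (real (Suc ?m) - 1) = u ^ (k - 1) * (1 - u) ^ ?m"
    if "u \<in> {0<..<1}" for u :: real
    using that assms powr_realpow[of u "k - 1"] powr_realpow[of "1 - u" ?m] by (simp add: of_nat_diff)
  ultimately have "((\<lambda>u. u ^ (k - 1) * (1 - u) ^ ?m) has_integral Beta (real k) (real (Suc ?m))) {0<..<1}"
    by (metis (no_types, lifting) has_integral_cong)
  moreover have "Beta (real k) (real (Suc ?m)) = 1 / (real (d * k choose (k - 1)) * real (d * k + 1))"
  proof -
    have "Beta (real k) (real (Suc ?m)) = fact (k - 1) * fact ?m / fact (d * k + 1)"
    proof -
      have "Gamma (real k) = fact (k - 1)" using Gamma_fact[of "k - 1", where ?'a = real] assms by (simp add: of_nat_diff)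
      moreover have "Gamma (real (Suc ?m)) = fact ?m" using Gamma_fact[of ?m, where ?'a = real] by (simp add: add.commute)
      moreover have "real k + real (Suc ?m) = 1 + real (d * k + 1)" using k_le assms by (simp add: of_nat_diff)
      then have "Gamma (real k + real (Suc ?m)) = fact (d * k + 1)"
        using Gamma_fact[of "d * k + 1", where ?'a = real] by (simp only:)
      ultimately show ?thesis by (simp add: Beta_def)
    qed
    also have "\<dots> = 1 / (fact (d * k) / (fact (k - 1) * fact ?m) * real (d * k + 1))"
    proof -
      have "x / (n * C) = 1 / (C / x * n)" for x n C :: real by simp
      moreover have "fact (d * k + 1) = real (d * k + 1) * fact (d * k)" by simp
      ultimately show ?thesis by metis
    qed
    also have "fact (d * k) / (fact (k - 1) * fact ?m) = real (d * k choose (k - 1))"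
      unfolding k_le(2) by (rule binomial_fact[OF k_le(1), symmetric])
    finally show ?thesis .
  qed
  ultimately show ?thesis by simp
qed

subsection \<open>Asymptotics of the cluster size\<close>

text \<open>The factor \<open>s powr (- 1 / (1 + \<alpha>))\<close> of \<open>final_density\<close>
  in the coordinate \<open>x\<close>, cut to \<open>0 < s < 1\<close>. It is singular at
  \<open>x = 1 - d / (1 + \<alpha>)\<close>, which is negative, zero or positive in the three cases
  of the theorem.\<close>

definition endpoint_weight :: "nat \<Rightarrow> real \<Rightarrow> real \<Rightarrow> real" where
  "endpoint_weight d \<alpha> x = (let s = 1 - (1 + \<alpha>) / real d * (1 - x) in
     indicator {0<..<1} s * s powr (- 1 / (1 + \<alpha>)))"

lemma endpoint_weight_measurable [measurable]: "endpoint_weight d \<alpha> \<in> borel_measurable borel"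
  unfolding endpoint_weight_def[abs_def] Let_def by measurable

lemma kernel_substitution:
  assumes "d \<ge> 2" "k \<ge> 1"
  shows "indicator {0<..<1} ((1 - x) / real d) * (((1 - x) / real d) ^ (k - 1) * (1 - (1 - x) / real d) ^ (d * k + 1 - k))
    = (1 / real d) ^ (k - 1) * ((real d - 1) / real d) ^ (d * k + 1 - k) * laplace_kernel d k x"
proof -
  have d: "real d > 1" using assms by simp
  have "(1 - x) / real d \<in> {0<..<1} \<longleftrightarrow> x \<in> {- (real d - 1)<..<1}"
    using d by (auto simp: field_simps)
  moreover have "1 - (1 - x) / real d = (real d - 1) / real d * (1 + x / (real d - 1))"
    using d by (simp add: field_simps)
  ultimately show ?thesis
    by (auto simp: laplace_kernel_def indicator_def power_mult_distrib power_divide)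
qed

lemma density_substitution:
  assumes "\<alpha> > 0" "d \<ge> 2" "k \<ge> 1"
  defines "s \<equiv> \<lambda>x. 1 - (1 + \<alpha>) / real d * (1 - x)"
  shows "indicator {0<..<1} (s x) * final_density \<alpha> (k - 1) (d * k + 1 - k) (s x)
    = \<alpha> / (1 + \<alpha>) * ((1 / real d) ^ (k - 1) * ((real d - 1) / real d) ^ (d * k + 1 - k)) *
      (endpoint_weight d \<alpha> x * laplace_kernel d k x)"
proof (cases "s x \<in> {0<..<1}")
  case False
  then show ?thesis unfolding endpoint_weight_def s_def by (simp add: Let_def)
next
  case True
  define u where "u = (1 - x) / real d"
  have su: "(1 - s x) / (1 + \<alpha>) = u" using assms(1) by (simp add: s_def u_def)
  have "u > 0" using True assms(1) unfolding su[symmetric] by simp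
  moreover have "u < 1"
    unfolding su[symmetric] using True assms(1) by (simp add: field_simps)
  ultimately have "u ^ (k - 1) * (1 - u) ^ (d * k + 1 - k)
      = (1 / real d) ^ (k - 1) * ((real d - 1) / real d) ^ (d * k + 1 - k) * laplace_kernel d k x"
    using kernel_substitution[OF assms(2,3), of x] unfolding u_def by simp
  moreover have "endpoint_weight d \<alpha> x = s x powr (- 1 / (1 + \<alpha>))"
    using True unfolding endpoint_weight_def s_def by (simp add: Let_def)
  ultimately show ?thesis
    using True unfolding final_density_def su by (simp add: mult_ac)
qed

text \<open>The integral for one shape and the beta integral both become integrals against the
  kernel with the same constant \<open>K\<close> and the same scale \<open>d * r\<close>, all of
  which cancel in the quotient.\<close>

lemma cluster_size_prob_ratio:
  assumes "\<alpha> > 0" "d \<ge> 2" "k \<ge> 1"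
  shows "cluster_size_prob d \<alpha> k = \<alpha> / (real k * real (d * k + 1)) *
    ((\<integral>y. endpoint_weight d \<alpha> (y / sqrt (real k)) * laplace_kernel d k (y / sqrt (real k)) \<partial>lborel) /
     (\<integral>y. laplace_kernel d k (y / sqrt (real k)) \<partial>lborel))"
proof -
  define r K where "r = sqrt (real k)"
    and "K = (1 / real d) ^ (k - 1) * ((real d - 1) / real d) ^ (d * k + 1 - k)"
  let ?m = "d * k + 1 - k"
  let ?G = "\<lambda>y. endpoint_weight d \<alpha> (y / r)" and ?w = "\<lambda>y. laplace_kernel d k (y / r)"
  define B I where "B = 1 / (real (d * k choose (k - 1)) * real (d * k + 1))"
    and "I = integral {0..1} (final_density \<alpha> (k - 1) ?m)"
  have r: "r > 0" and d: "real d > 1" and K: "K > 0" using assms by (auto simp: r_def K_def)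
  have "d * k \<ge> k" using mult_le_mono1[of 1 d k] assms by simp
  then have "0 < (d * k choose (k - 1))" by (intro zero_less_binomial) linarith
  then have B: "B > 0" unfolding B_def by (intro divide_pos_pos mult_pos_pos) (simp_all add: add_pos_nonneg)
  have "has_bochner_integral lborel (\<lambda>u. indicator {0<..<1} u * (u ^ (k - 1) * (1 - u) ^ ?m)) B"
    unfolding B_def using beta_integral[of d k] assms
    by (intro nonneg_has_bochner_integral) auto
  \<comment> \<open>The substitution \<open>u = (1 - y / r) / d\<close>, with
    \<open>r = sqrt k\<close> the scale of the peak.\<close>
  then have "has_bochner_integral lborel
      (\<lambda>y. indicator {0<..<1} (1 / real d + (- 1 / (real d * r)) * y) *
        ((1 / real d + (- 1 / (real d * r)) * y) ^ (k - 1) * (1 - (1 / real d + (- 1 / (real d * r)) * y)) ^ ?m))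
      (B /\<^sub>R \<bar>- 1 / (real d * r)\<bar>)"
    using d r by (subst (asm) lborel_has_bochner_integral_real_affine_iff[where c = "- 1 / (real d * r)" and t = "1 / real d"]) auto
  moreover have "1 / real d + (- 1 / (real d * r)) * y = (1 - y / r) / real d" for y
    using d r by (simp add: field_simps)
  ultimately have "has_bochner_integral lborel (\<lambda>y. K * ?w y) (B * (real d * r))"
    using kernel_substitution[OF assms(2,3)] d r by (simp add: K_def mult_ac)
  then have w: "K * (\<integral>y. ?w y \<partial>lborel) = B * (real d * r)"
    by (metis has_bochner_integral_integral_eq integral_mult_right_zero)
  have "(final_density \<alpha> (k - 1) ?m has_integral I) {0<..<1}"
    using final_density_integrable[OF assms(1)] unfolding I_def
    by (simp add: has_integral_Icc_iff_Ioo[symmetric] integrable_integral)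
  moreover have "final_density \<alpha> (k - 1) ?m \<in> borel_measurable borel"
    unfolding final_density_def[abs_def] by measurable
  ultimately have "has_bochner_integral lborel (\<lambda>s. indicator {0<..<1} s * final_density \<alpha> (k - 1) ?m s) I"
    using final_density_bounds(1)[OF assms(1)] by (intro nonneg_has_bochner_integral) auto
  \<comment> \<open>The substitution \<open>s = 1 - (1 + \<alpha>) * u\<close> with the same
    \<open>u\<close>.\<close>
  then have hb: "has_bochner_integral lborel
      (\<lambda>y. indicator {0<..<1} (1 - (1 + \<alpha>) / real d + ((1 + \<alpha>) / (real d * r)) * y) *
        final_density \<alpha> (k - 1) ?m (1 - (1 + \<alpha>) / real d + ((1 + \<alpha>) / (real d * r)) * y))
      (I /\<^sub>R \<bar>(1 + \<alpha>) / (real d * r)\<bar>)"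
    using d r assms(1)
    by (subst (asm) lborel_has_bochner_integral_real_affine_iff[where c = "(1 + \<alpha>) / (real d * r)" and t = "1 - (1 + \<alpha>) / real d"]) auto
  have subst: "1 - (1 + \<alpha>) / real d + ((1 + \<alpha>) / (real d * r)) * y = 1 - (1 + \<alpha>) / real d * (1 - y / r)" for y
    using d r by (simp add: field_simps)
  have "I /\<^sub>R \<bar>(1 + \<alpha>) / (real d * r)\<bar> = I * (real d * r) / (1 + \<alpha>)"
    using d r assms(1) by simp
  with hb have "has_bochner_integral lborel (\<lambda>y. \<alpha> / (1 + \<alpha>) * K * (?G y * ?w y)) (I * (real d * r) / (1 + \<alpha>))"
    unfolding subst density_substitution[OF assms] K_def[symmetric] by (simp only:)
  then have Gw: "\<alpha> / (1 + \<alpha>) * K * (\<integral>y. ?G y * ?w y \<partial>lborel) = I * (real d * r) / (1 + \<alpha>)"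
    by (metis has_bochner_integral_integral_eq integral_mult_right_zero)
  have "(\<integral>y. ?w y \<partial>lborel) = B * (real d * r) / K" using w K by (simp add: field_simps)
  moreover have "(\<integral>y. ?G y * ?w y \<partial>lborel) = I * (real d * r) / (\<alpha> * K)"
    using Gw K assms(1) by (simp add: field_simps)
  ultimately have "(\<integral>y. ?G y * ?w y \<partial>lborel) / (\<integral>y. ?w y \<partial>lborel) = I / (\<alpha> * B)"
    using K B d r by simp
  moreover have "1 + real d * real k \<noteq> 0" using add_pos_nonneg[of 1 "real d * real k"] by simp
  ultimately show ?thesis
    unfolding cluster_size_prob_def r_def[symmetric] I_def[symmetric] using assms(1)
    by (simp add: B_def)
qed

lemma gaussian_integral_pos:
  fixes F :: "real \<Rightarrow> real"
  assumes "a > 0" "F \<in> borel_measurable borel" "\<And>y. 0 \<le> F y" "\<And>y. y \<in> {0<..<1} \<Longrightarrow> F y > 0"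
    and int: "integrable lborel (\<lambda>y. F y * exp (- a * y\<^sup>2))"
  shows "(\<integral>y. F y * exp (- a * y\<^sup>2) \<partial>lborel) > 0"
proof -
  have "(\<integral>y. F y * exp (- a * y\<^sup>2) \<partial>lborel) \<noteq> 0"
  proof
    assume "(\<integral>y. F y * exp (- a * y\<^sup>2) \<partial>lborel) = 0"
    then have "AE y in lborel. F y * exp (- a * y\<^sup>2) = 0"
      using integral_nonneg_eq_0_iff_AE[OF int] assms(3) by simp
    then have "AE y in lborel. y \<notin> {0<..<1::real}"
      by eventually_elim (use assms(4) in force)
    then have "{0<..<1::real} \<in> null_sets lborel"
      by (subst AE_iff_null_sets) auto
    then show False by (simp add: null_sets_def)
  qed
  moreover have "(\<integral>y. F y * exp (- a * y\<^sup>2) \<partial>lborel) \<ge> 0"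
    using assms(3) by (intro integral_nonneg_AE) auto
  ultimately show ?thesis by simp
qed

lemma kernel_integral_limit:
  assumes d: "d \<ge> 2"
  defines "g \<equiv> (\<integral>y. exp (- (real d / (2 * (real d - 1))) * y\<^sup>2) \<partial>lborel)"
  shows "g > 0" and "(\<lambda>k. \<integral>y. laplace_kernel d k (y / sqrt (real k)) \<partial>lborel) \<longlonglongrightarrow> g"
proof -
  have d': "real d > 1" using d by simp
  have "integrable lborel (\<lambda>y. exp (- y\<^sup>2 / ((2 * (real d - 1)) / real d)))"
    using d' by (intro integrable_gaussian) auto
  then have "integrable lborel (\<lambda>y. 1 * exp (- (real d / (2 * (real d - 1))) * y\<^sup>2))"
    by (simp add: mult.commute)
  then show "g > 0"
    unfolding g_def using gaussian_integral_pos[of "real d / (2 * (real d - 1))" "\<lambda>_. 1"] d' by simp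
  have "integrable lborel (\<lambda>y. exp (- y\<^sup>2 / (4 * (real d - 1))))"
    using d' by (intro integrable_gaussian) auto
  then show "(\<lambda>k. \<integral>y. laplace_kernel d k (y / sqrt (real k)) \<partial>lborel) \<longlonglongrightarrow> g"
    using laplace_limit[OF d, of "\<lambda>_ _. 1" "\<lambda>_. 1" "\<lambda>_. 1"] by (simp add: g_def)
qed

text \<open>The prefactor of \<open>cluster_size_prob_ratio\<close> behaves like
  \<open>\<alpha> / d * k powr (- 2)\<close>, and \<open>\<beta>\<close> is the growth exponent of
  the weighted integral.\<close>

lemma cluster_size_prob_asymp:
  assumes "\<alpha> > 0" "d \<ge> 2" "M > 0"
    and lim: "(\<lambda>k. real k powr (- \<beta>) *
      (\<integral>y. endpoint_weight d \<alpha> (y / sqrt (real k)) * laplace_kernel d k (y / sqrt (real k)) \<partial>lborel))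
      \<longlonglongrightarrow> M"
  shows "\<exists>C>0. cluster_size_prob d \<alpha> \<sim>[at_top] (\<lambda>k. C * real k powr (- (2 - \<beta>)))"
proof -
  define g where "g = (\<integral>y. exp (- (real d / (2 * (real d - 1))) * y\<^sup>2) \<partial>lborel)"
  let ?w = "\<lambda>k. \<integral>y. laplace_kernel d k (y / sqrt (real k)) \<partial>lborel"
  let ?Gw = "\<lambda>k. \<integral>y. endpoint_weight d \<alpha> (y / sqrt (real k)) * laplace_kernel d k (y / sqrt (real k)) \<partial>lborel"
  have g: "g > 0" "?w \<longlonglongrightarrow> g" using kernel_integral_limit[OF assms(2)] by (auto simp: g_def)
  define C where "C = \<alpha> / real d * (M / g)"
  have C: "C > 0" using assms g by (simp add: C_def)
  have "(\<lambda>k. real k / real (d * k + 1)) \<longlonglongrightarrow> inverse (real d)"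
    using assms(2) by real_asymp
  then have "(\<lambda>k. real k / real (d * k + 1)) \<longlonglongrightarrow> 1 / real d"
    by (simp only: inverse_eq_divide)
  from tendsto_mult[OF tendsto_mult[OF tendsto_const this] tendsto_divide[OF lim g(2)]]
  have "(\<lambda>k. \<alpha> * (real k / real (d * k + 1)) * (real k powr (- \<beta>) * ?Gw k / ?w k)) \<longlonglongrightarrow> \<alpha> * (1 / real d) * (M / g)"
    using g(1) by blast
  moreover have "\<forall>\<^sub>F k in sequentially. \<alpha> * (real k / real (d * k + 1)) * (real k powr (- \<beta>) * ?Gw k / ?w k)
      = cluster_size_prob d \<alpha> k / real k powr (- (2 - \<beta>))"
    using eventually_ge_at_top[of 1]
  proof eventually_elim
    case (elim k)
    have "real k powr (- (2 - \<beta>)) = 1 / (real k powr (- \<beta>) * (real k * real k))"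
      using elim by (simp add: powr_diff powr_minus field_simps power2_eq_square)
    then show ?case
      unfolding cluster_size_prob_ratio[OF assms(1,2) elim] using elim by simp
  qed
  ultimately have "(\<lambda>k. cluster_size_prob d \<alpha> k / real k powr (- (2 - \<beta>))) \<longlonglongrightarrow> C"
    unfolding C_def using Lim_transform_eventually by force
  then have "(\<lambda>k. cluster_size_prob d \<alpha> k / real k powr (- (2 - \<beta>)) / C) \<longlonglongrightarrow> C / C"
    using C by (intro tendsto_intros) auto
  then have "cluster_size_prob d \<alpha> \<sim>[at_top] (\<lambda>k. C * real k powr (- (2 - \<beta>)))"
    using C by (intro asymp_equivI') (simp add: mult.commute)
  then show ?thesis using C by blast
qed

lemma integrable_power_density:
  fixes \<alpha> :: real
  assumes "\<alpha> > 0"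
  shows "integrable lborel (\<lambda>s. indicator {0<..<1} s * s powr (- 1 / (1 + \<alpha>)))"
proof -
  have "((\<lambda>x. \<alpha> / (1 + \<alpha>) * x powr (- 1 / (1 + \<alpha>))) has_integral 1) {0<..<1}"
    using powr_density_integral[OF assms] by (simp add: has_integral_Icc_iff_Ioo)
  then have "has_bochner_integral lborel (\<lambda>x. indicator {0<..<1} x * (\<alpha> / (1 + \<alpha>) * x powr (- 1 / (1 + \<alpha>)))) 1"
    using assms by (intro nonneg_has_bochner_integral) auto
  then have "integrable lborel (\<lambda>x. (1 + \<alpha>) / \<alpha> * (indicator {0<..<1} x * (\<alpha> / (1 + \<alpha>) * x powr (- 1 / (1 + \<alpha>)))))"
    by (intro integrable_mult_right) (simp add: has_bochner_integral_iff)
  then show ?thesis using assms by (simp add: mult_ac)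
qed

text \<open>Here \<open>s = x\<close>, so the weight at \<open>y / sqrt k\<close> is
  \<open>k powr (1 / (2 * d))\<close> times \<open>y powr (- 1 / d)\<close>; the power of
  \<open>k\<close> leaves the integral and the remaining singularity is integrable.\<close>

lemma cluster_size_prob_critical:
  assumes "d \<ge> 2" and \<alpha>: "\<alpha> = real d - 1"
  shows "\<exists>C>0. cluster_size_prob d \<alpha> \<sim>[at_top] (\<lambda>k. C * real k powr (- (2 - 1 / (2 * real d))))"
proof -
  define F where "F = (\<lambda>y::real. indicator {0<..} y * y powr (- 1 / real d))"
  define M where "M = (\<integral>y. F y * exp (- (real d / (2 * (real d - 1))) * y\<^sup>2) \<partial>lborel)"
  have d: "real d > 1" and \<alpha>0: "\<alpha> > 0" using assms by auto
  have [measurable]: "F \<in> borel_measurable borel" unfolding F_def by measurable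
  have F0: "F y \<ge> 0" for y by (simp add: F_def)
  \<comment> \<open>Below \<open>1\<close> the power itself is integrable; from \<open>1\<close> on
    it is at most one and the Gaussian dominates.\<close>
  have int: "integrable lborel (\<lambda>y. F y * exp (- y\<^sup>2 / a))" if "a > 0" for a
  proof (rule Bochner_Integration.integrable_bound)
    show "integrable lborel (\<lambda>y. indicator {0<..<1} y * y powr (- 1 / (1 + \<alpha>)) + exp (- y\<^sup>2 / a))"
      by (intro Bochner_Integration.integrable_add integrable_power_density integrable_gaussian \<alpha>0 that)
    show "AE y in lborel. norm (F y * exp (- y\<^sup>2 / a))
        \<le> norm (indicator {0<..<1} y * y powr (- 1 / (1 + \<alpha>)) + exp (- y\<^sup>2 / a))"
    proof (rule AE_I2)
      fix y :: real
      consider "y \<le> 0" | "0 < y" "y < 1" | "y \<ge> 1" by linarith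
      then show "norm (F y * exp (- y\<^sup>2 / a))
          \<le> norm (indicator {0<..<1} y * y powr (- 1 / (1 + \<alpha>)) + exp (- y\<^sup>2 / a))"
      proof cases
        case 1
        then show ?thesis by (simp add: F_def)
      next
        case 2
        have "y powr (- 1 / real d) * exp (- y\<^sup>2 / a) \<le> y powr (- 1 / real d) * 1"
          using that by (intro mult_left_mono) auto
        then show ?thesis using 2 \<alpha> by (simp add: F_def add_increasing2)
      next
        case 3
        have "y powr (- 1 / real d) \<le> y powr 0" using 3 by (intro powr_mono) auto
        then have "y powr (- 1 / real d) * exp (- y\<^sup>2 / a) \<le> 1 * exp (- y\<^sup>2 / a)"
          using 3 by (intro mult_right_mono) auto
        then show ?thesis using 3 by (simp add: F_def)
      qed
    qed
  qed simp
  have "integrable lborel (\<lambda>y. F y * exp (- (real d / (2 * (real d - 1))) * y\<^sup>2))"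
    using int[of "(2 * (real d - 1)) / real d"] d by (simp add: mult.commute)
  then have M: "M > 0"
    unfolding M_def using d F0 by (intro gaussian_integral_pos) (auto simp: F_def)
  have "(\<lambda>k. \<integral>y. F y * laplace_kernel d k (y / sqrt (real k)) \<partial>lborel) \<longlonglongrightarrow> M"
    unfolding M_def
    using laplace_limit[OF assms(1), of "\<lambda>_. F" F F] int[of "4 * (real d - 1)"] F0 d by simp
  moreover have "(\<integral>y. F y * laplace_kernel d k (y / sqrt (real k)) \<partial>lborel)
      = real k powr (- (1 / (2 * real d))) *
        (\<integral>y. endpoint_weight d \<alpha> (y / sqrt (real k)) * laplace_kernel d k (y / sqrt (real k)) \<partial>lborel)"
    if k: "k \<ge> 1" for k
  proof -
    have "F y * laplace_kernel d k (y / sqrt (real k)) = real k powr (- (1 / (2 * real d))) *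
        (endpoint_weight d \<alpha> (y / sqrt (real k)) * laplace_kernel d k (y / sqrt (real k)))" for y
    proof (cases "0 < y \<and> y / sqrt (real k) < 1")
      case True
      define x where "x = y / sqrt (real k)"
      have x: "0 < x" "x < 1" using True k by (auto simp: x_def)
      have "endpoint_weight d \<alpha> x = x powr (- 1 / real d)"
        using d \<alpha> x by (simp add: endpoint_weight_def Let_def)
      moreover have "F y = real k powr (- (1 / (2 * real d))) * x powr (- 1 / real d)"
      proof -
        have "y = real k powr (1 / 2) * x" using k by (simp add: x_def powr_half_sqrt)
        then have "y powr (- 1 / real d) = real k powr (1 / 2 * (- 1 / real d)) * x powr (- 1 / real d)"
          using x k by (simp add: powr_mult powr_powr)
        then show ?thesis using True by (simp add: F_def)
      qed
      ultimately show ?thesis by (simp add: x_def)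
    next
      case False
      \<comment> \<open>\<open>F\<close> lacks the cut at \<open>x < 1\<close> that the weight has,
        but the kernel vanishes beyond it.\<close>
      have "F y = 0 \<or> laplace_kernel d k (y / sqrt (real k)) = 0"
        using False by (auto simp: F_def laplace_kernel_def)
      moreover have "endpoint_weight d \<alpha> (y / sqrt (real k)) = 0"
        using False k d \<alpha> by (auto simp: endpoint_weight_def Let_def indicator_def zero_less_divide_iff)
      ultimately show ?thesis by auto
    qed
    then show ?thesis by (simp only: integral_mult_right_zero)
  qed
  then have "\<forall>\<^sub>F k in sequentially. (\<integral>y. F y * laplace_kernel d k (y / sqrt (real k)) \<partial>lborel)
      = real k powr (- (1 / (2 * real d))) *
        (\<integral>y. endpoint_weight d \<alpha> (y / sqrt (real k)) * laplace_kernel d k (y / sqrt (real k)) \<partial>lborel)"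
    by (rule eventually_sequentiallyI)
  ultimately have "(\<lambda>k. real k powr (- (1 / (2 * real d))) *
      (\<integral>y. endpoint_weight d \<alpha> (y / sqrt (real k)) * laplace_kernel d k (y / sqrt (real k)) \<partial>lborel))
      \<longlonglongrightarrow> M"
    by (rule Lim_transform_eventually)
  from cluster_size_prob_asymp[OF \<alpha>0 assms(1) M this] show ?thesis .
qed

text \<open>The weight is continuous at the peak, so only its value there survives. Its singularity
  at a positive distance rules out a constant bound on the whole line; hence the split into a near
  and a far part.\<close>

lemma cluster_size_prob_slow_freezing:
  assumes "\<alpha> > 0" and \<alpha>: "\<alpha> < real d - 1"
  shows "\<exists>C>0. cluster_size_prob d \<alpha> \<sim>[at_top] (\<lambda>k. C * real k powr (- 2))"
proof -
  \<comment> \<open>\<open>s0\<close> is the value of \<open>s\<close> at the peak, and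
    \<open>\<delta>\<close> is half the distance from the peak to the singularity, so that
    \<open>s \<ge> s0 / 2\<close> on the near part.\<close>
  define b s0 \<delta> where "b = 1 + \<alpha>" and "s0 = 1 - b / real d" and "\<delta> = s0 * real d / (2 * b)"
  have d: "d \<ge> 2" "real d > 1" and b: "b > 1" "b < real d" using assms by (auto simp: b_def)
  have s0: "0 < s0" "s0 < 1" using b d by (auto simp: s0_def)
  have \<delta>: "\<delta> > 0" using s0 b d by (simp add: \<delta>_def)
  let ?G = "endpoint_weight d \<alpha>" and ?w = "\<lambda>k y. laplace_kernel d k (y / sqrt (real k))"
  have G: "?G x = indicator {0<..<1} (s0 + b / real d * x) * (s0 + b / real d * x) powr (- 1 / b)" for x
  proof -
    have "1 - (1 + \<alpha>) / real d * (1 - x) = s0 + b / real d * x"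
      by (simp add: s0_def b_def right_diff_distrib)
    then show ?thesis by (simp add: endpoint_weight_def Let_def b_def)
  qed
  have G0: "0 \<le> ?G x" for x by (simp add: G)
  define near far where "near = (\<lambda>x. indicator {- \<delta>..} x * ?G x)" and "far = (\<lambda>x. indicator {..<- \<delta>} x * ?G x)"
  have [measurable]: "near \<in> borel_measurable borel" "far \<in> borel_measurable borel"
    unfolding near_def far_def by measurable
  have split: "?G x = near x + far x" for x by (auto simp: near_def far_def indicator_def)
  have near_le: "\<bar>near x\<bar> \<le> (s0 / 2) powr (- 1 / b)" for x
  proof (cases "x \<ge> - \<delta> \<and> s0 + b / real d * x \<in> {0<..<1}")
    case True
    then have "b / real d * (- \<delta>) \<le> b / real d * x"
      using b d by (intro mult_left_mono) auto
    moreover have "b / real d * (- \<delta>) = - (s0 / 2)" using b d by (simp add: \<delta>_def)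
    ultimately have "s0 / 2 \<le> s0 + b / real d * x" by linarith
    then have "(s0 + b / real d * x) powr (- 1 / b) \<le> (s0 / 2) powr (- 1 / b)"
      using s0 b by (intro powr_mono2') auto
    then show ?thesis using True by (simp add: near_def G)
  qed (auto simp: near_def G indicator_def)
  define g M where "g = (\<integral>y. exp (- (real d / (2 * (real d - 1))) * y\<^sup>2) \<partial>lborel)"
    and "M = s0 powr (- 1 / b)"
  have g: "g > 0" using kernel_integral_limit(1)[OF d(1)] by (simp add: g_def)
  have "(\<lambda>k. \<integral>y. near (y / sqrt (real k)) * ?w k y \<partial>lborel)
      \<longlonglongrightarrow> (\<integral>y. M * exp (- real d / (2 * (real d - 1)) * y\<^sup>2) \<partial>lborel)"
  proof (rule laplace_limit[OF d(1), where H = "\<lambda>_. (s0 / 2) powr (- 1 / b)"])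
    show "integrable lborel (\<lambda>y. (s0 / 2) powr (- 1 / b) * exp (- y\<^sup>2 / (4 * (real d - 1))))"
      using d by (intro integrable_mult_right integrable_gaussian) auto
    show "(\<lambda>k. near (y / sqrt (real k))) \<longlonglongrightarrow> M" for y
    proof -
      have x: "(\<lambda>k. y / sqrt (real k)) \<longlonglongrightarrow> 0" by real_asymp
      then have "(\<lambda>k. s0 + b / real d * (y / sqrt (real k))) \<longlonglongrightarrow> s0 + b / real d * 0"
        by (intro tendsto_intros)
      then have s: "(\<lambda>k. s0 + b / real d * (y / sqrt (real k))) \<longlonglongrightarrow> s0" by simp
      then have "(\<lambda>k. (s0 + b / real d * (y / sqrt (real k))) powr (- 1 / b)) \<longlonglongrightarrow> M"
        unfolding M_def using s0 by (intro tendsto_intros) auto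
      moreover have "\<forall>\<^sub>F k in sequentially. (s0 + b / real d * (y / sqrt (real k))) powr (- 1 / b) = near (y / sqrt (real k))"
        using order_tendstoD(1)[OF x, of "- \<delta>", simplified, OF \<delta>]
          order_tendstoD(1)[OF s s0(1)] order_tendstoD(2)[OF s s0(2)]
        by eventually_elim (simp only: near_def G, simp)
      ultimately show ?thesis by (rule Lim_transform_eventually)
    qed
  qed (use near_le in auto)
  then have near: "(\<lambda>k. \<integral>y. near (y / sqrt (real k)) * ?w k y \<partial>lborel) \<longlonglongrightarrow> M * g"
    by (simp add: g_def)
  define J where "J = (\<integral>x. ?G x \<partial>lborel)"
  have Gint: "integrable lborel ?G"
    unfolding G
    using integrable_power_density[OF assms(1)] b d
    by (subst lborel_integrable_real_affine_iff[where f = "\<lambda>s. indicator {0<..<1} s * s powr (- 1 / b)"])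
       (auto simp: b_def)
  have Gk: "integrable lborel (\<lambda>y. ?G (y / sqrt (real k)))"
    "(\<integral>y. ?G (y / sqrt (real k)) \<partial>lborel) = sqrt (real k) * J" if "k \<ge> 1" for k
    using lborel_integrable_real_affine_iff[of "1 / sqrt (real k)" ?G 0] Gint that
      lborel_integral_real_affine[of "1 / sqrt (real k)" ?G 0] by (auto simp: J_def)
  \<comment> \<open>A bound for the kernel beyond \<open>\<delta>\<close>, exponentially small in
    \<open>k\<close>; the weight is integrable and rescaling it costs only
    \<open>sqrt k\<close>.\<close>
  define e where "e = (\<lambda>k. 2 ^ d * exp (- (\<delta>\<^sup>2 * real k) / (4 * (real d - 1))))"
  have far_le: "far (y / sqrt (real k)) * ?w k y \<le> e k * ?G (y / sqrt (real k))" if k: "k \<ge> 2" for k y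
  proof (cases "y / sqrt (real k) < - \<delta>")
    case True
    have "\<delta>\<^sup>2 \<le> (y / sqrt (real k))\<^sup>2"
      using True \<delta> by (intro abs_le_square_iff[THEN iffD1]) linarith
    then have "\<delta>\<^sup>2 * real k \<le> y\<^sup>2" using k by (simp add: power_divide field_simps)
    then have "2 ^ d * exp (- y\<^sup>2 / (4 * (real d - 1))) \<le> e k"
      unfolding e_def using d by (auto simp: divide_right_mono)
    then have "?w k y \<le> e k" using laplace_kernel_le[OF d(1) k, of y] by linarith
    then show ?thesis
      using True G0[of "y / sqrt (real k)"] mult_left_mono by (fastforce simp: far_def mult.commute)
  qed (use G0 in \<open>simp add: far_def e_def\<close>)
  have far0: "0 \<le> far (y / sqrt (real k)) * ?w k y" for k y
    using G0 laplace_kernel_nonneg[OF d(1)] by (simp add: far_def)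
  have far_int: "integrable lborel (\<lambda>y. far (y / sqrt (real k)) * ?w k y)" if "k \<ge> 2" for k
  proof (rule Bochner_Integration.integrable_bound)
    show "integrable lborel (\<lambda>y. e k * ?G (y / sqrt (real k)))"
      using Gk(1)[of k] that by simp
    show "AE y in lborel. norm (far (y / sqrt (real k)) * ?w k y) \<le> norm (e k * ?G (y / sqrt (real k)))"
    proof (rule AE_I2)
      fix y
      have "norm (far (y / sqrt (real k)) * ?w k y) = far (y / sqrt (real k)) * ?w k y"
        using far0[where k = k and y = y] by (simp only: real_norm_def abs_of_nonneg)
      also have "\<dots> \<le> e k * ?G (y / sqrt (real k))" by (rule far_le[OF that])
      also have "\<dots> \<le> norm (e k * ?G (y / sqrt (real k)))" by (simp only: real_norm_def abs_ge_self)
      finally show "norm (far (y / sqrt (real k)) * ?w k y) \<le> norm (e k * ?G (y / sqrt (real k)))" .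
    qed
  qed simp
  have far_upper: "(\<integral>y. far (y / sqrt (real k)) * ?w k y \<partial>lborel) \<le> e k * (sqrt (real k) * J)" if "k \<ge> 2" for k
  proof -
    have "(\<integral>y. far (y / sqrt (real k)) * ?w k y \<partial>lborel) \<le> (\<integral>y. e k * ?G (y / sqrt (real k)) \<partial>lborel)"
      using far_le[OF that] far_int[OF that] Gk(1)[of k] that by (intro integral_mono) auto
    then show ?thesis using Gk(2)[of k] that by simp
  qed
  have far_lower: "(\<integral>y. far (y / sqrt (real k)) * ?w k y \<partial>lborel) \<ge> 0" for k
    by (intro integral_nonneg_AE AE_I2 far0)
  have e_lim: "(\<lambda>k. e k * (sqrt (real k) * J)) \<longlonglongrightarrow> 0"
  proof -
    define q where "q = \<delta>\<^sup>2 / (4 * (real d - 1))"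
    have "q > 0" using \<delta> d by (simp add: q_def)
    then have "(\<lambda>k. 2 ^ d * exp (- (q * real k)) * (sqrt (real k) * J)) \<longlonglongrightarrow> 0" by real_asymp
    then show ?thesis by (simp add: e_def q_def)
  qed
  have far: "(\<lambda>k. \<integral>y. far (y / sqrt (real k)) * ?w k y \<partial>lborel) \<longlonglongrightarrow> 0"
    by (rule tendsto_sandwich[OF always_eventually[OF allI[OF far_lower]]
          eventually_sequentiallyI[OF far_upper] tendsto_const e_lim])
  have near_int: "integrable lborel (\<lambda>y. near (y / sqrt (real k)) * ?w k y)" if "k \<ge> 2" for k
  proof (rule Bochner_Integration.integrable_bound)
    show "integrable lborel (\<lambda>y. (s0 / 2) powr (- 1 / b) * (2 ^ d * exp (- y\<^sup>2 / (4 * (real d - 1)))))"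
      using d by (intro integrable_mult_right integrable_gaussian) auto
    show "AE y in lborel. norm (near (y / sqrt (real k)) * ?w k y)
        \<le> norm ((s0 / 2) powr (- 1 / b) * (2 ^ d * exp (- y\<^sup>2 / (4 * (real d - 1)))))"
      using near_le laplace_kernel_le[OF d(1) that] laplace_kernel_nonneg[OF d(1)]
      by (intro AE_I2) (auto simp: abs_mult intro!: mult_mono)
  qed simp
  have "(\<lambda>k. (\<integral>y. near (y / sqrt (real k)) * ?w k y \<partial>lborel) + (\<integral>y. far (y / sqrt (real k)) * ?w k y \<partial>lborel))
      \<longlonglongrightarrow> M * g + 0"
    by (intro tendsto_add near far)
  moreover have "(\<integral>y. near (y / sqrt (real k)) * ?w k y \<partial>lborel) + (\<integral>y. far (y / sqrt (real k)) * ?w k y \<partial>lborel)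
      = real k powr (- 0) * (\<integral>y. ?G (y / sqrt (real k)) * ?w k y \<partial>lborel)" if "k \<ge> 2" for k
    using near_int[OF that] far_int[OF that] that by (simp add: split distrib_right)
  then have "\<forall>\<^sub>F k in sequentially. (\<integral>y. near (y / sqrt (real k)) * ?w k y \<partial>lborel) + (\<integral>y. far (y / sqrt (real k)) * ?w k y \<partial>lborel)
      = real k powr (- 0) * (\<integral>y. ?G (y / sqrt (real k)) * ?w k y \<partial>lborel)"
    by (rule eventually_sequentiallyI)
  ultimately have "(\<lambda>k. real k powr (- 0) * (\<integral>y. ?G (y / sqrt (real k)) * ?w k y \<partial>lborel)) \<longlonglongrightarrow> M * g + 0"
    by (rule Lim_transform_eventually)
  from cluster_size_prob_asymp[OF assms(1) d(1) _ this] show ?thesis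
    using g s0 by (simp add: M_def)
qed

text \<open>\<open>u * (1 - u) ^ (d - 1)\<close> increases up to \<open>1 / d\<close>. In place of a
  derivative, Bernoulli's inequality is applied to the power of
  \<open>1 - z = (1 - v) / (1 - u)\<close>.\<close>

lemma offspring_base_strict_mono:
  fixes u v :: real
  assumes "0 < u" "u < v" "real d * v \<le> 1" "d \<ge> 1" "v < 1"
  shows "u * (1 - u) ^ (d - 1) < v * (1 - v) ^ (d - 1)"
proof -
  define z where "z = (v - u) / (1 - u)"
  have z: "0 \<le> z" "z \<le> 1" using assms by (auto simp: z_def field_simps)
  have "(real d - 1) * v < 1 - u" using assms by (simp add: algebra_simps)
  then have "(v - u) * ((real d - 1) * v) < (v - u) * (1 - u)"
    using assms by (intro mult_strict_left_mono) auto
  then have "(real d - 1) * z < 1 - u / v"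
    using assms by (simp add: z_def field_simps)
  moreover have "1 + real (d - 1) * (- z) \<le> (1 + (- z)) ^ (d - 1)"
    using z by (intro Bernoulli_inequality) auto
  ultimately have "u / v < (1 - z) ^ (d - 1)" using assms by (simp add: of_nat_diff)
  also have "1 - z = (1 - v) / (1 - u)" using assms by (simp add: z_def field_simps)
  finally show ?thesis using assms by (simp add: power_divide field_simps)
qed

text \<open>Let \<open>h u = u * (1 - u) ^ (d - 1)\<close>. The integral only sees
  \<open>u \<le> a < 1 / d\<close> and is at most \<open>h a ^ (k - 1)\<close>, while the number of
  shapes is at most a constant times \<open>1 / h p ^ (k - 1)\<close>. Any \<open>p\<close> with
  \<open>h p > h a\<close> gives geometric decay.\<close>

lemma cluster_size_prob_exponential:
  assumes d: "d \<ge> 1" and \<alpha>: "\<alpha> > real d - 1" "\<alpha> > 0"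
  shows "\<exists>K>0. \<exists>lam>0. \<forall>k. cluster_size_prob d \<alpha> k \<le> K * exp (- lam * real k)"
proof -
  define h where "h = (\<lambda>u::real. u * (1 - u) ^ (d - 1))"
  define a where "a = 1 / (1 + \<alpha>)"
  \<comment> \<open>\<open>p = 1 / d\<close> would maximise \<open>h p\<close>, but for
    \<open>d = 1\<close> it makes \<open>(1 - p) ^ d\<close> vanish; a point strictly between serves
    every \<open>d\<close>.\<close>
  obtain p where p: "a < p" "p < 1 / real d"
    using dense[of a "1 / real d"] \<alpha> d by (auto simp: a_def field_simps)
  have a: "0 < a" using \<alpha> by (simp add: a_def)
  have "1 / real d \<le> 1" using d by simp
  then have p1: "p < 1" using p by simp
  have dp: "real d * p \<le> 1" using p d by (simp add: field_simps)
  define \<rho> where "\<rho> = h a / h p"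
  have h: "0 < h a" "h a < h p"
    using a p p1 offspring_base_strict_mono[OF a p(1) dp d p1] by (auto simp: h_def)
  have h_mono: "h u \<le> h a" if u: "0 \<le> u" "u \<le> a" for u
  proof -
    consider "u = 0" | "u = a" | "0 < u" "u < a" using u by linarith
    then show ?thesis
    proof cases
      case 3
      have "real d * a \<le> real d * p" using p d by (intro mult_left_mono) auto
      then have "real d * a \<le> 1" using dp by linarith
      then show ?thesis
        using offspring_base_strict_mono[of u a d] 3 p p1 d unfolding h_def by simp
    qed (use h in \<open>auto simp: h_def\<close>)
  qed
  have \<rho>: "0 < \<rho>" "\<rho> < 1" using h by (auto simp: \<rho>_def)
  \<comment> \<open>The additional \<open>1 / \<rho>\<close> turns \<open>\<rho> ^ (k - 1)\<close>
    into \<open>\<rho> ^ k\<close>.\<close>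
  define K where "K = 1 / (\<rho> * (1 - p) ^ d)"
  have K: "K > 0" using \<rho> p1 by (simp add: K_def)
  have bound: "cluster_size_prob d \<alpha> k \<le> \<rho> ^ (k - 1) / (1 - p) ^ d" if k: "k \<ge> 1" for k
  proof -
    let ?m = "d * k + 1 - k" and ?N = "real (d * k choose (k - 1))"
    have base: "u ^ (k - 1) * (1 - u) ^ ?m = h u ^ (k - 1) * (1 - u) ^ d" for u
      unfolding exponent_split[OF d k] h_def power_mult_distrib power_add power_mult by simp
    have dk: "k \<le> d * k" using mult_le_mono1[of 1 d k] d by simp
    have N: "?N \<le> 1 / (h p ^ (k - 1) * (1 - p) ^ d)"
    proof -
      \<comment> \<open>A single term of the binomial expansion of
        \<open>(p + (1 - p)) ^ (d * k) = 1\<close>.\<close>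
      have "?N * p ^ (k - 1) * (1 - p) ^ (d * k - (k - 1)) \<le> (\<Sum>j\<le>d * k. real (d * k choose j) * p ^ j * (1 - p) ^ (d * k - j))"
        using order.trans[OF diff_le_self dk] p a p1 by (intro member_le_sum) auto
      also have "\<dots> = (p + (1 - p)) ^ (d * k)" by (rule binomial_ring[symmetric])
      finally have "?N * (h p ^ (k - 1) * (1 - p) ^ d) \<le> 1"
        using base[of p] dk k by (simp add: mult.assoc)
      then show ?thesis using h p1 by (simp add: field_simps)
    qed
    have "integral {0..1} (final_density \<alpha> (k - 1) ?m)
        \<le> integral {0..1} (\<lambda>x. h a ^ (k - 1) * (\<alpha> / (1 + \<alpha>) * x powr (- 1 / (1 + \<alpha>))))"
    proof (intro integral_le final_density_integrable \<alpha>)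
      show "(\<lambda>x. h a ^ (k - 1) * (\<alpha> / (1 + \<alpha>) * x powr (- 1 / (1 + \<alpha>)))) integrable_on {0..1}"
        using has_integral_mult_right[OF powr_density_integral[OF \<alpha>(2)], of "h a ^ (k - 1)"] by blast
      fix x :: real assume x: "x \<in> {0..1}"
      define u where "u = (1 - x) / (1 + \<alpha>)"
      have u: "0 \<le> u" "u \<le> a" "u \<le> 1" using x \<alpha> by (auto simp: u_def a_def field_simps)
      have "h u ^ (k - 1) * (1 - u) ^ d \<le> h a ^ (k - 1) * 1"
        using u h h_mono[OF u(1,2)] by (intro mult_mono power_mono power_le_one) (auto simp: h_def)
      then have "\<alpha> / (1 + \<alpha>) * x powr (- 1 / (1 + \<alpha>)) * (u ^ (k - 1) * (1 - u) ^ ?m)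
          \<le> \<alpha> / (1 + \<alpha>) * x powr (- 1 / (1 + \<alpha>)) * h a ^ (k - 1)"
        unfolding base using \<alpha> by (intro mult_left_mono) auto
      then show "final_density \<alpha> (k - 1) ?m x \<le> h a ^ (k - 1) * (\<alpha> / (1 + \<alpha>) * x powr (- 1 / (1 + \<alpha>)))"
        unfolding final_density_def u_def[symmetric] by (simp only: mult_ac)
    qed
    also have "\<dots> = h a ^ (k - 1)"
      using integral_unique[OF has_integral_mult_right[OF powr_density_integral[OF \<alpha>(2)], of "h a ^ (k - 1)"]]
      by (simp only: mult_1_right)
    finally have I: "integral {0..1} (final_density \<alpha> (k - 1) ?m) \<le> h a ^ (k - 1)" .
    have I0: "0 \<le> integral {0..1} (final_density \<alpha> (k - 1) ?m)"
      using final_density_bounds(1)[OF \<alpha>(2)] final_density_integrable[OF \<alpha>(2)] by (intro integral_nonneg) auto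
    have "?N / real k \<le> ?N" using k by (simp add: divide_le_eq mult_le_cancel_left1)
    then have "cluster_size_prob d \<alpha> k \<le> (1 / (h p ^ (k - 1) * (1 - p) ^ d)) * h a ^ (k - 1)"
      unfolding cluster_size_prob_def using N I I0 h p1 by (intro mult_mono) auto
    then show ?thesis by (simp add: \<rho>_def power_divide)
  qed
  have "cluster_size_prob d \<alpha> k \<le> K * exp (- (- ln \<rho>) * real k)" for k
  proof (cases "k = 0")
    case True
    then show ?thesis using K by (simp add: cluster_size_prob_def)
  next
    case False
    have "exp (- (- ln \<rho>) * real k) = \<rho> ^ k"
      using \<rho> by (simp add: exp_of_nat2_mult)
    moreover have "\<rho> ^ (k - 1) / (1 - p) ^ d = K * \<rho> ^ k"
      using False \<rho> by (cases k) (auto simp: K_def)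
    ultimately show ?thesis using bound[of k] False by simp
  qed
  moreover have "- ln \<rho> > 0" using \<rho> by simp
  ultimately show ?thesis using K by blast
qed

theorem theorem4p1:
  fixes d :: nat and \<alpha> :: real
  assumes "d \<ge> 1" and "\<alpha> > 0"
  shows
    "(\<alpha> < real d - 1 \<longrightarrow>
       (\<exists>C>0. \<forall>\<mu>. pcf_law (d_ary_tree d) \<alpha> \<mu> \<longrightarrow>
         (\<lambda>k. measure \<mu> (root_cluster_size \<mu> k)) \<sim>[at_top]
         (\<lambda>k. C * real k powr (- 2)))) \<and>
     (\<alpha> = real d - 1 \<longrightarrow>
       (\<exists>C>0. \<forall>\<mu>. pcf_law (d_ary_tree d) \<alpha> \<mu> \<longrightarrow>
         (\<lambda>k. measure \<mu> (root_cluster_size \<mu> k)) \<sim>[at_top]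
         (\<lambda>k. C * real k powr (- (2 - 1 / (2 * real d)))))) \<and>
     (\<alpha> > real d - 1 \<longrightarrow>
       (\<exists>K>0. \<exists>lam>0. \<forall>\<mu>. pcf_law (d_ary_tree d) \<alpha> \<mu> \<longrightarrow>
         (\<forall>k. measure \<mu> (root_cluster_size \<mu> k) \<le> K * exp (- lam * real k))))"
proof (intro conjI impI)
  \<comment> \<open>\<open>cluster_size_prob\<close> does not mention \<open>\<mu>\<close>, which is
    why the constants can be chosen before the law.\<close>
  note prob = measure_root_cluster_size[OF assms]
  show "\<exists>C>0. \<forall>\<mu>. pcf_law (d_ary_tree d) \<alpha> \<mu> \<longrightarrow>
      (\<lambda>k. measure \<mu> (root_cluster_size \<mu> k)) \<sim>[at_top] (\<lambda>k. C * real k powr (- 2))"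
    if "\<alpha> < real d - 1"
    using cluster_size_prob_slow_freezing[OF assms(2) that] by (auto simp: prob)
  show "\<exists>C>0. \<forall>\<mu>. pcf_law (d_ary_tree d) \<alpha> \<mu> \<longrightarrow>
      (\<lambda>k. measure \<mu> (root_cluster_size \<mu> k)) \<sim>[at_top] (\<lambda>k. C * real k powr (- (2 - 1 / (2 * real d))))"
    if "\<alpha> = real d - 1"
    \<comment> \<open>\<open>\<alpha> > 0\<close> and \<open>\<alpha> = d - 1\<close> force
      \<open>d \<ge> 2\<close>.\<close>
    using cluster_size_prob_critical[OF _ that] assms that by (auto simp: prob)
  show "\<exists>K>0. \<exists>lam>0. \<forall>\<mu>. pcf_law (d_ary_tree d) \<alpha> \<mu> \<longrightarrow>
      (\<forall>k. measure \<mu> (root_cluster_size \<mu> k) \<le> K * exp (- lam * real k))"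
    if "\<alpha> > real d - 1"
    using cluster_size_prob_exponential[OF assms(1) that assms(2)] by (auto simp: prob)
qed

end
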